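(* Let $(M,J,g)$ be a compact connected quasi Kähler manifold. Suppose that the second Ricci curvature $R''$ of the canonical connection is quasi positive and that the $(2,0)$-part of the curvature tensor of the canonical connection $\nabla$ is parallel with respect to $\nabla$. Then $(M,J,g)$ is Kähler.
   Context: An almost Hermitian manifold $(M,J,g)$ is a manifold $M$ of real dimension $2n$ with an almost complex structure $J$ and a Riemannian metric $g$ satisfying $g(JX,JY)=g(X,Y)$. Its fundamental form is $\omega_g(X,Y)=g(JX,Y)$. It is quasi Kähler if $\bar\partial\omega_g=0$, where $\bar\partial\omega_g$ is the $(1,2)$-part of $d\omega_g$; Kähler if $J$ is integrable and $d\omega_g=0$. Write $\langle\cdot,\cdot\rangle$ for the complex bilinear extension of $g$ to $TM\otimes\mathbb C$. The torsion of a connection $\nabla$ is $\tau(X,Y)=\nabla_XY-\nabla_YX-[X,Y]$. The canonical connection $\nabla$ is the unique connection with $\nabla g=0$, $\nabla J=0$ and $\tau(X,\overline Y)=0$ for all $(1,0)$-vectors $X,Y$ (tensors and connections are extended complex linearly). Curvature of the canonical connection: $R(X,Y)Z=\nabla_X\nabla_YZ-\nabla_Y\nabla_XZ-\nabla_{[X,Y]}Z$ and $R(X,Y,Z,W)=\langle R(Z,W)X,Y\rangle$. For a local unitary $(1,0)$-frame $(e_1,\dots,e_n)$ (i.e. a local frame of $T^{1,0}M$ with $\langle e_i,\overline{e_j}\rangle=\delta_{ij}$), put $e_{\bar i}=\overline{e_i}$ and $R_{ABCD}=R(e_A,e_B,e_C,e_D)$ for $A,B,C,D\in\{1,\bar1,\dots,n,\bar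 n\}$. The $(2,0)$-part of the curvature tensor is the part with components $R_{i\bar jkl}$ ($i,j,k,l\in\{1,\dots,n\}$), i.e. the last two arguments are of type $(1,0)$. The second Ricci curvature is the Hermitian form $R''_{i\bar j}=\sum_{\lambda=1}^nR_{i\bar j\lambda\bar\lambda}$. It is quasi positive if it is positive semidefinite at every point of $M$ and positive definite at some point of $M$. *)

theory Defs
  imports "HOL-Analysis.Analysis" "HOL-Library.Function_Algebras"
begin

section \<open>Smooth manifolds\<close>

text \<open>Meaningful for open \<open>U\<close>: \<open>f\<close> is \<open>k\<close> times continuously differentiable on \<open>U\<close>.\<close>

fun Ck_on :: "nat \<Rightarrow> 'e::euclidean_space set \<Rightarrow> ('e \<Rightarrow> 'b::real_normed_vector) \<Rightarrow> bool" where
  "Ck_on 0 U f \<longleftrightarrow> continuous_on U f"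
| "Ck_on (Suc k) U f \<longleftrightarrow> (\<forall>x\<in>U. f differentiable (at x)) \<and>
     (\<forall>v. Ck_on k U (\<lambda>x. frechet_derivative f (at x) v))"

definition Cinf_on :: "'e::euclidean_space set \<Rightarrow> ('e \<Rightarrow> 'b::real_normed_vector) \<Rightarrow> bool" where
  "Cinf_on U f \<longleftrightarrow> (\<forall>k. Ck_on k U f)"

type_synonym ('a, 'e) chart = "'a set \<times> ('a \<Rightarrow> 'e)"

text \<open>
  Everything of tensorial nature below lives on the complexified tangent bundle. A complex
  tangent vector at \<open>p\<close> is a complex-linear derivation of the algebra of germs at \<open>p\<close> of smooth
  complex-valued functions. Functions on the manifold are represented by total functions; a
  tangent vector takes the value 0 on those that are not smooth near its base point, which makes
  equality of tangent vectors extensional. Sums, differences and 0 are the pointwise ones of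
  \<^theory>\<open>HOL-Library.Function_Algebras\<close>.
\<close>

type_synonym 'a tvec = "('a \<Rightarrow> complex) \<Rightarrow> complex"
type_synonym 'a vfield = "'a \<Rightarrow> 'a tvec"

definition cscale :: "complex \<Rightarrow> 'a tvec \<Rightarrow> 'a tvec"  (infixr "\<odot>" 75) where
  "c \<odot> v = (\<lambda>f. c * v f)"

text \<open>Complex conjugation on the complexified tangent space; its fixed vectors are the real
  tangent vectors.\<close>

definition conj_vec :: "'a tvec \<Rightarrow> 'a tvec" where
  "conj_vec v = (\<lambda>f. cnj (v (\<lambda>q. cnj (f q))))"

definition conj_field :: "'a vfield \<Rightarrow> 'a vfield" where
  "conj_field X = (\<lambda>p. conj_vec (X p))"

locale smooth_manifold =
  fixes T :: "'a topology" and A :: "('a, 'e::euclidean_space) chart set"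
  assumes Hausdorff: "Hausdorff_space T"
    and second_countable: "second_countable T"
    and chart: "\<And>U \<phi>. (U, \<phi>) \<in> A \<Longrightarrow>
      openin T U \<and> open (\<phi> ` U) \<and> homeomorphic_map (subtopology T U) (top_of_set (\<phi> ` U)) \<phi>"
    and cover: "topspace T = (\<Union>(U, \<phi>)\<in>A. U)"
    and compatible: "\<And>U \<phi> V \<psi>. (U, \<phi>) \<in> A \<Longrightarrow> (V, \<psi>) \<in> A \<Longrightarrow>
      Cinf_on (\<phi> ` (U \<inter> V)) (\<psi> \<circ> inv_into U \<phi>)"
begin

text \<open>For open \<open>W\<close>: smoothness of \<open>f\<close> on \<open>W\<close>, whatever the values of \<open>f\<close> elsewhere.\<close>

definition smooth_fun :: "'a set \<Rightarrow> ('a \<Rightarrow> complex) \<Rightarrow> bool" where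
  "smooth_fun W f \<longleftrightarrow> (\<forall>(U, \<phi>)\<in>A. Cinf_on (\<phi> ` (U \<inter> W)) (f \<circ> inv_into U \<phi>))"

definition smooth_near :: "'a \<Rightarrow> ('a \<Rightarrow> complex) \<Rightarrow> bool" where
  "smooth_near p f \<longleftrightarrow> (\<exists>W. openin T W \<and> p \<in> W \<and> smooth_fun W f)"

definition same_germ :: "'a \<Rightarrow> ('a \<Rightarrow> complex) \<Rightarrow> ('a \<Rightarrow> complex) \<Rightarrow> bool" where
  "same_germ p f h \<longleftrightarrow> (\<exists>W. openin T W \<and> p \<in> W \<and> (\<forall>q\<in>W. f q = h q))"

definition tangent_space :: "'a \<Rightarrow> 'a tvec set" where
  "tangent_space p = {v.
     (\<forall>f. \<not> smooth_near p f \<longrightarrow> v f = 0) \<and>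
     (\<forall>f h. smooth_near p f \<and> smooth_near p h \<and> same_germ p f h \<longrightarrow> v f = v h) \<and>
     (\<forall>f h. smooth_near p f \<and> smooth_near p h \<longrightarrow> v (\<lambda>q. f q + h q) = v f + v h) \<and>
     (\<forall>c f. smooth_near p f \<longrightarrow> v (\<lambda>q. c * f q) = c * v f) \<and>
     (\<forall>f h. smooth_near p f \<and> smooth_near p h \<longrightarrow>
        v (\<lambda>q. f q * h q) = f p * v h + h p * v f)}"

text \<open>For open \<open>W\<close>: \<open>X\<close> is a smooth complex vector field on \<open>W\<close>, i.e. a smooth section of the
  complexified tangent bundle over \<open>W\<close>; its values outside \<open>W\<close> are irrelevant.\<close>

definition field_on :: "'a set \<Rightarrow> 'a vfield \<Rightarrow> bool" where
  "field_on W X \<longleftrightarrow> (\<forall>p\<in>W. X p \<in> tangent_space p) \<and>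
     (\<forall>V f. openin T V \<and> V \<subseteq> W \<and> smooth_fun V f \<longrightarrow> smooth_fun V (\<lambda>p. X p f))"

text \<open>The Lie bracket. The case distinction keeps to the convention that tangent vectors vanish
  on functions that are not smooth near the base point.\<close>

definition bracket :: "'a vfield \<Rightarrow> 'a vfield \<Rightarrow> 'a vfield" where
  "bracket X Y = (\<lambda>p f.
     if smooth_near p f then X p (\<lambda>q. Y q f) - Y p (\<lambda>q. X q f) else 0)"

text \<open>The exterior derivative of a 2-form \<open>\<alpha>\<close>, evaluated on three vector fields.\<close>

definition ext_d :: "('a \<Rightarrow> 'a tvec \<Rightarrow> 'a tvec \<Rightarrow> complex) \<Rightarrow>
    'a vfield \<Rightarrow> 'a vfield \<Rightarrow> 'a vfield \<Rightarrow> 'a \<Rightarrow> complex" where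
  "ext_d \<alpha> X Y Z p =
     X p (\<lambda>q. \<alpha> q (Y q) (Z q)) - Y p (\<lambda>q. \<alpha> q (X q) (Z q)) + Z p (\<lambda>q. \<alpha> q (X q) (Y q))
     - \<alpha> p (bracket X Y p) (Z p) + \<alpha> p (bracket X Z p) (Y p) - \<alpha> p (bracket Y Z p) (X p)"

text \<open>
  A connection on the tangent bundle, extended complex bilinearly to complex vector fields and
  acting on local sections over open sets. The condition \<open>real\<close> says that it is the complex
  extension of a connection on the real tangent bundle.
\<close>

definition affine_connection :: "('a vfield \<Rightarrow> 'a vfield \<Rightarrow> 'a vfield) \<Rightarrow> bool" where
  "affine_connection nabla \<longleftrightarrow>
    (\<forall>W X X' Y Y' f. openin T W \<and> field_on W X \<and> field_on W X' \<and> field_on W Y \<and> field_on W Y' \<and>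
        smooth_fun W f \<longrightarrow>
      field_on W (nabla X Y) \<and>
      ((\<forall>q\<in>W. X q = X' q \<and> Y q = Y' q) \<longrightarrow> (\<forall>p\<in>W. nabla X Y p = nabla X' Y' p)) \<and>
      (\<forall>p\<in>W.
        nabla (X + X') Y p = nabla X Y p + nabla X' Y p \<and>
        nabla (\<lambda>q. f q \<odot> X q) Y p = f p \<odot> nabla X Y p \<and>
        nabla X (Y + Y') p = nabla X Y p + nabla X Y' p \<and>
        nabla X (\<lambda>q. f q \<odot> Y q) p = X p f \<odot> Y p + f p \<odot> nabla X Y p \<and>
        nabla (conj_field X) (conj_field Y) p = conj_vec (nabla X Y p)))"

definition torsion :: "('a vfield \<Rightarrow> 'a vfield \<Rightarrow> 'a vfield) \<Rightarrow> 'a vfield \<Rightarrow> 'a vfield \<Rightarrow> 'a vfield" where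
  "torsion nabla X Y = nabla X Y - nabla Y X - bracket X Y"

definition curvature_op ::
    "('a vfield \<Rightarrow> 'a vfield \<Rightarrow> 'a vfield) \<Rightarrow> 'a vfield \<Rightarrow> 'a vfield \<Rightarrow> 'a vfield \<Rightarrow> 'a vfield" where
  "curvature_op nabla X Y Z =
     nabla X (nabla Y Z) - nabla Y (nabla X Z) - nabla (bracket X Y) Z"

end


section \<open>Almost complex and Riemannian structures\<close>

text \<open>\<open>J\<close> and \<open>g\<close> denote the complex (bi)linear extensions to the complexified tangent spaces.
  Commuting with conjugation expresses that they come from the real tangent spaces.\<close>

locale almost_complex_manifold = smooth_manifold T A
  for T :: "'a topology" and A :: "('a, 'e::euclidean_space) chart set" +
  fixes J :: "'a \<Rightarrow> 'a tvec \<Rightarrow> 'a tvec"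
  assumes J_closed: "\<And>p v. p \<in> topspace T \<Longrightarrow> v \<in> tangent_space p \<Longrightarrow> J p v \<in> tangent_space p"
    and J_add: "\<And>p u v. p \<in> topspace T \<Longrightarrow> u \<in> tangent_space p \<Longrightarrow> v \<in> tangent_space p \<Longrightarrow>
      J p (u + v) = J p u + J p v"
    and J_scale: "\<And>p c v. p \<in> topspace T \<Longrightarrow> v \<in> tangent_space p \<Longrightarrow> J p (c \<odot> v) = c \<odot> J p v"
    and J_real: "\<And>p v. p \<in> topspace T \<Longrightarrow> v \<in> tangent_space p \<Longrightarrow>
      J p (conj_vec v) = conj_vec (J p v)"
    and J_square: "\<And>p v. p \<in> topspace T \<Longrightarrow> v \<in> tangent_space p \<Longrightarrow> J p (J p v) = - v"
    and J_smooth: "\<And>W X. openin T W \<Longrightarrow> field_on W X \<Longrightarrow> field_on W (\<lambda>p. J p (X p))"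
begin

definition J_field :: "'a vfield \<Rightarrow> 'a vfield" where
  "J_field X = (\<lambda>p. J p (X p))"

definition type10_on :: "'a set \<Rightarrow> 'a vfield \<Rightarrow> bool" where
  "type10_on W X \<longleftrightarrow> (\<forall>p\<in>W. J p (X p) = \<i> \<odot> X p)"

text \<open>The (1,0)- and (0,1)-components of a complex vector field.\<close>

definition part10 :: "'a vfield \<Rightarrow> 'a vfield" where
  "part10 X = (\<lambda>p. (1/2) \<odot> (X p - \<i> \<odot> J p (X p)))"

definition part01 :: "'a vfield \<Rightarrow> 'a vfield" where
  "part01 X = (\<lambda>p. (1/2) \<odot> (X p + \<i> \<odot> J p (X p)))"

text \<open>The component of bidegree (1,2) of a 3-form.\<close>

definition part12 :: "('a vfield \<Rightarrow> 'a vfield \<Rightarrow> 'a vfield \<Rightarrow> 'a \<Rightarrow> complex) \<Rightarrow>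
    'a vfield \<Rightarrow> 'a vfield \<Rightarrow> 'a vfield \<Rightarrow> 'a \<Rightarrow> complex" where
  "part12 \<Phi> X Y Z p =
     \<Phi> (part10 X) (part01 Y) (part01 Z) p
     + \<Phi> (part01 X) (part10 Y) (part01 Z) p
     + \<Phi> (part01 X) (part01 Y) (part10 Z) p"

definition nijenhuis :: "'a vfield \<Rightarrow> 'a vfield \<Rightarrow> 'a vfield" where
  "nijenhuis X Y =
     bracket (J_field X) (J_field Y) - J_field (bracket (J_field X) Y)
     - J_field (bracket X (J_field Y)) - bracket X Y"

text \<open>Integrability in the sense of Kobayashi-Nomizu (Foundations of Differential Geometry II,
  Chapter IX): \<open>J\<close> has no torsion.\<close>

definition integrable_structure :: bool where
  "integrable_structure \<longleftrightarrow>
    (\<forall>W X Y. openin T W \<and> field_on W X \<and> field_on W Y \<longrightarrow> (\<forall>p\<in>W. nijenhuis X Y p = 0))"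

end

locale riemannian_manifold = smooth_manifold T A
  for T :: "'a topology" and A :: "('a, 'e::euclidean_space) chart set" +
  fixes g :: "'a \<Rightarrow> 'a tvec \<Rightarrow> 'a tvec \<Rightarrow> complex"
  assumes g_sym: "\<And>p u v. p \<in> topspace T \<Longrightarrow> u \<in> tangent_space p \<Longrightarrow> v \<in> tangent_space p \<Longrightarrow>
      g p u v = g p v u"
    and g_add: "\<And>p u v w. p \<in> topspace T \<Longrightarrow> u \<in> tangent_space p \<Longrightarrow> v \<in> tangent_space p \<Longrightarrow>
      w \<in> tangent_space p \<Longrightarrow> g p (u + v) w = g p u w + g p v w"
    and g_scale: "\<And>p c u v. p \<in> topspace T \<Longrightarrow> u \<in> tangent_space p \<Longrightarrow> v \<in> tangent_space p \<Longrightarrow>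
      g p (c \<odot> u) v = c * g p u v"
    and g_real: "\<And>p u v. p \<in> topspace T \<Longrightarrow> u \<in> tangent_space p \<Longrightarrow> v \<in> tangent_space p \<Longrightarrow>
      g p (conj_vec u) (conj_vec v) = cnj (g p u v)"
    and g_pos: "\<And>p v. p \<in> topspace T \<Longrightarrow> v \<in> tangent_space p \<Longrightarrow> conj_vec v = v \<Longrightarrow> v \<noteq> 0 \<Longrightarrow>
      0 < Re (g p v v)"
    and g_smooth: "\<And>W X Y. openin T W \<Longrightarrow> field_on W X \<Longrightarrow> field_on W Y \<Longrightarrow>
      smooth_fun W (\<lambda>p. g p (X p) (Y p))"


section \<open>Almost Hermitian manifolds and the canonical connection\<close>

locale almost_hermitian_manifold = almost_complex_manifold T A J + riemannian_manifold T A g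
  for T :: "'a topology" and A :: "('a, 'e::euclidean_space) chart set"
    and J :: "'a \<Rightarrow> 'a tvec \<Rightarrow> 'a tvec" and g :: "'a \<Rightarrow> 'a tvec \<Rightarrow> 'a tvec \<Rightarrow> complex" +
  fixes n :: nat
  assumes dimension: "DIM('e) = 2 * n"
    and g_J: "\<And>p u v. p \<in> topspace T \<Longrightarrow> u \<in> tangent_space p \<Longrightarrow> v \<in> tangent_space p \<Longrightarrow>
      g p (J p u) (J p v) = g p u v"
begin

definition fundamental_form :: "'a \<Rightarrow> 'a tvec \<Rightarrow> 'a tvec \<Rightarrow> complex" where
  "fundamental_form p u v = g p (J p u) v"

definition quasi_kaehler :: bool where
  "quasi_kaehler \<longleftrightarrow>
    (\<forall>W X Y Z. openin T W \<and> field_on W X \<and> field_on W Y \<and> field_on W Z \<longrightarrow>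
       (\<forall>p\<in>W. part12 (ext_d fundamental_form) X Y Z p = 0))"

definition kaehler :: bool where
  "kaehler \<longleftrightarrow> integrable_structure \<and>
    (\<forall>W X Y Z. openin T W \<and> field_on W X \<and> field_on W Y \<and> field_on W Z \<longrightarrow>
       (\<forall>p\<in>W. ext_d fundamental_form X Y Z p = 0))"

definition canonical_connection :: "('a vfield \<Rightarrow> 'a vfield \<Rightarrow> 'a vfield) \<Rightarrow> bool" where
  "canonical_connection nabla \<longleftrightarrow> affine_connection nabla \<and>
    (\<forall>W X Y Z. openin T W \<and> field_on W X \<and> field_on W Y \<and> field_on W Z \<longrightarrow>
       (\<forall>p\<in>W. X p (\<lambda>q. g q (Y q) (Z q)) = g p (nabla X Y p) (Z p) + g p (Y p) (nabla X Z p))) \<and>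
    (\<forall>W X Y. openin T W \<and> field_on W X \<and> field_on W Y \<longrightarrow>
       (\<forall>p\<in>W. nabla X (J_field Y) p = J p (nabla X Y p))) \<and>
    (\<forall>W X Y. openin T W \<and> field_on W X \<and> field_on W Y \<and> type10_on W X \<and> type10_on W Y \<longrightarrow>
       (\<forall>p\<in>W. torsion nabla X (conj_field Y) p = 0))"

text \<open>\<open>R(X,Y,Z,W) = \<langle>R(Z,W)X, Y\<rangle>\<close>; note the position of the arguments.\<close>

definition curvature :: "('a vfield \<Rightarrow> 'a vfield \<Rightarrow> 'a vfield) \<Rightarrow>
    'a vfield \<Rightarrow> 'a vfield \<Rightarrow> 'a vfield \<Rightarrow> 'a vfield \<Rightarrow> 'a \<Rightarrow> complex" where
  "curvature nabla X Y Z W p = g p (curvature_op nabla Z W X p) (Y p)"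

text \<open>The (2,0)-part of the curvature, as a complex 4-tensor: its components with respect to a
  local unitary (1,0)-frame are \<open>R\<close> at index positions \<open>(i, j-bar, k, l)\<close>, and all others vanish.\<close>

definition curvature20 :: "('a vfield \<Rightarrow> 'a vfield \<Rightarrow> 'a vfield) \<Rightarrow>
    'a vfield \<Rightarrow> 'a vfield \<Rightarrow> 'a vfield \<Rightarrow> 'a vfield \<Rightarrow> 'a \<Rightarrow> complex" where
  "curvature20 nabla X Y Z W =
     curvature nabla (part10 X) (part01 Y) (part10 Z) (part10 W)"

definition parallel_curvature20 :: "('a vfield \<Rightarrow> 'a vfield \<Rightarrow> 'a vfield) \<Rightarrow> bool" where
  "parallel_curvature20 nabla \<longleftrightarrow>
    (\<forall>N V X Y Z W. openin T N \<and> field_on N V \<and> field_on N X \<and> field_on N Y \<and> field_on N Z \<and>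
        field_on N W \<longrightarrow>
      (\<forall>p\<in>N. V p (curvature20 nabla X Y Z W)
         - curvature20 nabla (nabla V X) Y Z W p - curvature20 nabla X (nabla V Y) Z W p
         - curvature20 nabla X Y (nabla V Z) W p - curvature20 nabla X Y Z (nabla V W) p = 0))"

text \<open>A local unitary (1,0)-frame on the open set \<open>W\<close>. Spanning is automatic, since the
  (1,0)-tangent spaces have complex dimension \<open>n\<close>.\<close>

definition unitary_frame :: "'a set \<Rightarrow> (nat \<Rightarrow> 'a vfield) \<Rightarrow> bool" where
  "unitary_frame W e \<longleftrightarrow> openin T W \<and>
     (\<forall>i\<in>{1..n}. field_on W (e i) \<and> type10_on W (e i)) \<and>
     (\<forall>p\<in>W. \<forall>i\<in>{1..n}. \<forall>j\<in>{1..n}. g p (e i p) (conj_vec (e j p)) = (if i = j then 1 else 0))"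

definition second_ricci :: "('a vfield \<Rightarrow> 'a vfield \<Rightarrow> 'a vfield) \<Rightarrow>
    (nat \<Rightarrow> 'a vfield) \<Rightarrow> nat \<Rightarrow> nat \<Rightarrow> 'a \<Rightarrow> complex" where
  "second_ricci nabla e i j p =
     (\<Sum>l\<in>{1..n}. curvature nabla (e i) (conj_field (e j)) (e l) (conj_field (e l)) p)"

text \<open>The value of the Hermitian form \<open>R''\<close> on the vector with components \<open>\<xi>\<close> in the frame \<open>e\<close>
  (a real number, by Hermitian symmetry).\<close>

definition second_ricci_form :: "('a vfield \<Rightarrow> 'a vfield \<Rightarrow> 'a vfield) \<Rightarrow>
    (nat \<Rightarrow> 'a vfield) \<Rightarrow> (nat \<Rightarrow> complex) \<Rightarrow> 'a \<Rightarrow> real" where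
  "second_ricci_form nabla e \<xi> p =
     Re (\<Sum>i\<in>{1..n}. \<Sum>j\<in>{1..n}. second_ricci nabla e i j p * \<xi> i * cnj (\<xi> j))"

text \<open>Local unitary (1,0)-frames exist around every point, and the conditions do not depend on the
  frame.\<close>

definition second_ricci_semidefinite_at :: "('a vfield \<Rightarrow> 'a vfield \<Rightarrow> 'a vfield) \<Rightarrow> 'a \<Rightarrow> bool" where
  "second_ricci_semidefinite_at nabla p \<longleftrightarrow>
    (\<forall>W e \<xi>. unitary_frame W e \<and> p \<in> W \<longrightarrow> 0 \<le> second_ricci_form nabla e \<xi> p)"

definition second_ricci_definite_at :: "('a vfield \<Rightarrow> 'a vfield \<Rightarrow> 'a vfield) \<Rightarrow> 'a \<Rightarrow> bool" where
  "second_ricci_definite_at nabla p \<longleftrightarrow>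
    (\<forall>W e \<xi>. unitary_frame W e \<and> p \<in> W \<and> (\<exists>i\<in>{1..n}. \<xi> i \<noteq> 0) \<longrightarrow>
       0 < second_ricci_form nabla e \<xi> p)"

definition second_ricci_quasi_positive :: "('a vfield \<Rightarrow> 'a vfield \<Rightarrow> 'a vfield) \<Rightarrow> bool" where
  "second_ricci_quasi_positive nabla \<longleftrightarrow>
    (\<forall>p\<in>topspace T. second_ricci_semidefinite_at nabla p) \<and>
    (\<exists>p\<in>topspace T. second_ricci_definite_at nabla p)"

end

end

theory Submission
  imports Defs
begin

text \<open>
  Let \<open>\<tau>\<close> be the torsion of the canonical connection. On a quasi Kaehler manifold \<open>\<tau>\<close> maps pairs of
  (1,0)-vectors to (0,1)-vectors, since \<open>d\<omega>\<close> is the cyclic sum of \<open>\<omega>(\<tau>(X,Y),Z)\<close>; so \<open>\<tau>\<close> amounts to the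
  trilinear form \<open>T(X,Y,Z) = g(\<tau>(X,Y),Z)\<close> on (1,0)-vectors. The first Bianchi identity identifies the
  (2,0)-part of the curvature with the derivative of \<open>T\<close> in (0,1)-directions up to sign. If this part
  is parallel, the second covariant derivatives of \<open>T\<close> that start in a (0,1)-direction vanish,
  and commuting derivatives turns the Laplacian of \<open>|T|\<^sup>2\<close> into \<open>|\<nabla>T|\<^sup>2\<close> plus three terms \<open>R''(T,T)\<close>, one
  for each argument of \<open>T\<close>. Hence \<open>|T|\<^sup>2\<close> is subharmonic. By Hopf's strong maximum principle it is
  constant, and it vanishes where \<open>R''\<close> is definite. So \<open>\<tau> = 0\<close>, and a torsion free connection
  preserving \<open>g\<close> and \<open>J\<close> forces the manifold to be Kaehler.
\<close>


section \<open>Calculus of smooth functions\<close>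

text \<open>Commuting derivatives creates no bad terms. For a (1,0)-field E and C = conj E the mixed
  torsion vanishes, so nabla_E C - [E,C] = nabla_C E, and the first order terms of the commutation
  add up to the derivative of |T|^2 along nabla_E C. This is exactly what
  \<open>frame_operator\<close> with \<open>frame_drift\<close> subtracts. What remains is the
  curvature operator R(E, conj E); summing it over a unitary frame traces the last two arguments of
  the curvature, and this is how R'' enters rather than another Ricci contraction. The resulting
  inequality is pointwise and the maximum principle tolerates any first order term, so no
  integration over the manifold occurs. Two obstacles shape the rest. Tangent vectors are abstract
  derivations, so the dimension of the tangent space has to come from Hadamard's lemma before frames
  can be built by Gram-Schmidt. And frames exist only locally, so |T|^2 is computed in a frame,
  where the connection coefficients cancel because they are anti-Hermitian, and is then shown not to
  depend on the frame.\<close>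

lemma frechet_derivative_cong_open:
  assumes "open U" "x \<in> U" "\<And>y. y \<in> U \<Longrightarrow> f y = g y"
  shows "(f differentiable (at x)) = (g differentiable (at x))"
    and "frechet_derivative f (at x) = frechet_derivative g (at x)"
proof -
  have *: "(f has_derivative D) (at x) = (g has_derivative D) (at x)" for D
    using has_derivative_transform_within_open[of f D x UNIV U g]
      has_derivative_transform_within_open[of g D x UNIV U f] assms by auto
  show "(f differentiable (at x)) = (g differentiable (at x))"
    using * by (simp add: differentiable_def)
  show "frechet_derivative f (at x) = frechet_derivative g (at x)"
    using * by (simp add: frechet_derivative_def)
qed

section \<open>Permanence properties of C^k functions\<close>

lemma Ck_on_cong:
  assumes "open U" "\<And>x. x \<in> U \<Longrightarrow> f x = g x"
  shows "Ck_on k U f = Ck_on k U g"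
  using assms(2)
proof (induction k arbitrary: f g)
  case 0
  then show ?case by (simp cong: continuous_on_cong)
next
  case (Suc k)
  have "Ck_on k U (\<lambda>x. frechet_derivative f (at x) v) = Ck_on k U (\<lambda>x. frechet_derivative g (at x) v)" for v
    by (rule Suc.IH) (metis frechet_derivative_cong_open(2) assms(1) Suc.prems)
  then show ?case
    using frechet_derivative_cong_open(1)[OF assms(1) _ Suc.prems] by auto
qed

lemma Ck_on_subset:
  assumes "Ck_on k U f" "V \<subseteq> U"
  shows "Ck_on k V f"
  using assms by (induction k arbitrary: f) (auto intro: continuous_on_subset)

lemma Ck_on_local:
  assumes "\<And>x. x \<in> U \<Longrightarrow> \<exists>V. open V \<and> x \<in> V \<and> Ck_on k V f"
  shows "Ck_on k U f"
  using assms
proof (induction k arbitrary: f)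
  case 0
  have "continuous (at x) f" if "x \<in> U" for x
    using 0[OF that] continuous_on_eq_continuous_at by auto
  then show ?case by (simp add: continuous_at_imp_continuous_on)
next
  case (Suc k)
  have "Ck_on k U (\<lambda>x. frechet_derivative f (at x) v)" for v
    by (rule Suc.IH) (use Suc.prems in force)
  moreover have "f differentiable (at x)" if "x \<in> U" for x
    using Suc.prems[OF that] by auto
  ultimately show ?case by simp
qed

text \<open>The definition of \<open>Ck_on\<close> speaks of \<open>frechet_derivative\<close>.
  Naming a candidate \<open>f'\<close> lets each closure property be an induction on k in which only
  the formula for the derivative changes.\<close>

lemma Ck_on_SucI:
  assumes "\<And>x. x \<in> U \<Longrightarrow> (f has_derivative f' x) (at x)"
    and "\<And>v. Ck_on k U (\<lambda>x. f' x v)" and "open U"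
  shows "Ck_on (Suc k) U f"
proof -
  have eq: "frechet_derivative f (at x) = f' x" if "x \<in> U" for x
    using assms(1) that frechet_derivative_at by metis
  have "Ck_on k U (\<lambda>x. frechet_derivative f (at x) v)" for v
    using Ck_on_cong[OF assms(3), of "\<lambda>x. frechet_derivative f (at x) v" "\<lambda>x. f' x v" k] eq assms(2) by auto
  then show ?thesis using assms(1) by (auto simp: differentiable_def)
qed

lemma Ck_on_SucD:
  assumes "Ck_on (Suc k) U f"
  shows "Ck_on k U f"
  using assms
proof (induction k arbitrary: f)
  case 0
  then show ?case
    by (auto intro: continuous_at_imp_continuous_on differentiable_imp_continuous_within)
next
  case (Suc k)
  have "Ck_on k U (\<lambda>x. frechet_derivative f (at x) v)" for v
    by (rule Suc.IH) (use Suc.prems in simp)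
  then show ?case using Suc.prems by simp
qed

lemma Ck_on_has_derivative:
  assumes "Ck_on (Suc k) U f" "x \<in> U"
  shows "(f has_derivative frechet_derivative f (at x)) (at x)"
  using assms frechet_derivative_works by auto

lemma Ck_on_const: "open U \<Longrightarrow> Ck_on k U (\<lambda>x. c)"
proof (induction k arbitrary: c)
  case (Suc k)
  show ?case by (rule Ck_on_SucI[of _ _ "\<lambda>_ _. 0"]) (use Suc in auto)
qed simp

lemma Ck_on_bounded_linear:
  assumes "bounded_linear L" "open U"
  shows "Ck_on k U L"
proof (cases k)
  case 0
  then show ?thesis using assms(1) by (auto intro: linear_continuous_on)
next
  case (Suc m)
  show ?thesis unfolding Suc
    by (rule Ck_on_SucI[of _ _ "\<lambda>_. L"])
      (use assms bounded_linear_imp_has_derivative Ck_on_const in auto)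
qed

lemma Ck_on_add:
  assumes "Ck_on k U f" "Ck_on k U g" "open U"
  shows "Ck_on k U (\<lambda>x. f x + g x)"
  using assms(1,2)
proof (induction k arbitrary: f g)
  case 0
  then show ?case by (auto intro: continuous_intros)
next
  case (Suc k)
  show ?case
    by (rule Ck_on_SucI[of _ _ "\<lambda>x v. frechet_derivative f (at x) v + frechet_derivative g (at x) v"])
      (use Suc assms(3) in \<open>auto intro!: has_derivative_add Ck_on_has_derivative\<close>)
qed

lemma Ck_on_bilinear:
  assumes "bounded_bilinear B" "Ck_on k U f" "Ck_on k U g" "open U"
  shows "Ck_on k U (\<lambda>x. B (f x) (g x))"
  using assms(2,3)
proof (induction k arbitrary: f g)
  case 0
  then show ?case by (simp add: bounded_bilinear.continuous_on[OF assms(1)])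
next
  case (Suc k)
  show ?case
  proof (rule Ck_on_SucI[of _ _ "\<lambda>x v. B (f x) (frechet_derivative g (at x) v) + B (frechet_derivative f (at x) v) (g x)"])
    show "((\<lambda>x. B (f x) (g x)) has_derivative (\<lambda>v. B (f x) (frechet_derivative g (at x) v) + B (frechet_derivative f (at x) v) (g x))) (at x)"
      if "x \<in> U" for x
      by (rule bounded_bilinear.FDERIV[OF assms(1)]) (use Suc.prems that Ck_on_has_derivative in blast)+
    show "Ck_on k U (\<lambda>x. B (f x) (frechet_derivative g (at x) v) + B (frechet_derivative f (at x) v) (g x))" for v
      using Suc Ck_on_SucD[OF Suc.prems(1)] Ck_on_SucD[OF Suc.prems(2)] by (intro Ck_on_add) (use assms(4) in auto)
  qed (rule assms(4))
qed

lemma Ck_on_linear_compose: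
  assumes L: "bounded_linear L" and f: "Ck_on k U f" and U: "open U"
  shows "Ck_on k U (\<lambda>x. L (f x))"
  using f
proof (induction k arbitrary: f)
  case 0
  then show ?case by (simp add: bounded_linear.continuous_on[OF L])
next
  case (Suc k)
  show ?case
  proof (rule Ck_on_SucI[of _ _ "\<lambda>x v. L (frechet_derivative f (at x) v)"])
    show "((\<lambda>x. L (f x)) has_derivative (\<lambda>v. L (frechet_derivative f (at x) v))) (at x)" if "x \<in> U" for x
      by (rule bounded_linear.has_derivative[OF L Ck_on_has_derivative[OF Suc.prems that]])
  qed (use Suc U in auto)
qed

lemma Ck_on_sum:
  assumes "\<And>i. i \<in> I \<Longrightarrow> Ck_on k U (f i)" "open U"
  shows "Ck_on k U (\<lambda>x. \<Sum>i\<in>I. f i x)"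
  using assms(1)
  by (induction I rule: infinite_finite_induct) (auto intro: Ck_on_const Ck_on_add assms(2))

text \<open>The derivative of the composite depends on x both through the base point
  \<open>g x\<close> and through the direction \<open>?g' x v\<close>. Expanding the direction in
  the basis leaves products of scalar functions with derivatives of f in fixed directions b, and to
  those the induction hypothesis applies.\<close>

lemma Ck_on_compose:
  fixes g :: "'e::euclidean_space \<Rightarrow> 'f::euclidean_space"
  assumes "Ck_on k V f" "Ck_on k U g" "open U" "open V" "g ` U \<subseteq> V"
  shows "Ck_on k U (\<lambda>x. f (g x))"
  using assms(1,2)
proof (induction k arbitrary: f)
  case 0
  then show ?case using assms(5) by (auto intro: continuous_on_compose2)
next
  case (Suc k)
  let ?f' = "\<lambda>y. frechet_derivative f (at y)" and ?g' = "\<lambda>x. frechet_derivative g (at x)"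
  show ?case
  proof (rule Ck_on_SucI[of _ _ "\<lambda>x v. \<Sum>b\<in>Basis. (?g' x v \<bullet> b) *\<^sub>R ?f' (g x) b"])
    fix x assume x: "x \<in> U"
    have f': "(f has_derivative ?f' (g x)) (at (g x))"
      using Suc.prems(1) x assms(5) by (intro Ck_on_has_derivative) auto
    have g': "(g has_derivative ?g' x) (at x)"
      using Suc.prems(2) x by (rule Ck_on_has_derivative)
    have "?f' (g x) (?g' x v) = (\<Sum>b\<in>Basis. (?g' x v \<bullet> b) *\<^sub>R ?f' (g x) b)" for v
    proof -
      interpret f': linear "?f' (g x)" using f' by (rule has_derivative_linear)
      show ?thesis
        by (subst (1) euclidean_representation[of "?g' x v", symmetric]) (simp add: f'.sum f'.scale)
    qed
    then show "((\<lambda>x. f (g x)) has_derivative (\<lambda>v. \<Sum>b\<in>Basis. (?g' x v \<bullet> b) *\<^sub>R ?f' (g x) b)) (at x)"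
      using has_derivative_compose[OF g' f'] by presburger
  next
    fix v
    have "Ck_on k U (\<lambda>x. ?f' (g x) b)" for b
      using Suc.IH[of "\<lambda>y. ?f' y b"] Suc.prems Ck_on_SucD by auto
    moreover have "Ck_on k U (\<lambda>x. ?g' x v \<bullet> b)" for b
      using Suc.prems(2) by (intro Ck_on_linear_compose[of "\<lambda>z. z \<bullet> b"])
        (auto intro: bounded_linear_inner_left assms(3))
    ultimately show "Ck_on k U (\<lambda>x. \<Sum>b\<in>Basis. (?g' x v \<bullet> b) *\<^sub>R ?f' (g x) b)"
      by (intro Ck_on_sum Ck_on_bilinear[OF bounded_bilinear_scaleR] assms(3))
  qed (rule assms(3))
qed

lemma Cinf_on_cong: "open U \<Longrightarrow> (\<And>x. x \<in> U \<Longrightarrow> f x = g x) \<Longrightarrow> Cinf_on U f = Cinf_on U g"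
  unfolding Cinf_on_def using Ck_on_cong[of U f g] by simp

lemma Cinf_on_subset: "Cinf_on U f \<Longrightarrow> V \<subseteq> U \<Longrightarrow> Cinf_on V f"
  unfolding Cinf_on_def by (rule allI, rule Ck_on_subset[of _ U]) auto

lemma Cinf_on_local: "(\<And>x. x \<in> U \<Longrightarrow> \<exists>V. open V \<and> x \<in> V \<and> Cinf_on V f) \<Longrightarrow> Cinf_on U f"
  unfolding Cinf_on_def by (rule allI, rule Ck_on_local) meson

lemma Cinf_on_const: "open U \<Longrightarrow> Cinf_on U (\<lambda>x. c)"
  by (simp add: Cinf_on_def Ck_on_const)

lemma Cinf_on_bounded_linear: "bounded_linear L \<Longrightarrow> open U \<Longrightarrow> Cinf_on U L"
  by (simp add: Cinf_on_def Ck_on_bounded_linear)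

lemma Cinf_on_add: "Cinf_on U f \<Longrightarrow> Cinf_on U g \<Longrightarrow> open U \<Longrightarrow> Cinf_on U (\<lambda>x. f x + g x)"
  by (simp add: Cinf_on_def Ck_on_add)

lemma Cinf_on_bilinear:
  "bounded_bilinear B \<Longrightarrow> Cinf_on U f \<Longrightarrow> Cinf_on U g \<Longrightarrow> open U \<Longrightarrow> Cinf_on U (\<lambda>x. B (f x) (g x))"
  by (simp add: Cinf_on_def Ck_on_bilinear)

lemma Cinf_on_linear_compose:
  "bounded_linear L \<Longrightarrow> Cinf_on U f \<Longrightarrow> open U \<Longrightarrow> Cinf_on U (\<lambda>x. L (f x))"
  by (simp add: Cinf_on_def Ck_on_linear_compose)

lemma Cinf_on_compose:
  fixes g :: "'e::euclidean_space \<Rightarrow> 'f::euclidean_space"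
  shows "Cinf_on V f \<Longrightarrow> Cinf_on U g \<Longrightarrow> open U \<Longrightarrow> open V \<Longrightarrow> g ` U \<subseteq> V \<Longrightarrow> Cinf_on U (\<lambda>x. f (g x))"
  unfolding Cinf_on_def by (rule allI, rule Ck_on_compose[of _ V f U g]) auto

lemma Cinf_on_mult:
  fixes f g :: "'e::euclidean_space \<Rightarrow> 'b::real_normed_algebra"
  shows "Cinf_on U f \<Longrightarrow> Cinf_on U g \<Longrightarrow> open U \<Longrightarrow> Cinf_on U (\<lambda>x. f x * g x)"
  by (rule Cinf_on_bilinear[OF bounded_bilinear_mult])

lemma Cinf_on_deriv: "Cinf_on U f \<Longrightarrow> Cinf_on U (\<lambda>x. frechet_derivative f (at x) v)"
  unfolding Cinf_on_def by (rule allI, drule_tac x="Suc k" in spec) simp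

lemma Cinf_on_has_derivative:
  "Cinf_on U f \<Longrightarrow> x \<in> U \<Longrightarrow> (f has_derivative frechet_derivative f (at x)) (at x)"
  unfolding Cinf_on_def by (rule Ck_on_has_derivative[of 0]) auto

lemma Cinf_on_continuous: "Cinf_on U f \<Longrightarrow> continuous_on U f"
  unfolding Cinf_on_def by (drule spec[of _ 0]) simp

lemma Cinf_on_powr_Re: "Cinf_on {z. 0 < Re z} (\<lambda>z. complex_of_real (Re z powr s))"
proof -
  have op: "open {z. 0 < Re z}"
    by (simp add: open_Collect_less continuous_intros)
  \<comment> \<open>Generalised over the exponent and a constant factor: the derivative has the same
    form with exponent \<open>s - 1\<close>, and the factor \<open>s * Re v\<close> goes into the
    constant.\<close>
  have "Ck_on k {z. 0 < Re z} (\<lambda>z. c * complex_of_real (Re z powr s))" for k c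
  proof (induction k arbitrary: s c)
    case 0
    show ?case by (auto intro!: continuous_intros)
  next
    case (Suc k)
    show ?case
    proof (rule Ck_on_SucI[of _ _ "\<lambda>z v. (c * of_real (s * Re v)) * of_real (Re z powr (s - 1))"])
      fix z assume "z \<in> {z. 0 < Re z}"
      then have "0 < Re z" by simp
      then show "((\<lambda>z. c * complex_of_real (Re z powr s)) has_derivative
          (\<lambda>v. (c * of_real (s * Re v)) * of_real (Re z powr (s - 1)))) (at z)"
        by (auto intro!: derivative_eq_intros simp: powr_diff field_simps)
    next
      show "Ck_on k {z. 0 < Re z} (\<lambda>x. c * complex_of_real (s * Re v) * complex_of_real (Re x powr (s - 1)))" for v
        by (rule Suc.IH)
    qed (rule op)
  qed
  from this[where c=1] show ?thesis by (simp add: Cinf_on_def)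
qed

section \<open>Averages along rays and Hadamard's lemma\<close>

text \<open>Differentiating under the integral in direction v brings out one more factor t and
  replaces G by its derivative in direction v. The weight \<open>t ^ m\<close> makes this family of
  integrals closed under differentiation, so that the induction on k runs.\<close>

lemma Ck_on_ray_integral:
  fixes G :: "'e::euclidean_space \<Rightarrow> 'b::{banach, euclidean_space}"
  assumes "Cinf_on (ball y r) G"
  shows "Ck_on k (ball y r) (\<lambda>x. integral {0..1} (\<lambda>t. t ^ m *\<^sub>R G (y + t *\<^sub>R (x - y))))"
proof -
  let ?B = "ball y r"
  have mem: "y + t *\<^sub>R (x - y) \<in> ?B" if "x \<in> ?B" "t \<in> {0..1}" for x t
  proof -
    have "norm (t *\<^sub>R (x - y)) \<le> norm (x - y)" using that by (simp add: mult_left_le_one_le)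
    then show ?thesis using that by (simp add: dist_norm norm_minus_commute)
  qed
  have deriv: "((\<lambda>x. integral {0..1} (\<lambda>t. t ^ m *\<^sub>R G (y + t *\<^sub>R (x - y)))) has_derivative
      (\<lambda>v. integral {0..1} (\<lambda>t. t ^ Suc m *\<^sub>R frechet_derivative G (at (y + t *\<^sub>R (x - y))) v))) (at x)"
    if G: "Cinf_on ?B G" and x: "x \<in> ?B" for m x and G :: "'e \<Rightarrow> 'b"
  proof -
    define D where "D z = frechet_derivative G (at z)" for z
    have D: "(G has_derivative D z) (at z)" if "z \<in> ?B" for z
      unfolding D_def using Cinf_on_has_derivative[OF G that] .
    have bl: "bounded_linear (D z)" if "z \<in> ?B" for z using D[OF that] by (rule has_derivative_bounded_linear)
    have contD: "continuous_on ?B (\<lambda>z. D z v)" for v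
      unfolding D_def using Cinf_on_continuous[OF Cinf_on_deriv[OF G]] .
    \<comment> \<open>\<open>leibniz_rule\<close> wants the derivative as a continuous map into the
      bounded linear functions; \<open>fx\<close> is that bundling. Its continuity is checked on
      basis vectors further below.\<close>
    define fx where "fx x t = Blinfun (\<lambda>v. t ^ Suc m *\<^sub>R D (y + t *\<^sub>R (x - y)) v)" for x t
    have fx: "blinfun_apply (fx x t) v = t ^ Suc m *\<^sub>R D (y + t *\<^sub>R (x - y)) v" if "x \<in> ?B" "t \<in> {0..1}" for x t v
      unfolding fx_def
      by (subst bounded_linear_Blinfun_apply) (intro bounded_linear_scaleR_right bounded_linear_compose[OF bounded_linear_scaleR_right] bl mem that, simp)
    have cont_line: "continuous_on (?B \<times> cbox 0 1) (\<lambda>p. y + snd p *\<^sub>R (fst p - y))"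
      by (intro continuous_intros)
    have "((\<lambda>x. integral (cbox 0 1) (\<lambda>t. t ^ m *\<^sub>R G (y + t *\<^sub>R (x - y)))) has_derivative
        blinfun_apply (integral (cbox 0 1) (fx x))) (at x within ?B)"
    proof (rule leibniz_rule)
      fix x t assume xt: "x \<in> ?B" "t \<in> cbox 0 (1::real)"
      have g: "((\<lambda>x. y + t *\<^sub>R (x - y)) has_derivative (\<lambda>v. t *\<^sub>R v)) (at x within ?B)"
        by (auto intro!: derivative_eq_intros)
      have "((\<lambda>x. t ^ m *\<^sub>R G (y + t *\<^sub>R (x - y))) has_derivative
          (\<lambda>v. t ^ m *\<^sub>R D (y + t *\<^sub>R (x - y)) (t *\<^sub>R v))) (at x within ?B)"
        using has_derivative_compose[OF g D[OF mem]] xt by (auto intro!: has_derivative_scaleR_right)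
      moreover have "t ^ m *\<^sub>R D (y + t *\<^sub>R (x - y)) (t *\<^sub>R v) = fx x t v" for v
        using fx[of x t v] bl[OF mem[of x t]] xt by (simp add: linear_simps)
      ultimately show "((\<lambda>x. t ^ m *\<^sub>R G (y + t *\<^sub>R (x - y))) has_derivative blinfun_apply (fx x t)) (at x within ?B)"
        by simp
    next
      fix x assume x: "x \<in> ?B"
      show "(\<lambda>t. t ^ m *\<^sub>R G (y + t *\<^sub>R (x - y))) integrable_on cbox 0 1"
        by (intro integrable_continuous continuous_intros continuous_on_compose2[OF Cinf_on_continuous[OF G]])
          (use mem[OF x] in auto)
    next
      show "continuous_on (?B \<times> cbox 0 1) (\<lambda>(x, t). fx x t)"
      proof (rule continuous_on_blinfun_componentwise)
        fix i :: 'e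
        have "continuous_on (?B \<times> cbox 0 1) (\<lambda>p. snd p ^ Suc m *\<^sub>R D (y + snd p *\<^sub>R (fst p - y)) i)"
          by (intro continuous_intros continuous_on_compose2[OF contD cont_line]) (use mem in auto)
        then show "continuous_on (?B \<times> cbox 0 1) (\<lambda>x. (case x of (x, t) \<Rightarrow> fx x t) i)"
          by (rule continuous_on_eq) (clarsimp simp: fx)
      qed
    qed (use x in auto)
    moreover have "blinfun_apply (integral {0..1} (fx x)) = (\<lambda>v. integral {0..1} (\<lambda>t. fx x t v))"
    proof (intro ext blinfun_apply_integral integrable_continuous_interval continuous_on_blinfun_componentwise)
      fix i :: 'e
      have "continuous_on {0..1} (\<lambda>t. t ^ Suc m *\<^sub>R D (y + t *\<^sub>R (x - y)) i)"
        by (intro continuous_intros continuous_on_compose2[OF contD]) (use mem[OF x] in auto)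
      then show "continuous_on {0..1} (\<lambda>t. fx x t i)"
        by (rule continuous_on_eq) (simp only: fx[OF x])
    qed
    ultimately have "((\<lambda>x. integral {0..1} (\<lambda>t. t ^ m *\<^sub>R G (y + t *\<^sub>R (x - y)))) has_derivative
        (\<lambda>v. integral {0..1} (\<lambda>t. fx x t v))) (at x)"
      using at_within_open[OF x open_ball] by simp
    moreover have "integral {0..1} (\<lambda>t. fx x t v) =
        integral {0..1} (\<lambda>t. t ^ Suc m *\<^sub>R D (y + t *\<^sub>R (x - y)) v)" for v
      by (rule integral_cong) (simp only: fx[OF x])
    ultimately show ?thesis unfolding D_def by simp
  qed
  show ?thesis
    using assms
  proof (induction k arbitrary: m G)
    case 0
    show ?case
      using has_derivative_continuous[OF deriv[OF 0]]
      unfolding Ck_on.simps by (intro continuous_at_imp_continuous_on ballI)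
  next
    case (Suc k)
    show ?case
      by (rule Ck_on_SucI[OF deriv[OF Suc.prems]], assumption)
        (rule Suc.IH[OF Cinf_on_deriv[OF Suc.prems]], rule open_ball)
  qed
qed

text \<open>Integrating the derivative of f along the segment from y to x gives f x - f y. Expanding
  the direction x - y in the basis makes \<open>h b\<close> the average of the b-th partial
  derivative over the segment, and at x = y this average is the partial derivative itself.\<close>

lemma hadamard:
  fixes f :: "'e::euclidean_space \<Rightarrow> complex"
  assumes f: "Cinf_on (ball y r) f" and r: "0 < r"
  obtains h where "\<And>b. Cinf_on (ball y r) (h b)"
    and "\<And>x. x \<in> ball y r \<Longrightarrow> f x = f y + (\<Sum>b\<in>Basis. of_real ((x - y) \<bullet> b) * h b x)"
    and "\<And>b. h b y = frechet_derivative f (at y) b"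
proof
  \<comment> \<open>The trivial factor \<open>t ^ 0\<close> makes this the case m = 0 of
    \<open>Ck_on_ray_integral\<close>.\<close>
  let ?h = "\<lambda>b x. integral {0..1} (\<lambda>t. t ^ 0 *\<^sub>R frechet_derivative f (at (y + t *\<^sub>R (x - y))) b)"
  show "Cinf_on (ball y r) (?h b)" for b
    unfolding Cinf_on_def using Ck_on_ray_integral[OF Cinf_on_deriv[OF f]] by blast
  show "?h b y = frechet_derivative f (at y) b" for b
    by simp
  fix x assume x: "x \<in> ball y r"
  define z where "z t = y + t *\<^sub>R (x - y)" for t
  have z: "z t \<in> ball y r" if "t \<in> {0..1}" for t
  proof -
    have "norm (t *\<^sub>R (x - y)) \<le> norm (x - y)" using that by (simp add: mult_left_le_one_le)
    then show ?thesis using x by (simp add: dist_norm norm_minus_commute z_def)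
  qed
  let ?D = "\<lambda>t. frechet_derivative f (at (z t))"
  have "((\<lambda>t. f (z t)) has_vector_derivative ?D t (x - y)) (at t within {0..1})" if "t \<in> {0..1}" for t
  proof -
    have "(z has_vector_derivative (x - y)) (at t within {0..1})"
      unfolding z_def by (auto intro!: derivative_eq_intros)
    from vector_derivative_diff_chain_within[OF this has_derivative_at_withinI[OF Cinf_on_has_derivative[OF f z[OF that]]]]
    show ?thesis by (simp add: o_def)
  qed
  then have "((\<lambda>t. ?D t (x - y)) has_integral (f (z 1) - f (z 0))) {0..1}"
    by (intro fundamental_theorem_of_calculus) auto
  then have "f x - f y = integral {0..1} (\<lambda>t. ?D t (x - y))"
    by (simp add: z_def integral_unique)
  also have "\<dots> = integral {0..1} (\<lambda>t. \<Sum>b\<in>Basis. of_real ((x - y) \<bullet> b) * ?D t b)"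
  proof (rule integral_cong)
    fix t :: real assume "t \<in> {0..1}"
    then interpret D: linear "?D t"
      using Cinf_on_has_derivative[OF f z] has_derivative_linear by blast
    show "?D t (x - y) = (\<Sum>b\<in>Basis. of_real ((x - y) \<bullet> b) * ?D t b)"
      by (subst (1) euclidean_representation[of "x - y", symmetric]) (simp add: D.sum D.scale scaleR_conv_of_real)
  qed
  also have "\<dots> = (\<Sum>b\<in>Basis. of_real ((x - y) \<bullet> b) * integral {0..1} (\<lambda>t. ?D t b))"
  proof -
    have "continuous_on {0..1} z" unfolding z_def by (intro continuous_intros)
    then have "continuous_on {0..1} (\<lambda>t. ?D t b)" for b
      by (rule continuous_on_compose2[OF Cinf_on_continuous[OF Cinf_on_deriv[OF f]]]) (use z in blast)
    then have "((\<lambda>t. \<Sum>b\<in>Basis. of_real ((x - y) \<bullet> b) * ?D t b) has_integral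
        (\<Sum>b\<in>Basis. of_real ((x - y) \<bullet> b) * integral {0..1} (\<lambda>t. ?D t b))) {0..1}"
      by (intro has_integral_sum has_integral_mult_right integrable_integral integrable_continuous_interval finite_Basis)
    then show ?thesis by (rule integral_unique)
  qed
  finally have *: "f x - f y = (\<Sum>b\<in>Basis. of_real ((x - y) \<bullet> b) * integral {0..1} (\<lambda>t. ?D t b))" .
  have "a = c + d" if "a - c = d" for a c d :: complex using that by auto
  from this[OF *] show "f x = f y + (\<Sum>b\<in>Basis. of_real ((x - y) \<bullet> b) * ?h b x)"
    unfolding z_def power_0 scaleR_one .
qed


section \<open>Smooth functions, tangent vectors and vector fields\<close>

interpretation tv: vector_space "cscale :: complex \<Rightarrow> 'a tvec \<Rightarrow> 'a tvec"
  by unfold_locales (auto simp: cscale_def fun_eq_iff algebra_simps)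

lemma cscale_apply [simp]: "(c \<odot> v) f = c * v f"
  by (simp add: cscale_def)

lemma sum_tvec_apply: "(\<Sum>i\<in>I. F i) f = (\<Sum>i\<in>I. F i f)" for F :: "'i \<Rightarrow> 'a tvec"
  by (induction I rule: infinite_finite_induct) auto

lemma conj_vec_conj_vec [simp]: "conj_vec (conj_vec v) = v"
  by (simp add: conj_vec_def)

lemma conj_vec_add: "conj_vec (u + v) = conj_vec u + conj_vec v"
  by (simp add: conj_vec_def fun_eq_iff)

lemma conj_vec_diff: "conj_vec (u - v) = conj_vec u - conj_vec v"
  by (simp add: conj_vec_def fun_eq_iff)

lemma conj_vec_scale: "conj_vec (c \<odot> v) = cnj c \<odot> conj_vec v"
  by (simp add: conj_vec_def fun_eq_iff)

lemma conj_vec_zero [simp]: "conj_vec 0 = 0"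
  by (simp add: conj_vec_def fun_eq_iff)

lemma conj_vec_sum: "conj_vec (\<Sum>i\<in>I. F i) = (\<Sum>i\<in>I. conj_vec (F i))"
  using sum_comp_morphism[of conj_vec F I] by (simp add: conj_vec_add o_def)

lemma conj_field_conj_field [simp]: "conj_field (conj_field X) = X"
  by (simp add: conj_field_def)

text \<open>Applying \<open>L i\<close> to a vanishing combination extracts its i-th coefficient.
  The dual functionals will be evaluation at coordinate functions in one case and Hermitian products
  with frame vectors in the other.\<close>

lemma biorthogonal_independent:
  fixes L :: "'i \<Rightarrow> 'a tvec \<Rightarrow> complex" and f :: "'i \<Rightarrow> 'a tvec"
  assumes I: "finite I"
    and lin: "\<And>i c. i \<in> I \<Longrightarrow> L i (\<Sum>j\<in>I. c j \<odot> f j) = (\<Sum>j\<in>I. c j * L i (f j))"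
    and L: "\<And>i j. i \<in> I \<Longrightarrow> j \<in> I \<Longrightarrow> L i (f j) = (if j = i then 1 else 0)"
  shows "tv.independent (f ` I)" and "inj_on f I"
proof -
  have coeff: "L i (\<Sum>j\<in>I. c j \<odot> f j) = c i" if i: "i \<in> I" for i c
  proof -
    have "L i (\<Sum>j\<in>I. c j \<odot> f j) = (\<Sum>j\<in>I. if j = i then c j else 0)"
      unfolding lin[OF i] by (rule sum.cong) (use L[OF i] in auto)
    then show ?thesis using I i by simp
  qed
  show inj: "inj_on f I"
  proof (rule inj_onI)
    fix i j assume ij: "i \<in> I" "j \<in> I" "f i = f j"
    then have "(if j = i then 1 else 0) = (1::complex)"
      using L[OF ij(1) ij(1)] L[OF ij(1) ij(2)] by metis
    then show "i = j" by (metis zero_neq_one)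
  qed
  show "tv.independent (f ` I)"
    unfolding tv.dependent_finite[OF finite_imageI[OF I]]
  proof (rule notI, elim exE conjE bexE)
    fix c x assume c: "(\<Sum>x\<in>f ` I. c x \<odot> x) = 0" and cx: "c x \<noteq> 0" and "x \<in> f ` I"
    then obtain i where i: "i \<in> I" "x = f i" by blast
    have *: "(\<Sum>j\<in>I. c (f j) \<odot> f j) = 0"
      using c unfolding sum.reindex[OF inj] o_def .
    have 0: "(\<Sum>j\<in>I. (0::complex) \<odot> f j) = 0" by (intro sum.neutral ballI tv.scale_zero_left)
    have 1: "L i 0 = c (f i)" using coeff[OF i(1), of "\<lambda>j. c (f j)"] unfolding * .
    have 2: "L i 0 = 0" using coeff[OF i(1), of "\<lambda>j. 0"] unfolding 0 .
    show False using 1 2 cx i(2) by simp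
  qed
qed

context smooth_manifold
begin

section \<open>Charts and smooth functions\<close>

lemma chart_openin: "(U, \<phi>) \<in> A \<Longrightarrow> openin T U"
  using chart by blast

lemma chart_inj: "(U, \<phi>) \<in> A \<Longrightarrow> inj_on \<phi> U"
  using chart[of U \<phi>] homeomorphic_imp_injective_map openin_subset
  by (metis topspace_subtopology_subset)

lemma chart_inv: "(U, \<phi>) \<in> A \<Longrightarrow> q \<in> U \<Longrightarrow> inv_into U \<phi> (\<phi> q) = q"
  using chart_inj by (simp add: inv_into_f_f)

lemma chart_image_open:
  assumes "(U, \<phi>) \<in> A" "openin T V"
  shows "open (\<phi> ` (U \<inter> V))"
proof -
  have "open_map (subtopology T U) (top_of_set (\<phi> ` U)) \<phi>"
    using chart[OF assms(1)] homeomorphic_imp_open_map by blast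
  moreover have "openin (subtopology T U) (U \<inter> V)"
    using assms(2) by (metis inf_commute openin_subtopology_Int)
  ultimately have "openin (top_of_set (\<phi> ` U)) (\<phi> ` (U \<inter> V))"
    by (simp add: open_map_def)
  then show ?thesis using chart[OF assms(1)] openin_open_trans by blast
qed

lemma chart_vimage_open:
  assumes "(U, \<phi>) \<in> A" "open B"
  shows "openin T {q \<in> U. \<phi> q \<in> B}"
proof -
  have U: "openin T U" using assms(1) by (rule chart_openin)
  then have ts: "topspace (subtopology T U) = U" by (meson openin_subset topspace_subtopology_subset)
  have cm: "continuous_map (subtopology T U) (top_of_set (\<phi> ` U)) \<phi>"
    using chart[OF assms(1)] homeomorphic_imp_continuous_map by blast
  have "openin (top_of_set (\<phi> ` U)) (\<phi> ` U \<inter> B)"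
    using assms(2) by (simp add: openin_open_Int)
  from openin_continuous_map_preimage[OF cm this]
  have "openin (subtopology T U) {x \<in> U. \<phi> x \<in> \<phi> ` U \<inter> B}" by (simp only: ts)
  moreover have "{x \<in> U. \<phi> x \<in> \<phi> ` U \<inter> B} = {q \<in> U. \<phi> q \<in> B}" by auto
  ultimately show ?thesis using U openin_trans_full by fastforce
qed

lemma chart_at:
  assumes "p \<in> topspace T"
  obtains U \<phi> where "(U, \<phi>) \<in> A" "p \<in> U"
  using assms cover by auto

lemma smooth_funD: "smooth_fun W f \<Longrightarrow> (U, \<phi>) \<in> A \<Longrightarrow> Cinf_on (\<phi> ` (U \<inter> W)) (f \<circ> inv_into U \<phi>)"
  unfolding smooth_fun_def by auto

lemma smooth_funI:
  "(\<And>U \<phi>. (U, \<phi>) \<in> A \<Longrightarrow> Cinf_on (\<phi> ` (U \<inter> W)) (f \<circ> inv_into U \<phi>)) \<Longrightarrow> smooth_fun W f"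
  unfolding smooth_fun_def by auto

lemma smooth_fun_subset: "smooth_fun W f \<Longrightarrow> V \<subseteq> W \<Longrightarrow> smooth_fun V f"
  by (rule smooth_funI) (blast intro: Cinf_on_subset smooth_funD)

lemma smooth_fun_local:
  assumes "\<And>p. p \<in> W \<Longrightarrow> \<exists>V. openin T V \<and> p \<in> V \<and> smooth_fun V f"
  shows "smooth_fun W f"
proof (rule smooth_funI, rule Cinf_on_local)
  fix U \<phi> x assume U: "(U, \<phi>) \<in> A" and "x \<in> \<phi> ` (U \<inter> W)"
  then obtain p where p: "p \<in> U" "p \<in> W" "x = \<phi> p" by auto
  obtain V where V: "openin T V" "p \<in> V" "smooth_fun V f" using assms p by blast
  show "\<exists>V. open V \<and> x \<in> V \<and> Cinf_on V (f \<circ> inv_into U \<phi>)"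
    using chart_image_open[OF U V(1)] smooth_funD[OF V(3) U] p V(2) by blast
qed

lemma smooth_fun_cong:
  assumes "openin T W" "\<And>p. p \<in> W \<Longrightarrow> f p = h p"
  shows "smooth_fun W f = smooth_fun W h"
proof -
  have "Cinf_on (\<phi> ` (U \<inter> W)) (f \<circ> inv_into U \<phi>) = Cinf_on (\<phi> ` (U \<inter> W)) (h \<circ> inv_into U \<phi>)"
    if U: "(U, \<phi>) \<in> A" for U \<phi>
    by (rule Cinf_on_cong[OF chart_image_open[OF U assms(1)]]) (use chart_inv[OF U] assms(2) in auto)
  then show ?thesis unfolding smooth_fun_def by auto
qed

lemma smooth_fun_const: "openin T W \<Longrightarrow> smooth_fun W (\<lambda>q. c)"
  by (rule smooth_funI) (simp add: o_def Cinf_on_const chart_image_open)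

lemma smooth_fun_add:
  assumes "openin T W" "smooth_fun W f" "smooth_fun W h"
  shows "smooth_fun W (\<lambda>q. f q + h q)"
  by (rule smooth_funI)
    (use Cinf_on_add[OF smooth_funD[OF assms(2)] smooth_funD[OF assms(3)] chart_image_open[OF _ assms(1)]] in \<open>simp add: o_def\<close>)

lemma smooth_fun_mult:
  assumes "openin T W" "smooth_fun W f" "smooth_fun W h"
  shows "smooth_fun W (\<lambda>q. f q * h q)"
  by (rule smooth_funI)
    (use Cinf_on_mult[OF smooth_funD[OF assms(2)] smooth_funD[OF assms(3)] chart_image_open[OF _ assms(1)]] in \<open>simp add: o_def\<close>)

lemma smooth_fun_cmult: "openin T W \<Longrightarrow> smooth_fun W f \<Longrightarrow> smooth_fun W (\<lambda>q. c * f q)"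
  by (intro smooth_fun_mult smooth_fun_const)

lemma smooth_fun_minus: "openin T W \<Longrightarrow> smooth_fun W f \<Longrightarrow> smooth_fun W (\<lambda>q. - f q)"
  using smooth_fun_cmult[of W f "-1"] by simp

lemma smooth_fun_diff:
  "openin T W \<Longrightarrow> smooth_fun W f \<Longrightarrow> smooth_fun W h \<Longrightarrow> smooth_fun W (\<lambda>q. f q - h q)"
  using smooth_fun_add[of W f "\<lambda>q. - h q"] smooth_fun_minus[of W h] by simp

lemma smooth_fun_cnj:
  assumes "openin T W" "smooth_fun W f"
  shows "smooth_fun W (\<lambda>q. cnj (f q))"
  by (rule smooth_funI)
    (use Cinf_on_linear_compose[OF bounded_linear_cnj smooth_funD[OF assms(2)] chart_image_open[OF _ assms(1)]] in \<open>simp add: o_def\<close>)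

lemma smooth_fun_cnj_iff: "openin T W \<Longrightarrow> smooth_fun W (\<lambda>q. cnj (f q)) \<longleftrightarrow> smooth_fun W f"
  using smooth_fun_cnj[of W f] smooth_fun_cnj[of W "\<lambda>q. cnj (f q)"] by auto

lemma smooth_fun_sum:
  "openin T W \<Longrightarrow> (\<And>i. i \<in> I \<Longrightarrow> smooth_fun W (f i)) \<Longrightarrow> smooth_fun W (\<lambda>q. \<Sum>i\<in>I. f i q)"
  by (induction I rule: infinite_finite_induct) (auto intro: smooth_fun_const smooth_fun_add)

lemma smooth_fun_powr:
  assumes "openin T W" "smooth_fun W f" "\<And>p. p \<in> W \<Longrightarrow> 0 < Re (f p)"
  shows "smooth_fun W (\<lambda>p. complex_of_real (Re (f p) powr s))"
proof (rule smooth_funI)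
  fix U \<phi> assume U: "(U, \<phi>) \<in> A"
  have op: "open {z. 0 < Re z}"
    by (simp add: open_Collect_less continuous_intros)
  have "Cinf_on (\<phi> ` (U \<inter> W)) (\<lambda>x. complex_of_real (Re ((f \<circ> inv_into U \<phi>) x) powr s))"
    by (rule Cinf_on_compose[OF Cinf_on_powr_Re smooth_funD[OF assms(2) U] chart_image_open[OF U assms(1)] op])
      (use assms(3) chart_inv[OF U] in auto)
  then show "Cinf_on (\<phi> ` (U \<inter> W)) ((\<lambda>p. complex_of_real (Re (f p) powr s)) \<circ> inv_into U \<phi>)"
    by (simp add: o_def)
qed

text \<open>Any other chart is related to \<phi> by a smooth transition map, and f read in \<psi> is
  f read in \<phi> composed with that map; so a single chart decides smoothness.\<close>

lemma smooth_fun_chartI: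
  assumes U: "(U, \<phi>) \<in> A" and V: "openin T V" "V \<subseteq> U" and f: "Cinf_on (\<phi> ` V) (f \<circ> inv_into U \<phi>)"
  shows "smooth_fun V f"
proof (rule smooth_funI)
  fix U' \<psi> assume U': "(U', \<psi>) \<in> A"
  have VU: "U \<inter> V = V" using V by blast
  have op: "open (\<psi> ` (U' \<inter> V))" "open (\<phi> ` V)"
    using chart_image_open[OF U' V(1)] chart_image_open[OF U V(1)] VU by auto
  have "Cinf_on (\<psi> ` (U' \<inter> V)) (\<phi> \<circ> inv_into U' \<psi>)"
    by (rule Cinf_on_subset[OF compatible[OF U' U]]) (use V in auto)
  then have "Cinf_on (\<psi> ` (U' \<inter> V)) (\<lambda>x. (f \<circ> inv_into U \<phi>) ((\<phi> \<circ> inv_into U' \<psi>) x))"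
    by (rule Cinf_on_compose[OF f _ op]) (use chart_inv[OF U'] in auto)
  moreover have "(f \<circ> inv_into U \<phi>) ((\<phi> \<circ> inv_into U' \<psi>) x) = (f \<circ> inv_into U' \<psi>) x"
    if "x \<in> \<psi> ` (U' \<inter> V)" for x
    using that chart_inv[OF U'] chart_inv[OF U] V by auto
  ultimately show "Cinf_on (\<psi> ` (U' \<inter> V)) (f \<circ> inv_into U' \<psi>)"
    using Cinf_on_cong[OF op(1), of "\<lambda>x. (f \<circ> inv_into U \<phi>) ((\<phi> \<circ> inv_into U' \<psi>) x)" "f \<circ> inv_into U' \<psi>"] by simp
qed

text \<open>Continuity of smooth functions, in the form in which it cuts out open sets by strict
  inequalities: where a field is nonzero, or where an operator is positive.\<close>

lemma smooth_fun_preimage_open: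
  assumes W: "openin T W" "smooth_fun W f" and B: "open B"
  shows "openin T {q \<in> W. f q \<in> B}"
proof (subst openin_subopen, intro ballI)
  fix p assume p: "p \<in> {q \<in> W. f q \<in> B}"
  then have "p \<in> topspace T" using W(1) openin_subset by blast
  then obtain U \<phi> where U: "(U, \<phi>) \<in> A" "p \<in> U" by (rule chart_at)
  let ?h = "f \<circ> inv_into U \<phi>" and ?S = "\<phi> ` (U \<inter> W)"
  have "open (?h -` B \<inter> ?S)"
    using Cinf_on_continuous[OF smooth_funD[OF W(2) U(1)]] chart_image_open[OF U(1) W(1)] B
      continuous_on_open_vimage by blast
  then have "openin T {q \<in> U. \<phi> q \<in> ?h -` B \<inter> ?S}"
    by (rule chart_vimage_open[OF U(1)])
  moreover have "p \<in> {q \<in> U. \<phi> q \<in> ?h -` B \<inter> ?S}"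
    using p U chart_inv[OF U(1)] by auto
  moreover have "{q \<in> U. \<phi> q \<in> ?h -` B \<inter> ?S} \<subseteq> {q \<in> W. f q \<in> B}"
  proof
    fix q assume "q \<in> {q \<in> U. \<phi> q \<in> ?h -` B \<inter> ?S}"
    then have q: "q \<in> U" "f (inv_into U \<phi> (\<phi> q)) \<in> B" "\<phi> q \<in> \<phi> ` (U \<inter> W)" by auto
    then obtain q' where q': "q' \<in> U" "q' \<in> W" "\<phi> q = \<phi> q'" by blast
    then have "q = q'" using chart_inj[OF U(1)] q(1) by (meson inj_onD)
    then show "q \<in> {q \<in> W. f q \<in> B}" using q q' chart_inv[OF U(1)] by auto
  qed
  ultimately show "\<exists>V. openin T V \<and> p \<in> V \<and> V \<subseteq> {q \<in> W. f q \<in> B}" by blast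
qed

lemma smooth_nearI: "openin T W \<Longrightarrow> p \<in> W \<Longrightarrow> smooth_fun W f \<Longrightarrow> smooth_near p f"
  unfolding smooth_near_def by blast

lemma smooth_near_cong:
  assumes "openin T W" "p \<in> W" "\<And>q. q \<in> W \<Longrightarrow> f q = h q"
  shows "smooth_near p f = smooth_near p h"
proof -
  have "smooth_near p h" if "smooth_near p f" "\<And>q. q \<in> W \<Longrightarrow> f q = h q" for f h
  proof -
    obtain V where V: "openin T V" "p \<in> V" "smooth_fun V f" using \<open>smooth_near p f\<close> unfolding smooth_near_def by blast
    have "smooth_fun (V \<inter> W) h"
      using smooth_fun_cong[of "V \<inter> W" f h] smooth_fun_subset[OF V(3)] assms(1) V that by auto
    then show ?thesis using smooth_nearI[of "V \<inter> W"] V assms by auto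
  qed
  from this[of f h] this[of h f] show ?thesis using assms(3) by auto
qed

lemma smooth_near2:
  assumes "smooth_near p f" "smooth_near p h"
  obtains W where "openin T W" "p \<in> W" "smooth_fun W f" "smooth_fun W h"
proof -
  obtain V W where "openin T W" "p \<in> W" "smooth_fun W f" "openin T V" "p \<in> V" "smooth_fun V h"
    using assms unfolding smooth_near_def by blast
  then show ?thesis using that[of "V \<inter> W"] smooth_fun_subset[of V h "V \<inter> W"] smooth_fun_subset[of W f "V \<inter> W"] by auto
qed

lemma smooth_near_add: "smooth_near p f \<Longrightarrow> smooth_near p h \<Longrightarrow> smooth_near p (\<lambda>q. f q + h q)"
  by (erule (1) smooth_near2) (auto intro: smooth_nearI smooth_fun_add)

lemma smooth_near_mult: "smooth_near p f \<Longrightarrow> smooth_near p h \<Longrightarrow> smooth_near p (\<lambda>q. f q * h q)"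
  by (erule (1) smooth_near2) (auto intro: smooth_nearI smooth_fun_mult)

lemma smooth_near_const: "p \<in> topspace T \<Longrightarrow> smooth_near p (\<lambda>q. c)"
  by (rule smooth_nearI[of "topspace T"]) (auto intro: smooth_fun_const)

lemma smooth_near_topspace: "smooth_near p f \<Longrightarrow> p \<in> topspace T"
  unfolding smooth_near_def using openin_subset by blast

lemma smooth_near_cmult: "smooth_near p f \<Longrightarrow> smooth_near p (\<lambda>q. c * f q)"
  by (intro smooth_near_mult smooth_near_const smooth_near_topspace)

lemma smooth_near_sum:
  "p \<in> topspace T \<Longrightarrow> (\<And>i. i \<in> I \<Longrightarrow> smooth_near p (f i)) \<Longrightarrow> smooth_near p (\<lambda>q. \<Sum>i\<in>I. f i q)"
  by (induction I rule: infinite_finite_induct) (auto intro: smooth_near_const smooth_near_add)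

lemma smooth_near_cnj: "smooth_near p (\<lambda>q. cnj (f q)) \<longleftrightarrow> smooth_near p f"
  unfolding smooth_near_def by (auto simp: smooth_fun_cnj_iff)

section \<open>Derivations and the tangent space\<close>

lemma tangent_outside: "v \<in> tangent_space p \<Longrightarrow> \<not> smooth_near p f \<Longrightarrow> v f = 0"
  unfolding tangent_space_def by blast

lemma tangent_add: "v \<in> tangent_space p \<Longrightarrow> smooth_near p f \<Longrightarrow> smooth_near p h \<Longrightarrow>
    v (\<lambda>q. f q + h q) = v f + v h"
  unfolding tangent_space_def by blast

lemma tangent_cmult: "v \<in> tangent_space p \<Longrightarrow> smooth_near p f \<Longrightarrow> v (\<lambda>q. c * f q) = c * v f"
  unfolding tangent_space_def by blast

lemma tangent_mult: "v \<in> tangent_space p \<Longrightarrow> smooth_near p f \<Longrightarrow> smooth_near p h \<Longrightarrow>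
    v (\<lambda>q. f q * h q) = f p * v h + h p * v f"
  unfolding tangent_space_def by blast

text \<open>The definition gives this for functions smooth near p. If f is not smooth there, neither
  is h, and both values are 0 by convention. Hence functions can be rewritten under a tangent vector
  without smoothness side conditions.\<close>

lemma tangent_cong:
  assumes "v \<in> tangent_space p" "openin T W" "p \<in> W" "\<And>q. q \<in> W \<Longrightarrow> f q = h q"
  shows "v f = v h"
proof (cases "smooth_near p f")
  case True
  then have "smooth_near p h" using smooth_near_cong[OF assms(2,3,4)] by simp
  moreover have "same_germ p f h" unfolding same_germ_def using assms by blast
  ultimately show ?thesis using True assms(1) unfolding tangent_space_def by blast
next
  case False
  then have "\<not> smooth_near p h" using smooth_near_cong[OF assms(2,3,4)] by simp
  then show ?thesis using False assms(1) tangent_outside by metis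
qed

lemma tangent_const:
  assumes "v \<in> tangent_space p"
  shows "v (\<lambda>q. c) = 0"
proof (cases "p \<in> topspace T")
  case True
  \<comment> \<open>The Leibniz rule for 1 = 1 * 1 reads v(1) = 2 v(1).\<close>
  have "v (\<lambda>q. 1 * 1) = 1 * v (\<lambda>q. 1) + 1 * v (\<lambda>q. 1)"
    by (rule tangent_mult[OF assms]) (simp_all add: smooth_near_const True)
  then have "v (\<lambda>q. 1) = 0" by simp
  then show ?thesis using tangent_cmult[OF assms smooth_near_const[OF True], of c 1] by simp
next
  case False
  then show ?thesis using tangent_outside[OF assms] smooth_near_topspace by blast
qed

lemma tangent_sum:
  assumes "v \<in> tangent_space p" "\<And>i. i \<in> I \<Longrightarrow> smooth_near p (f i)"
  shows "v (\<lambda>q. \<Sum>i\<in>I. f i q) = (\<Sum>i\<in>I. v (f i))"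
  using assms(2)
proof (induction I rule: infinite_finite_induct)
  case (insert i I)
  then have sn: "smooth_near p (\<lambda>q. \<Sum>i\<in>I. f i q)"
    by (intro smooth_near_sum) (use smooth_near_topspace in auto)
  show ?case using insert tangent_add[OF assms(1) _ sn, of "f i"] by simp
qed (simp_all add: tangent_const[OF assms(1)])

lemma tangent_diff:
  assumes "v \<in> tangent_space p" "smooth_near p f" "smooth_near p h"
  shows "v (\<lambda>q. f q - h q) = v f - v h"
  using tangent_add[OF assms(1,2) smooth_near_cmult[OF assms(3), of "-1"]]
    tangent_cmult[OF assms(1,3), of "-1"] by simp

lemma tangent_space_zero: "0 \<in> tangent_space p"
  unfolding tangent_space_def by simp

lemma tangent_space_add: "u \<in> tangent_space p \<Longrightarrow> v \<in> tangent_space p \<Longrightarrow> u + v \<in> tangent_space p"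
  unfolding tangent_space_def mem_Collect_eq plus_fun_apply by (simp add: algebra_simps) metis

lemma tangent_space_scale: "v \<in> tangent_space p \<Longrightarrow> c \<odot> v \<in> tangent_space p"
  unfolding tangent_space_def mem_Collect_eq cscale_apply by (simp add: algebra_simps)

lemma tangent_space_uminus: "v \<in> tangent_space p \<Longrightarrow> - v \<in> tangent_space p"
  using tangent_space_scale[of v p "-1"] by (simp add: cscale_def fun_Compl_def)

lemma tangent_space_diff: "u \<in> tangent_space p \<Longrightarrow> v \<in> tangent_space p \<Longrightarrow> u - v \<in> tangent_space p"
  using tangent_space_add[OF _ tangent_space_uminus] by fastforce

lemma tangent_space_sum: "(\<And>i. i \<in> I \<Longrightarrow> F i \<in> tangent_space p) \<Longrightarrow> (\<Sum>i\<in>I. F i) \<in> tangent_space p"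
  by (induction I rule: infinite_finite_induct) (auto intro: tangent_space_zero tangent_space_add)

lemma tangent_space_conj:
  assumes "v \<in> tangent_space p"
  shows "conj_vec v \<in> tangent_space p"
proof -
  have "cnj (v (\<lambda>q. cnj (f q))) = cnj (v (\<lambda>q. cnj (h q)))" if "same_germ p f h" for f h
    using that tangent_cong[OF assms, of _ "\<lambda>q. cnj (f q)" "\<lambda>q. cnj (h q)"] unfolding same_germ_def by auto
  moreover have "cnj (v (\<lambda>q. cnj (f q + h q))) = cnj (v (\<lambda>q. cnj (f q))) + cnj (v (\<lambda>q. cnj (h q)))"
    if "smooth_near p f" "smooth_near p h" for f h
    using tangent_add[OF assms, of "\<lambda>q. cnj (f q)" "\<lambda>q. cnj (h q)"] that by (simp add: smooth_near_cnj)
  moreover have "cnj (v (\<lambda>q. cnj (c * f q))) = c * cnj (v (\<lambda>q. cnj (f q)))" if "smooth_near p f" for f c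
    using tangent_cmult[OF assms, of "\<lambda>q. cnj (f q)" "cnj c"] that by (simp add: smooth_near_cnj)
  moreover have "cnj (v (\<lambda>q. cnj (f q * h q))) = f p * cnj (v (\<lambda>q. cnj (h q))) + h p * cnj (v (\<lambda>q. cnj (f q)))"
    if "smooth_near p f" "smooth_near p h" for f h
    using tangent_mult[OF assms, of "\<lambda>q. cnj (f q)" "\<lambda>q. cnj (h q)"] that by (simp add: smooth_near_cnj)
  moreover have "cnj (v (\<lambda>q. cnj (f q))) = 0" if "\<not> smooth_near p f" for f
    using that tangent_outside[OF assms, of "\<lambda>q. cnj (f q)"] by (simp add: smooth_near_cnj)
  ultimately show ?thesis
    unfolding tangent_space_def conj_vec_def by blast
qed

section \<open>Vector fields and the Lie bracket\<close>

lemma field_onD: "field_on W X \<Longrightarrow> p \<in> W \<Longrightarrow> X p \<in> tangent_space p"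
  unfolding field_on_def by blast

lemma field_on_smooth: "field_on W X \<Longrightarrow> openin T V \<Longrightarrow> V \<subseteq> W \<Longrightarrow> smooth_fun V f \<Longrightarrow> smooth_fun V (\<lambda>p. X p f)"
  unfolding field_on_def by blast

lemma field_on_smooth_near:
  assumes "field_on W X" "openin T W" "p \<in> W" "smooth_near p f"
  shows "smooth_near p (\<lambda>q. X q f)"
proof -
  obtain V where V: "openin T V" "p \<in> V" "smooth_fun V f" using assms(4) unfolding smooth_near_def by blast
  have "smooth_fun (V \<inter> W) (\<lambda>q. X q f)"
    by (rule field_on_smooth[OF assms(1)]) (use V assms smooth_fun_subset[OF V(3)] in auto)
  then show ?thesis using smooth_nearI[of "V \<inter> W"] V assms by auto
qed

lemma field_on_subset: "field_on W X \<Longrightarrow> V \<subseteq> W \<Longrightarrow> field_on V X"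
  unfolding field_on_def by blast

lemma field_on_cong:
  assumes "\<And>p. p \<in> W \<Longrightarrow> X p = Y p"
  shows "field_on W X = field_on W Y"
proof -
  have "field_on W Y" if "field_on W X" "\<And>p. p \<in> W \<Longrightarrow> X p = Y p" for X Y
    unfolding field_on_def
  proof (intro conjI ballI allI impI)
    fix V f assume "openin T V \<and> V \<subseteq> W \<and> smooth_fun V f"
    then show "smooth_fun V (\<lambda>p. Y p f)"
      using smooth_fun_cong[of V "\<lambda>p. X p f" "\<lambda>p. Y p f"] field_on_smooth[OF that(1), of V f] that(2)
      by (metis subsetD)
  qed (use that field_onD in metis)
  from this[of X Y] this[of Y X] show ?thesis using assms by auto
qed

lemma field_on_zero: "field_on W 0"
  unfolding field_on_def using tangent_space_zero smooth_fun_const by auto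

lemma field_on_add: "field_on W X \<Longrightarrow> field_on W Y \<Longrightarrow> field_on W (X + Y)"
  unfolding field_on_def using tangent_space_add smooth_fun_add by simp

lemma field_on_scale:
  assumes "smooth_fun W f" "field_on W X"
  shows "field_on W (\<lambda>q. f q \<odot> X q)"
  unfolding field_on_def
  using field_onD[OF assms(2)] tangent_space_scale field_on_smooth[OF assms(2)] smooth_fun_mult
    smooth_fun_subset[OF assms(1)] by auto

lemma field_on_cscale: "openin T W \<Longrightarrow> field_on W X \<Longrightarrow> field_on W (\<lambda>q. c \<odot> X q)"
  by (rule field_on_scale[OF smooth_fun_const])

lemma field_on_uminus: "openin T W \<Longrightarrow> field_on W X \<Longrightarrow> field_on W (- X)"
  using field_on_cscale[of W X "-1"] by (simp add: cscale_def fun_Compl_def)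

lemma field_on_diff: "openin T W \<Longrightarrow> field_on W X \<Longrightarrow> field_on W Y \<Longrightarrow> field_on W (X - Y)"
  using field_on_add[of W X "-Y"] field_on_uminus[of W Y] by simp

lemma field_on_sum:
  "(\<And>i. i \<in> I \<Longrightarrow> field_on W (F i)) \<Longrightarrow> field_on W (\<lambda>q. \<Sum>i\<in>I. F i q)"
proof (induction I rule: infinite_finite_induct)
  case (insert i I)
  have "(\<lambda>q. \<Sum>i\<in>insert i I. F i q) = F i + (\<lambda>q. \<Sum>i\<in>I. F i q)"
    using insert by (simp add: fun_eq_iff)
  moreover have "field_on W (F i + (\<lambda>q. \<Sum>i\<in>I. F i q))"
    using insert by (intro field_on_add) simp_all
  ultimately show ?case by (rule back_subst[of "field_on W", OF _ sym, rotated])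
qed (use field_on_zero[of W] in \<open>simp_all add: zero_fun_def\<close>)

lemma field_on_conj:
  assumes "field_on W X"
  shows "field_on W (conj_field X)"
  unfolding field_on_def conj_field_def
proof (intro conjI ballI allI impI)
  fix V f assume V: "openin T V \<and> V \<subseteq> W \<and> smooth_fun V f"
  then have "smooth_fun V (\<lambda>p. X p (\<lambda>q. cnj (f q)))"
    using field_on_smooth[OF assms] smooth_fun_cnj by blast
  then show "smooth_fun V (\<lambda>p. conj_vec (X p) f)"
    using V smooth_fun_cnj by (simp add: conj_vec_def)
qed (use field_onD[OF assms] tangent_space_conj in auto)

lemma bracket_apply: "smooth_near p f \<Longrightarrow> bracket X Y p f = X p (\<lambda>q. Y q f) - Y p (\<lambda>q. X q f)"
  by (simp add: bracket_def)

text \<open>The composite of X and Y is of second order and fails the Leibniz rule by Yh Xf + Yf Xh.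
  This is symmetric in X and Y and cancels in the bracket. The auxiliary facts \<open>c\<close>,
  \<open>a\<close>, \<open>s\<close>, \<open>m\<close> are stated for arbitrary fields so as to
  serve both orders of composition.\<close>

lemma bracket_tangent:
  assumes W: "openin T W" and X: "field_on W X" and Y: "field_on W Y" and p: "p \<in> W"
  shows "bracket X Y p \<in> tangent_space p"
proof -
  have VW: "openin T (V \<inter> W)" "p \<in> V \<inter> W" if "openin T V" "p \<in> V" for V
    using that W p by auto
  have c: "X p (\<lambda>q. Y q f) = X p (\<lambda>q. Y q h)"
    if XY: "field_on W X" "field_on W Y" and "same_germ p f h" for X Y f h
  proof -
    obtain V where V: "openin T V" "p \<in> V" "\<And>q. q \<in> V \<Longrightarrow> f q = h q"
      using \<open>same_germ p f h\<close> unfolding same_germ_def by blast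
    show ?thesis
    proof (rule tangent_cong[OF field_onD[OF XY(1) p] VW[OF V(1,2)]])
      show "Y q f = Y q h" if "q \<in> V \<inter> W" for q
        by (rule tangent_cong[OF field_onD[OF XY(2)] V(1)]) (use that V(3) in auto)
    qed
  qed
  have a: "X p (\<lambda>q. Y q (\<lambda>q. f q + h q)) = X p (\<lambda>q. Y q f) + X p (\<lambda>q. Y q h)"
    if XY: "field_on W X" "field_on W Y" and f: "smooth_near p f" and h: "smooth_near p h" for X Y f h
  proof -
    obtain V where V: "openin T V" "p \<in> V" "smooth_fun V f" "smooth_fun V h" using smooth_near2 f h by metis
    have "X p (\<lambda>q. Y q (\<lambda>q. f q + h q)) = X p (\<lambda>q. Y q f + Y q h)"
      by (rule tangent_cong[OF field_onD[OF XY(1) p] VW[OF V(1,2)]], rule tangent_add[OF field_onD[OF XY(2)]])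
        (auto intro: smooth_nearI[OF V(1)] V)
    then show ?thesis
      using tangent_add[OF field_onD[OF XY(1) p] field_on_smooth_near[OF XY(2) W p f] field_on_smooth_near[OF XY(2) W p h]] by simp
  qed
  have s: "X p (\<lambda>q. Y q (\<lambda>q. k * f q)) = k * X p (\<lambda>q. Y q f)"
    if XY: "field_on W X" "field_on W Y" and f: "smooth_near p f" for X Y f k
  proof -
    obtain V where V: "openin T V" "p \<in> V" "smooth_fun V f" using f unfolding smooth_near_def by metis
    have "X p (\<lambda>q. Y q (\<lambda>q. k * f q)) = X p (\<lambda>q. k * Y q f)"
      by (rule tangent_cong[OF field_onD[OF XY(1) p] VW[OF V(1,2)]], rule tangent_cmult[OF field_onD[OF XY(2)]])
        (auto intro: smooth_nearI[OF V(1)] V)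
    then show ?thesis
      using tangent_cmult[OF field_onD[OF XY(1) p] field_on_smooth_near[OF XY(2) W p f]] by simp
  qed
  have m: "X p (\<lambda>q. Y q (\<lambda>q. f q * h q)) = f p * X p (\<lambda>q. Y q h) + Y p h * X p f + h p * X p (\<lambda>q. Y q f) + Y p f * X p h"
    if XY: "field_on W X" "field_on W Y" and f: "smooth_near p f" and h: "smooth_near p h" for X Y f h
  proof -
    obtain V where V: "openin T V" "p \<in> V" "smooth_fun V f" "smooth_fun V h" using smooth_near2 f h by metis
    note sY = field_on_smooth_near[OF XY(2) W p f] field_on_smooth_near[OF XY(2) W p h]
    have "X p (\<lambda>q. Y q (\<lambda>q. f q * h q)) = X p (\<lambda>q. f q * Y q h + h q * Y q f)"
      by (rule tangent_cong[OF field_onD[OF XY(1) p] VW[OF V(1,2)]], rule tangent_mult[OF field_onD[OF XY(2)]])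
        (auto intro: smooth_nearI[OF V(1)] V)
    also have "\<dots> = X p (\<lambda>q. f q * Y q h) + X p (\<lambda>q. h q * Y q f)"
      by (intro tangent_add[OF field_onD[OF XY(1) p]] smooth_near_mult f h sY)
    also have "\<dots> = f p * X p (\<lambda>q. Y q h) + Y p h * X p f + h p * X p (\<lambda>q. Y q f) + Y p f * X p h"
      using tangent_mult[OF field_onD[OF XY(1) p]] f h sY by simp
    finally show ?thesis .
  qed
  show ?thesis
    unfolding tangent_space_def mem_Collect_eq
  proof (intro conjI allI impI)
    fix f h assume "smooth_near p f \<and> smooth_near p h \<and> same_germ p f h"
    then show "bracket X Y p f = bracket X Y p h"
      using c[OF X Y, of f h] c[OF Y X, of f h] by (simp add: bracket_apply)
  next
    fix f h assume "smooth_near p f \<and> smooth_near p h"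
    then show "bracket X Y p (\<lambda>q. f q + h q) = bracket X Y p f + bracket X Y p h"
      using a[OF X Y, of f h] a[OF Y X, of f h] by (simp add: bracket_apply smooth_near_add)
  next
    fix k f assume "smooth_near p f"
    then show "bracket X Y p (\<lambda>q. k * f q) = k * bracket X Y p f"
      using s[OF X Y, of f k] s[OF Y X, of f k] by (simp add: bracket_apply smooth_near_cmult algebra_simps)
  next
    fix f h assume "smooth_near p f \<and> smooth_near p h"
    then show "bracket X Y p (\<lambda>q. f q * h q) = f p * bracket X Y p h + h p * bracket X Y p f"
      using m[OF X Y, of f h] m[OF Y X, of f h] by (simp add: bracket_apply smooth_near_mult algebra_simps)
  qed (simp add: bracket_def)
qed

lemma field_on_bracket:
  assumes W: "openin T W" and X: "field_on W X" and Y: "field_on W Y"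
  shows "field_on W (bracket X Y)"
  unfolding field_on_def
proof (intro conjI ballI allI impI)
  fix V f assume V: "openin T V \<and> V \<subseteq> W \<and> smooth_fun V f"
  then have "smooth_fun V (\<lambda>p. X p (\<lambda>q. Y q f) - Y p (\<lambda>q. X q f))"
    by (intro smooth_fun_diff field_on_smooth[OF X] field_on_smooth[OF Y]) auto
  then show "smooth_fun V (\<lambda>p. bracket X Y p f)"
    using smooth_fun_cong[of V "\<lambda>p. bracket X Y p f" "\<lambda>p. X p (\<lambda>q. Y q f) - Y p (\<lambda>q. X q f)"] V
      smooth_nearI bracket_apply by auto
qed (rule bracket_tangent[OF assms])

section \<open>Coordinate fields as a basis of the tangent space\<close>

definition coord :: "('a \<Rightarrow> 'e) \<Rightarrow> 'e \<Rightarrow> 'a \<Rightarrow> complex" where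
  "coord \<phi> b q = of_real (\<phi> q \<bullet> b)"

text \<open>The direction b may be any vector, not only a basis vector; the barrier argument uses
  the direction from a boundary point of a ball to its centre.\<close>

definition coord_field :: "'a set \<Rightarrow> ('a \<Rightarrow> 'e) \<Rightarrow> 'e \<Rightarrow> 'a vfield" where
  "coord_field U \<phi> b p f = (if smooth_near p f then frechet_derivative (f \<circ> inv_into U \<phi>) (at (\<phi> p)) b else 0)"

lemma smooth_near_chart:
  assumes U: "(U, \<phi>) \<in> A" "p \<in> U" and f: "smooth_near p f"
  obtains W where "openin T W" "p \<in> W" "W \<subseteq> U" "smooth_fun W f"
    "open (\<phi> ` W)" "Cinf_on (\<phi> ` W) (f \<circ> inv_into U \<phi>)"
proof -
  obtain V where V: "openin T V" "p \<in> V" "smooth_fun V f" using f unfolding smooth_near_def by blast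
  show ?thesis
  proof
    show "openin T (U \<inter> V)" using V chart_openin[OF U(1)] by auto
    show "smooth_fun (U \<inter> V) f" by (rule smooth_fun_subset[OF V(3)]) auto
  qed (use U V chart_image_open[OF U(1) V(1)] smooth_funD[OF V(3) U(1)] in auto)
qed

lemma smooth_fun_coord:
  assumes U: "(U, \<phi>) \<in> A"
  shows "smooth_fun U (coord \<phi> b)"
proof (rule smooth_fun_chartI[OF U])
  have op: "open (\<phi> ` U)" using chart[OF U] by blast
  have "Cinf_on (\<phi> ` U) (\<lambda>x. complex_of_real (x \<bullet> b))"
    by (rule Cinf_on_bounded_linear[OF _ op])
      (intro bounded_linear_compose[OF bounded_linear_of_real] bounded_linear_inner_left)
  then show "Cinf_on (\<phi> ` U) (coord \<phi> b \<circ> inv_into U \<phi>)"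
    using Cinf_on_cong[OF op, of "\<lambda>x. complex_of_real (x \<bullet> b)" "coord \<phi> b \<circ> inv_into U \<phi>"]
    by (simp add: coord_def f_inv_into_f)
qed (use chart_openin[OF U] in auto)

lemma coord_field_tangent:
  assumes U: "(U, \<phi>) \<in> A" and p: "p \<in> U"
  shows "coord_field U \<phi> b p \<in> tangent_space p"
proof -
  let ?D = "\<lambda>f. frechet_derivative (f \<circ> inv_into U \<phi>) (at (\<phi> p))"
  have D: "((f \<circ> inv_into U \<phi>) has_derivative ?D f) (at (\<phi> p))" if f: "smooth_near p f" for f
  proof -
    obtain W where W: "openin T W" "p \<in> W" "W \<subseteq> U" "smooth_fun W f"
      "open (\<phi> ` W)" "Cinf_on (\<phi> ` W) (f \<circ> inv_into U \<phi>)" using smooth_near_chart[OF U p f] by metis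
    show ?thesis by (rule Cinf_on_has_derivative[OF W(6)]) (use W in auto)
  qed
  show ?thesis
    unfolding tangent_space_def mem_Collect_eq
  proof (intro conjI allI impI)
    fix f h assume fh: "smooth_near p f \<and> smooth_near p h \<and> same_germ p f h"
    then obtain V where V: "openin T V" "p \<in> V" "\<And>q. q \<in> V \<Longrightarrow> f q = h q"
      unfolding same_germ_def by blast
    have "?D f = ?D h"
      by (rule frechet_derivative_cong_open(2)[OF chart_image_open[OF U V(1)]])
        (use V p chart_inv[OF U] in auto)
    then show "coord_field U \<phi> b p f = coord_field U \<phi> b p h" using fh by (simp add: coord_field_def)
  next
    fix f h assume fh: "smooth_near p f \<and> smooth_near p h"
    have "?D (\<lambda>q. f q + h q) = (\<lambda>v. ?D f v + ?D h v)"
      using has_derivative_add[OF D D] fh by (intro frechet_derivative_at[symmetric]) (auto simp: o_def)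
    then show "coord_field U \<phi> b p (\<lambda>q. f q + h q) = coord_field U \<phi> b p f + coord_field U \<phi> b p h"
      using fh by (simp add: coord_field_def smooth_near_add)
  next
    fix c f assume f: "smooth_near p f"
    have "?D (\<lambda>q. c * f q) = (\<lambda>v. c * ?D f v)"
      using has_derivative_mult_right[OF D[OF f], of c] by (intro frechet_derivative_at[symmetric]) (auto simp: o_def)
    then show "coord_field U \<phi> b p (\<lambda>q. c * f q) = c * coord_field U \<phi> b p f"
      using f by (simp add: coord_field_def smooth_near_cmult)
  next
    fix f h assume fh: "smooth_near p f \<and> smooth_near p h"
    have "?D (\<lambda>q. f q * h q) = (\<lambda>v. f p * ?D h v + ?D f v * h p)"
      using has_derivative_mult[OF D[of f] D[of h]] fh
      by (intro frechet_derivative_at[symmetric]) (auto simp: o_def chart_inv[OF U p])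
    then show "coord_field U \<phi> b p (\<lambda>q. f q * h q) = f p * coord_field U \<phi> b p h + h p * coord_field U \<phi> b p f"
      using fh by (simp add: coord_field_def smooth_near_mult)
  qed (simp add: coord_field_def)
qed

lemma field_on_coord:
  assumes U: "(U, \<phi>) \<in> A"
  shows "field_on U (coord_field U \<phi> b)"
  unfolding field_on_def
proof (intro conjI ballI allI impI)
  fix V f assume V: "openin T V \<and> V \<subseteq> U \<and> smooth_fun V f"
  then have VU: "U \<inter> V = V" by blast
  have op: "open (\<phi> ` V)" using chart_image_open[OF U, of V] V VU by simp
  let ?D = "\<lambda>x. frechet_derivative (f \<circ> inv_into U \<phi>) (at x) b"
  have "Cinf_on (\<phi> ` V) ?D"
    using smooth_funD[OF _ U, of V f] V VU by (intro Cinf_on_deriv) auto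
  moreover have "(\<lambda>p. coord_field U \<phi> b p f) (inv_into U \<phi> x) = ?D x" if "x \<in> \<phi> ` V" for x
    using that V chart_inv[OF U] smooth_nearI[of V _ f] by (auto simp: coord_field_def)
  ultimately show "smooth_fun V (\<lambda>p. coord_field U \<phi> b p f)"
    using smooth_fun_chartI[OF U, of V "\<lambda>p. coord_field U \<phi> b p f"] V
      Cinf_on_cong[OF op, of "(\<lambda>p. coord_field U \<phi> b p f) \<circ> inv_into U \<phi>" ?D] by (simp add: o_def)
qed (rule coord_field_tangent[OF U])

text \<open>By Hadamard's lemma f is, near p, a constant plus a sum of products of centred
  coordinates with smooth functions \<open>h b\<close>. The centred coordinates vanish at p, so the
  Leibniz rule keeps only \<open>v (coord \<phi> b)\<close> times the value of \<open>h b\<close> at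
  p, which is the b-th partial derivative of f.\<close>

theorem tangent_expansion:
  assumes U: "(U, \<phi>) \<in> A" and p: "p \<in> U" and v: "v \<in> tangent_space p"
  shows "v = (\<Sum>b\<in>Basis. v (coord \<phi> b) \<odot> coord_field U \<phi> b p)"
proof
  fix f
  show "v f = (\<Sum>b\<in>Basis. v (coord \<phi> b) \<odot> coord_field U \<phi> b p) f"
  proof (cases "smooth_near p f")
    case False
    then show ?thesis using tangent_outside[OF v] by (simp add: sum_tvec_apply coord_field_def)
  next
    case True
    obtain W where W: "openin T W" "p \<in> W" "W \<subseteq> U" "smooth_fun W f"
      "open (\<phi> ` W)" "Cinf_on (\<phi> ` W) (f \<circ> inv_into U \<phi>)" using smooth_near_chart[OF U p True] by metis
    obtain r where r: "0 < r" "ball (\<phi> p) r \<subseteq> \<phi> ` W" using W(2,5) openE by blast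
    obtain h where h: "\<And>b. Cinf_on (ball (\<phi> p) r) (h b)"
      "\<And>x. x \<in> ball (\<phi> p) r \<Longrightarrow> (f \<circ> inv_into U \<phi>) x = (f \<circ> inv_into U \<phi>) (\<phi> p) + (\<Sum>b\<in>Basis. of_real ((x - \<phi> p) \<bullet> b) * h b x)"
      "\<And>b. h b (\<phi> p) = frechet_derivative (f \<circ> inv_into U \<phi>) (at (\<phi> p)) b"
      by (rule hadamard[OF Cinf_on_subset[OF W(6) r(2)] r(1)]) (rule that)
    define V where "V = {q \<in> U. \<phi> q \<in> ball (\<phi> p) r}"
    have V: "openin T V" "p \<in> V" "V \<subseteq> U"
      unfolding V_def using chart_vimage_open[OF U open_ball] p r(1) by auto
    have imV: "\<phi> ` V \<subseteq> ball (\<phi> p) r" by (auto simp: V_def)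
    have opV: "open (\<phi> ` V)" using chart_image_open[OF U V(1)] V(3) by (simp add: inf.absorb2)
    have hs: "smooth_near p (\<lambda>q. h b (\<phi> q))" for b
    proof (rule smooth_nearI[OF V(1,2)], rule smooth_fun_chartI[OF U V(1,3)])
      show "Cinf_on (\<phi> ` V) ((\<lambda>q. h b (\<phi> q)) \<circ> inv_into U \<phi>)"
        by (subst Cinf_on_cong[OF opV, of _ "h b"])
          (use chart_inv[OF U] V(3) Cinf_on_subset[OF h(1) imV] in auto)
    qed
    have cs: "smooth_near p (coord \<phi> b)" for b
      by (rule smooth_nearI[OF chart_openin[OF U] p smooth_fun_coord[OF U]])
    let ?c = "\<lambda>b q. coord \<phi> b q - coord \<phi> b p"
    have tp: "p \<in> topspace T" using True smooth_near_topspace by blast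
    have cs': "smooth_near p (?c b)" for b
      using smooth_near_add[OF cs smooth_near_const[OF tp], of b "- coord \<phi> b p"] by simp
    have vc: "v (?c b) = v (coord \<phi> b)" for b
      using tangent_diff[OF v cs smooth_near_const[OF tp]] tangent_const[OF v] by simp
    have "v f = v (\<lambda>q. f p + (\<Sum>b\<in>Basis. ?c b q * h b (\<phi> q)))"
    proof (rule tangent_cong[OF v V(1,2)])
      fix q assume q: "q \<in> V"
      then have "q \<in> U" "\<phi> q \<in> ball (\<phi> p) r" using V(3) imV by auto
      then show "f q = f p + (\<Sum>b\<in>Basis. ?c b q * h b (\<phi> q))"
        using h(2)[of "\<phi> q"] p by (simp add: coord_def inner_diff_left chart_inv[OF U])
    qed
    also have "\<dots> = v (\<lambda>q. f p) + v (\<lambda>q. \<Sum>b\<in>Basis. ?c b q * h b (\<phi> q))"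
      by (intro tangent_add[OF v] smooth_near_const[OF tp] smooth_near_sum[OF tp] smooth_near_mult cs' hs)
    also have "\<dots> = (\<Sum>b\<in>Basis. v (\<lambda>q. ?c b q * h b (\<phi> q)))"
      using tangent_sum[OF v, of Basis "\<lambda>b q. ?c b q * h b (\<phi> q)"] smooth_near_mult[OF cs' hs] tangent_const[OF v] by simp
    also have "\<dots> = (\<Sum>b\<in>Basis. v (coord \<phi> b) * h b (\<phi> p))"
      using tangent_mult[OF v cs' hs] vc by (simp add: mult.commute)
    also have "\<dots> = (\<Sum>b\<in>Basis. v (coord \<phi> b) \<odot> coord_field U \<phi> b p) f"
      using True h(3) by (simp add: sum_tvec_apply coord_field_def)
    finally show ?thesis .
  qed
qed

lemma coord_field_coord:
  assumes U: "(U, \<phi>) \<in> A" and p: "p \<in> U" and b: "b \<in> Basis" "b' \<in> Basis"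
  shows "coord_field U \<phi> b p (coord \<phi> b') = (if b = b' then 1 else 0)"
proof -
  have op: "open (\<phi> ` U)" using chart[OF U] by blast
  have "frechet_derivative (coord \<phi> b' \<circ> inv_into U \<phi>) (at (\<phi> p)) = frechet_derivative (\<lambda>x. complex_of_real (x \<bullet> b')) (at (\<phi> p))"
    by (rule frechet_derivative_cong_open(2)[OF op]) (use p chart_inv[OF U] in \<open>auto simp: coord_def\<close>)
  also have "\<dots> = (\<lambda>x. complex_of_real (x \<bullet> b'))"
    by (rule frechet_derivative_at[symmetric], rule bounded_linear_imp_has_derivative)
      (intro bounded_linear_compose[OF bounded_linear_of_real] bounded_linear_inner_left)
  finally show ?thesis
    using smooth_nearI[OF chart_openin[OF U] p smooth_fun_coord[OF U]] b
    by (simp add: coord_field_def inner_Basis)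
qed

lemma subspace_tangent_space: "tv.subspace (tangent_space p)"
  unfolding tv.subspace_def using tangent_space_zero tangent_space_add tangent_space_scale by blast

lemma tangent_space_span:
  assumes "(U, \<phi>) \<in> A" "p \<in> U"
  shows "tangent_space p = tv.span ((\<lambda>b. coord_field U \<phi> b p) ` Basis)"
proof
  show "tangent_space p \<subseteq> tv.span ((\<lambda>b. coord_field U \<phi> b p) ` Basis)"
  proof
    fix v assume "v \<in> tangent_space p"
    from tangent_expansion[OF assms this]
    show "v \<in> tv.span ((\<lambda>b. coord_field U \<phi> b p) ` Basis)"
      by (rule ssubst) (intro tv.span_sum tv.span_scale tv.span_base imageI)
  qed
  show "tv.span ((\<lambda>b. coord_field U \<phi> b p) ` Basis) \<subseteq> tangent_space p"
    by (rule tv.span_minimal[OF _ subspace_tangent_space]) (use coord_field_tangent[OF assms] in auto)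
qed

text \<open>The dual functionals are evaluations at the coordinate functions. Together with
  \<open>tangent_space_span\<close> this gives the tangent space complex dimension DIM('e).\<close>

lemma independent_coord_fields:
  assumes U: "(U, \<phi>) \<in> A" and p: "p \<in> U"
  shows "tv.independent ((\<lambda>b. coord_field U \<phi> b p) ` Basis)"
    and "inj_on (\<lambda>b. coord_field U \<phi> b p) Basis"
  using biorthogonal_independent[of Basis "\<lambda>b v. v (coord \<phi> b)" "\<lambda>b. coord_field U \<phi> b p"]
    coord_field_coord[OF assms] by (simp_all add: sum_tvec_apply)

end


section \<open>Types of tangent vectors and unitary frames\<close>

context almost_complex_manifold
begin

section \<open>Vectors and fields of type (1,0) and (0,1)\<close>

text \<open>\<open>part10\<close> at a single point, and likewise \<open>part01v\<close> for
  \<open>part01\<close>: questions of type become linear algebra in one tangent space.\<close>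

definition part10v :: "'a \<Rightarrow> 'a tvec \<Rightarrow> 'a tvec" where
  "part10v p v = (1/2) \<odot> (v - \<i> \<odot> J p v)"

definition part01v :: "'a \<Rightarrow> 'a tvec \<Rightarrow> 'a tvec" where
  "part01v p v = (1/2) \<odot> (v + \<i> \<odot> J p v)"

definition T10 :: "'a \<Rightarrow> 'a tvec set" where
  "T10 p = {v \<in> tangent_space p. J p v = \<i> \<odot> v}"

definition T01 :: "'a \<Rightarrow> 'a tvec set" where
  "T01 p = {v \<in> tangent_space p. J p v = (- \<i>) \<odot> v}"

lemma part10_eq: "part10 X p = part10v p (X p)"
  by (simp add: part10_def part10v_def)

lemma part01_eq: "part01 X p = part01v p (X p)"
  by (simp add: part01_def part01v_def)

lemma J_uminus: "p \<in> topspace T \<Longrightarrow> v \<in> tangent_space p \<Longrightarrow> J p (- v) = - J p v"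
  using J_scale[of p v "-1"] by (simp add: cscale_def fun_Compl_def)

lemma J_diff: "p \<in> topspace T \<Longrightarrow> u \<in> tangent_space p \<Longrightarrow> v \<in> tangent_space p \<Longrightarrow> J p (u - v) = J p u - J p v"
  using J_add[of p u "- v"] J_uminus[of p v] tangent_space_uminus[of v p] by simp

lemma T10_tangent: "v \<in> T10 p \<Longrightarrow> v \<in> tangent_space p"
  by (simp add: T10_def)

lemma T01_tangent: "v \<in> T01 p \<Longrightarrow> v \<in> tangent_space p"
  by (simp add: T01_def)

lemma conj_T10:
  assumes "p \<in> topspace T" "v \<in> T10 p" shows "conj_vec v \<in> T01 p"
  using assms J_real[of p v] tangent_space_conj[of v p] by (simp add: T10_def T01_def conj_vec_scale)

lemma conj_T01:
  assumes "p \<in> topspace T" "v \<in> T01 p" shows "conj_vec v \<in> T10 p"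
  using assms J_real[of p v] tangent_space_conj[of v p]
  by (simp add: T10_def T01_def conj_vec_scale[of "- \<i>", simplified])

lemma part10v_T10:
  assumes p: "p \<in> topspace T" and v: "v \<in> tangent_space p" shows "part10v p v \<in> T10 p"
proof -
  have "J p (part10v p v) = (1/2) \<odot> (J p v - \<i> \<odot> J p (J p v))"
    unfolding part10v_def
    by (simp only: J_scale[OF p] J_diff[OF p] v J_closed[OF p v] tangent_space_scale tangent_space_diff)
  then show ?thesis
    using tangent_space_scale[OF tangent_space_diff[OF v tangent_space_scale[OF J_closed[OF p v]]], of "1/2" \<i>]
    by (simp add: T10_def part10v_def J_square[OF p v] fun_eq_iff algebra_simps)
qed

lemma part01v_T01:
  assumes p: "p \<in> topspace T" and v: "v \<in> tangent_space p" shows "part01v p v \<in> T01 p"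
proof -
  have "J p (part01v p v) = (1/2) \<odot> (J p v + \<i> \<odot> J p (J p v))"
    unfolding part01v_def
    by (simp only: J_scale[OF p] J_add[OF p] v J_closed[OF p v] tangent_space_scale tangent_space_add)
  then show ?thesis
    using tangent_space_scale[OF tangent_space_add[OF v tangent_space_scale[OF J_closed[OF p v]]], of "1/2" \<i>]
    by (simp add: T01_def part01v_def J_square[OF p v] fun_eq_iff algebra_simps)
qed

lemma part_sum: "part10v p v + part01v p v = v"
  by (simp add: part10v_def part01v_def fun_eq_iff algebra_simps)

lemma part10v_of_T10: "v \<in> T10 p \<Longrightarrow> part10v p v = v"
  by (simp add: part10v_def T10_def fun_eq_iff algebra_simps)

lemma part01v_of_T01: "v \<in> T01 p \<Longrightarrow> part01v p v = v"
  by (simp add: part01v_def T01_def fun_eq_iff algebra_simps)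

lemma part01v_of_T10: "v \<in> T10 p \<Longrightarrow> part01v p v = 0"
  by (simp add: part01v_def T10_def fun_eq_iff algebra_simps)

lemma part10v_of_T01: "v \<in> T01 p \<Longrightarrow> part10v p v = 0"
  by (simp add: part10v_def T01_def fun_eq_iff algebra_simps)

lemma T10_add: "p \<in> topspace T \<Longrightarrow> u \<in> T10 p \<Longrightarrow> v \<in> T10 p \<Longrightarrow> u + v \<in> T10 p"
  by (simp add: T10_def J_add tangent_space_add tv.scale_right_distrib)

lemma T10_scale: "p \<in> topspace T \<Longrightarrow> v \<in> T10 p \<Longrightarrow> c \<odot> v \<in> T10 p"
  by (simp add: T10_def J_scale tangent_space_scale tv.scale_left_commute)

lemma T10_diff: "p \<in> topspace T \<Longrightarrow> u \<in> T10 p \<Longrightarrow> v \<in> T10 p \<Longrightarrow> u - v \<in> T10 p"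
  by (simp add: T10_def J_diff tangent_space_diff tv.scale_right_diff_distrib)

lemma T10_zero: "p \<in> topspace T \<Longrightarrow> 0 \<in> T10 p"
  using J_scale[of p 0 0] tangent_space_zero by (simp add: T10_def)

lemma T10_sum: "p \<in> topspace T \<Longrightarrow> (\<And>i. i \<in> I \<Longrightarrow> F i \<in> T10 p) \<Longrightarrow> (\<Sum>i\<in>I. F i) \<in> T10 p"
  by (induction I rule: infinite_finite_induct) (simp_all add: T10_zero T10_add)

lemma T01_iff: "p \<in> topspace T \<Longrightarrow> v \<in> T01 p \<longleftrightarrow> conj_vec v \<in> T10 p"
  using conj_T10 conj_T01 conj_vec_conj_vec by metis

definition field10 :: "'a set \<Rightarrow> 'a vfield \<Rightarrow> bool" where
  "field10 W X \<longleftrightarrow> field_on W X \<and> type10_on W X"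

lemma field10_field: "field10 W X \<Longrightarrow> field_on W X"
  by (simp add: field10_def)

lemma field10_T10: "field10 W X \<Longrightarrow> p \<in> W \<Longrightarrow> X p \<in> T10 p"
  using field_onD[of W X p] by (simp add: field10_def type10_on_def T10_def)

lemma field10I: "field_on W X \<Longrightarrow> (\<And>p. p \<in> W \<Longrightarrow> X p \<in> T10 p) \<Longrightarrow> field10 W X"
  by (simp add: field10_def type10_on_def T10_def)

lemma field10_subset: "field10 W X \<Longrightarrow> V \<subseteq> W \<Longrightarrow> field10 V X"
  by (auto simp: field10_def type10_on_def intro: field_on_subset)

lemma field_on_J: "openin T W \<Longrightarrow> field_on W X \<Longrightarrow> field_on W (J_field X)"
  unfolding J_field_def by (rule J_smooth)

lemma field_on_part10:
  assumes "openin T W" "field_on W X" shows "field_on W (part10 X)"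
proof -
  have "part10 X = (\<lambda>q. (1/2) \<odot> (X - (\<lambda>q. \<i> \<odot> J_field X q)) q)"
    by (simp add: part10_def J_field_def fun_eq_iff)
  moreover have "field_on W (\<lambda>q. (1/2) \<odot> (X - (\<lambda>q. \<i> \<odot> J_field X q)) q)"
    by (intro field_on_cscale field_on_diff field_on_J assms)
  ultimately show ?thesis by (simp only:)
qed

lemma field_on_part01:
  assumes "openin T W" "field_on W X" shows "field_on W (part01 X)"
proof -
  have "part01 X = (\<lambda>q. (1/2) \<odot> (X + (\<lambda>q. \<i> \<odot> J_field X q)) q)"
    by (simp add: part01_def J_field_def fun_eq_iff)
  moreover have "field_on W (\<lambda>q. (1/2) \<odot> (X + (\<lambda>q. \<i> \<odot> J_field X q)) q)"
    by (intro field_on_cscale field_on_add field_on_J assms)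
  ultimately show ?thesis by (simp only:)
qed

lemma mem_topspace: "openin T W \<Longrightarrow> p \<in> W \<Longrightarrow> p \<in> topspace T"
  using openin_subset by blast

lemma field10_part10: "openin T W \<Longrightarrow> field_on W X \<Longrightarrow> field10 W (part10 X)"
  by (rule field10I[OF field_on_part10]) (simp_all add: part10_eq part10v_T10 mem_topspace field_onD)

text \<open>Every field is thereby a (1,0)-field plus the conjugate of a (1,0)-field, so that
  \<open>field10\<close> is the only type predicate needed for fields.\<close>

lemma field10_conj_part01: "openin T W \<Longrightarrow> field_on W X \<Longrightarrow> field10 W (conj_field (part01 X))"
  by (rule field10I[OF field_on_conj[OF field_on_part01]])
    (simp_all add: conj_field_def part01_eq conj_T01 part01v_T01 mem_topspace field_onD)

lemma field10_add: "openin T W \<Longrightarrow> field10 W X \<Longrightarrow> field10 W Y \<Longrightarrow> field10 W (X + Y)"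
  by (rule field10I) (simp_all add: field_on_add field10_field T10_add field10_T10 mem_topspace)

lemma field10_scale: "openin T W \<Longrightarrow> smooth_fun W f \<Longrightarrow> field10 W X \<Longrightarrow> field10 W (\<lambda>q. f q \<odot> X q)"
  by (rule field10I) (simp_all add: field_on_scale field10_field T10_scale field10_T10 mem_topspace)

lemma field10_sum:
  "openin T W \<Longrightarrow> (\<And>i. i \<in> I \<Longrightarrow> field10 W (F i)) \<Longrightarrow> field10 W (\<lambda>q. \<Sum>i\<in>I. F i q)"
  by (rule field10I, rule field_on_sum, rule field10_field, assumption)
    (rule T10_sum, rule mem_topspace, auto intro: field10_T10)

end

context riemannian_manifold
begin

section \<open>The complexified metric\<close>

lemma g_add_right: "p \<in> topspace T \<Longrightarrow> u \<in> tangent_space p \<Longrightarrow> v \<in> tangent_space p \<Longrightarrow>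
    w \<in> tangent_space p \<Longrightarrow> g p w (u + v) = g p w u + g p w v"
  using g_add[of p u v w] by (simp add: g_sym[of p w] tangent_space_add)

lemma g_scale_right: "p \<in> topspace T \<Longrightarrow> u \<in> tangent_space p \<Longrightarrow> v \<in> tangent_space p \<Longrightarrow>
    g p u (c \<odot> v) = c * g p u v"
  using g_scale[of p v u c] by (simp add: g_sym[of p u] tangent_space_scale)

lemma g_zero: "p \<in> topspace T \<Longrightarrow> v \<in> tangent_space p \<Longrightarrow> g p 0 v = 0"
  using g_scale[of p 0 v 0] by (simp add: tangent_space_zero)

lemma g_zero_right: "p \<in> topspace T \<Longrightarrow> v \<in> tangent_space p \<Longrightarrow> g p v 0 = 0"
  using g_zero[of p v] by (simp add: g_sym[of p v 0] tangent_space_zero)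

lemma g_uminus: "p \<in> topspace T \<Longrightarrow> u \<in> tangent_space p \<Longrightarrow> v \<in> tangent_space p \<Longrightarrow> g p (- u) v = - g p u v"
  using g_scale[of p u v "-1"] by (simp add: cscale_def fun_Compl_def)

lemma g_diff: "p \<in> topspace T \<Longrightarrow> u \<in> tangent_space p \<Longrightarrow> v \<in> tangent_space p \<Longrightarrow>
    w \<in> tangent_space p \<Longrightarrow> g p (u - v) w = g p u w - g p v w"
  using g_add[of p u "- v" w] g_uminus[of p v w] tangent_space_uminus[of v p] by simp

lemma g_sum: "p \<in> topspace T \<Longrightarrow> (\<And>i. i \<in> I \<Longrightarrow> F i \<in> tangent_space p) \<Longrightarrow> w \<in> tangent_space p \<Longrightarrow>
    g p (\<Sum>i\<in>I. F i) w = (\<Sum>i\<in>I. g p (F i) w)"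
  by (induction I rule: infinite_finite_induct) (simp_all add: g_zero g_add tangent_space_sum)

lemma g_lin:
  assumes p: "p \<in> topspace T" and F: "\<And>i. i \<in> I \<Longrightarrow> F i \<in> tangent_space p" and w: "w \<in> tangent_space p"
  shows "g p (\<Sum>i\<in>I. c i \<odot> F i) w = (\<Sum>i\<in>I. c i * g p (F i) w)"
  by (subst g_sum) (simp_all add: g_scale tangent_space_scale assms)

lemma g_conj_left: "p \<in> topspace T \<Longrightarrow> u \<in> tangent_space p \<Longrightarrow> v \<in> tangent_space p \<Longrightarrow>
    g p (conj_vec u) v = cnj (g p u (conj_vec v))"
  using g_real[of p u "conj_vec v"] by (simp add: tangent_space_conj)

lemma g_self_real: "p \<in> topspace T \<Longrightarrow> v \<in> tangent_space p \<Longrightarrow> Im (g p v (conj_vec v)) = 0"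
  using g_conj_left[of p v v] g_sym[of p "conj_vec v" v] tangent_space_conj[of v p]
  by (simp add: complex_eq_iff)

text \<open>Write v = a + i b with a and b real. Bilinearity and symmetry cancel the cross terms of
  g(a + i b, a - i b), which leaves g(a,a) + g(b,b), and a or b is nonzero.\<close>

lemma g_self_pos:
  assumes p: "p \<in> topspace T" and v: "v \<in> tangent_space p" and nz: "v \<noteq> 0"
  shows "0 < Re (g p v (conj_vec v))"
proof -
  define a where "a = (1/2) \<odot> (v + conj_vec v)"
  define b where "b = (- \<i>/2) \<odot> (v - conj_vec v)"
  note cv = tangent_space_conj[OF v]
  have a: "a \<in> tangent_space p" "conj_vec a = a"
    unfolding a_def using v cv
    by (simp_all add: tangent_space_add tangent_space_scale conj_vec_scale conj_vec_add add.commute)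
  have b: "b \<in> tangent_space p"
    unfolding b_def using v cv by (intro tangent_space_scale tangent_space_diff)
  have b': "conj_vec b = b"
    unfolding b_def conj_vec_scale conj_vec_diff conj_vec_conj_vec by (simp add: fun_eq_iff algebra_simps)
  have v_eq: "v = a + \<i> \<odot> b" and c_eq: "conj_vec v = a + (- \<i>) \<odot> b"
    unfolding a_def b_def by (simp_all add: fun_eq_iff algebra_simps)
  have ib: "\<i> \<odot> b \<in> tangent_space p" "(- \<i>) \<odot> b \<in> tangent_space p"
    by (rule tangent_space_scale[OF b])+
  have "g p (a + \<i> \<odot> b) (a + (- \<i>) \<odot> b) = g p a a + g p b b"
    using a b ib by (simp add: g_add[OF p] g_add_right[OF p] g_scale[OF p] g_scale_right[OF p]
        tangent_space_add g_sym[OF p, of b a] algebra_simps del: tv.scale_minus_left)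
  then have eq: "g p v (conj_vec v) = g p a a + g p b b"
    by (simp only: v_eq[symmetric] c_eq[symmetric])
  have nonneg: "0 \<le> Re (g p w w)" if "w \<in> tangent_space p" "conj_vec w = w" for w
    using g_pos[OF p that] g_zero[OF p tangent_space_zero] by (cases "w = 0") auto
  have "a \<noteq> 0 \<or> b \<noteq> 0"
    using v_eq nz by auto
  then show ?thesis
    unfolding eq using nonneg[OF a] nonneg[OF b b'] g_pos[OF p a] g_pos[OF p b b'] by auto
qed

end

context almost_hermitian_manifold
begin

text \<open>J preserves g but multiplies each argument by i, so g(u,v) = i^2 g(u,v).\<close>

lemma g_T10_T10:
  assumes p: "p \<in> topspace T" and u: "u \<in> T10 p" and v: "v \<in> T10 p"
  shows "g p u v = 0"
proof -
  have "g p u v = g p (J p u) (J p v)" using g_J[OF p, of u v] u v by (simp add: T10_def)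
  also have "\<dots> = - g p u v"
    using u v by (simp add: T10_def g_scale[OF p] g_scale_right[OF p] tangent_space_scale)
  finally show ?thesis by simp
qed

lemma g_T01_T01:
  assumes p: "p \<in> topspace T" and u: "u \<in> T01 p" and v: "v \<in> T01 p"
  shows "g p u v = 0"
proof -
  have "cnj (g p u v) = g p (conj_vec u) (conj_vec v)" using g_real[OF p] u v by (simp add: T01_def)
  also have "\<dots> = 0" using g_T10_T10[OF p conj_T01[OF p u] conj_T01[OF p v]] .
  finally show ?thesis by simp
qed

section \<open>Local unitary frames by Gram-Schmidt\<close>

text \<open>Unitarity for m fields instead of n, so that Gram-Schmidt can be an induction on
  m.\<close>

definition ortho_frame :: "'a set \<Rightarrow> nat \<Rightarrow> (nat \<Rightarrow> 'a vfield) \<Rightarrow> bool" where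
  "ortho_frame W m e \<longleftrightarrow> openin T W \<and> (\<forall>i\<in>{1..m}. field10 W (e i)) \<and>
     (\<forall>p\<in>W. \<forall>i\<in>{1..m}. \<forall>j\<in>{1..m}. g p (e i p) (conj_vec (e j p)) = (if i = j then 1 else 0))"

lemma unitary_ortho_frame: "unitary_frame W e \<longleftrightarrow> ortho_frame W n e"
  unfolding unitary_frame_def ortho_frame_def field10_def by auto

text \<open>For a unitary frame e, the vectors e_i and conj(e_i) together are a basis of the whole
  complexified tangent space, orthonormal for the Hermitian product g(u, conj v). The Boolean tells
  the two kinds apart.\<close>

definition frame_family :: "(nat \<Rightarrow> 'a vfield) \<Rightarrow> 'a \<Rightarrow> nat \<times> bool \<Rightarrow> 'a tvec" where
  "frame_family e p k = (if snd k then e (fst k) p else conj_vec (e (fst k) p))"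

definition frame_index :: "nat \<Rightarrow> (nat \<times> bool) set" where
  "frame_index m = {1..m} \<times> UNIV"

lemma frame_index_finite: "finite (frame_index m)" "card (frame_index m) = 2 * m"
  by (simp_all add: frame_index_def)

lemma frame_family_tangent:
  assumes "ortho_frame W m e" "p \<in> W" "k \<in> frame_index m"
  shows "frame_family e p k \<in> tangent_space p"
proof -
  have "e (fst k) p \<in> tangent_space p"
    using assms field_onD[OF field10_field, of W "e (fst k)" p] by (auto simp: ortho_frame_def frame_index_def)
  then show ?thesis by (simp add: frame_family_def tangent_space_conj)
qed

lemma frame_family_pairing:
  assumes F: "ortho_frame W m e" and p: "p \<in> W" and k: "k \<in> frame_index m" and l: "l \<in> frame_index m"
  shows "g p (frame_family e p k) (conj_vec (frame_family e p l)) = (if k = l then 1 else 0)"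
proof -
  have W: "openin T W" using F by (simp add: ortho_frame_def)
  note pT = mem_topspace[OF W p]
  obtain i a where i: "k = (i, a)" "i \<in> {1..m}" using k by (auto simp: frame_index_def)
  obtain j b where j: "l = (j, b)" "j \<in> {1..m}" using l by (auto simp: frame_index_def)
  have T: "e i p \<in> T10 p" "e j p \<in> T10 p"
    using F p i j by (auto simp: ortho_frame_def intro: field10_T10)
  note tT = T10_tangent[OF T(1)] T10_tangent[OF T(2)]
  have o: "g p (e i p) (conj_vec (e j p)) = (if i = j then 1 else 0)"
    using F p i j by (simp add: ortho_frame_def)
  have c: "g p (conj_vec (e i p)) (e j p) = (if i = j then 1 else 0)"
    using g_conj_left[OF pT tT] o by simp
  show ?thesis
    using o c g_T10_T10[OF pT T] g_T01_T01[OF pT conj_T10[OF pT T(1)] conj_T10[OF pT T(2)]]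
    by (cases a; cases b) (simp_all add: i j frame_family_def)
qed

lemma frame_family_independent:
  assumes F: "ortho_frame W m e" and p: "p \<in> W"
  shows "tv.independent (frame_family e p ` frame_index m)" (is ?I)
    and "inj_on (frame_family e p) (frame_index m)" (is ?J)
proof -
  have W: "openin T W" using F by (simp add: ortho_frame_def)
  note pT = mem_topspace[OF W p]
  let ?L = "\<lambda>k v. g p v (conj_vec (frame_family e p k))"
  have 1: "?L k (\<Sum>j\<in>frame_index m. c j \<odot> frame_family e p j) = (\<Sum>j\<in>frame_index m. c j * ?L k (frame_family e p j))"
    if "k \<in> frame_index m" for k c
    by (intro g_lin[OF pT] frame_family_tangent[OF F p] tangent_space_conj that)
  have 2: "?L k (frame_family e p j) = (if j = k then 1 else 0)" if "k \<in> frame_index m" "j \<in> frame_index m" for k j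
    by (rule frame_family_pairing[OF F p that(2,1)])
  show ?I ?J
    by (rule biorthogonal_independent[of _ ?L, OF frame_index_finite(1) 1 2]; assumption)+
qed

lemma tangent_space_basis:
  assumes "p \<in> topspace T"
  obtains B where "finite B" "card B = 2 * n" "tv.independent B" "tangent_space p = tv.span B"
proof -
  obtain U \<phi> where U: "(U, \<phi>) \<in> A" "p \<in> U" using chart_at[OF assms] by blast
  show ?thesis
    by (rule that[of "(\<lambda>b. coord_field U \<phi> b p) ` Basis"])
      (simp_all add: independent_coord_fields[OF U] tangent_space_span[OF U] card_image dimension)
qed

lemma tangent_independent_card:
  assumes p: "p \<in> topspace T" and S: "tv.independent S" "S \<subseteq> tangent_space p"
  shows "finite S" "card S \<le> 2 * n"
proof -
  obtain B where B: "finite B" "card B = 2 * n" "tv.independent B" "tangent_space p = tv.span B"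
    using tangent_space_basis[OF p] by blast
  show "finite S" "card S \<le> 2 * n"
    using tv.independent_span_bound[OF B(1) S(1)] S(2) B by auto
qed

text \<open>The 2n vectors of the family are independent, and the 2n coordinate fields already span;
  a tangent vector outside the span of the family would give 2n + 1 independent ones.\<close>

lemma unitary_frame_span:
  assumes F: "unitary_frame W e" and p: "p \<in> W"
  shows "tangent_space p = tv.span (frame_family e p ` frame_index n)"
proof -
  have O: "ortho_frame W n e" using F by (simp add: unitary_ortho_frame)
  let ?S = "frame_family e p ` frame_index n"
  have pT: "p \<in> topspace T" using O p mem_topspace by (auto simp: ortho_frame_def)
  have sub: "?S \<subseteq> tangent_space p" using frame_family_tangent[OF O p] by blast
  have card: "card ?S = 2 * n" using card_image[OF frame_family_independent(2)[OF O p]] frame_index_finite(2) by simp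
  have "v \<in> tv.span ?S" if v: "v \<in> tangent_space p" for v
  proof (rule ccontr)
    assume nv: "v \<notin> tv.span ?S"
    then have "v \<notin> ?S" using tv.span_base by blast
    have "tv.independent (insert v ?S)"
      using nv frame_family_independent(1)[OF O p] by (simp add: tv.independent_insert)
    from tangent_independent_card(2)[OF pT this] have "card (insert v ?S) \<le> 2 * n" using v sub by simp
    then show False using card \<open>v \<notin> ?S\<close> frame_index_finite(1) by simp
  qed
  then show ?thesis using tv.span_minimal[OF sub subspace_tangent_space] by blast
qed

lemma unitary_frame_tangent:
  assumes "unitary_frame W e" "p \<in> W" "i \<in> {1..n}"
  shows "p \<in> topspace T" "e i p \<in> T10 p" "conj_vec (e i p) \<in> T01 p" "e i p \<in> tangent_space p"
    "conj_vec (e i p) \<in> tangent_space p"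
proof -
  show pT: "p \<in> topspace T" and e: "e i p \<in> T10 p"
    using assms mem_topspace by (auto simp: unitary_ortho_frame ortho_frame_def intro: field10_T10)
  show "conj_vec (e i p) \<in> T01 p" using conj_T10[OF pT e] .
  show "e i p \<in> tangent_space p" using T10_tangent[OF e] .
  then show "conj_vec (e i p) \<in> tangent_space p" by (rule tangent_space_conj)
qed

text \<open>g is bilinear and pairs e_i with conj(e_i), hence the crossed coefficients: that of e_i
  is the product with conj(e_i), that of conj(e_i) the product with e_i.\<close>

theorem frame_expansion:
  assumes F: "unitary_frame W e" and p: "p \<in> W" and v: "v \<in> tangent_space p"
  shows "v = (\<Sum>i\<in>{1..n}. g p v (conj_vec (e i p)) \<odot> e i p) + (\<Sum>i\<in>{1..n}. g p v (e i p) \<odot> conj_vec (e i p))"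
proof -
  have O: "ortho_frame W n e" using F by (simp add: unitary_ortho_frame)
  have pT: "p \<in> topspace T" using O p mem_topspace by (auto simp: ortho_frame_def)
  let ?I = "frame_index n" and ?f = "frame_family e p"
  have "v \<in> tv.span (?f ` ?I)" using v unitary_frame_span[OF F p] by simp
  then obtain u where "v = (\<Sum>x\<in>?f ` ?I. u x \<odot> x)"
    using tv.span_finite[OF finite_imageI[OF frame_index_finite(1)]] by blast
  then have vu: "v = (\<Sum>k\<in>?I. u (?f k) \<odot> ?f k)"
    by (simp add: sum.reindex[OF frame_family_independent(2)[OF O p]])
  have coeff: "g p v (conj_vec (?f k)) = u (?f k)" if k: "k \<in> ?I" for k
  proof -
    have "g p v (conj_vec (?f k)) = (\<Sum>j\<in>?I. u (?f j) * g p (?f j) (conj_vec (?f k)))"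
      unfolding vu by (intro g_lin[OF pT] frame_family_tangent[OF O p] tangent_space_conj k)
    also have "\<dots> = (\<Sum>j\<in>?I. if j = k then u (?f j) else 0)"
      by (rule sum.cong) (use frame_family_pairing[OF O p _ k] in auto)
    also have "\<dots> = u (?f k)" using k frame_index_finite(1) by simp
    finally show ?thesis .
  qed
  have "v = (\<Sum>k\<in>?I. g p v (conj_vec (?f k)) \<odot> ?f k)"
    by (rule trans[OF vu], rule sum.cong) (simp_all add: coeff)
  also have "\<dots> = (\<Sum>i\<in>{1..n}. \<Sum>b\<in>UNIV. g p v (conj_vec (?f (i, b))) \<odot> ?f (i, b))"
    unfolding frame_index_def sum.cartesian_product by (simp add: case_prod_beta)
  also have "\<dots> = (\<Sum>i\<in>{1..n}. g p v (conj_vec (e i p)) \<odot> e i p + g p v (e i p) \<odot> conj_vec (e i p))"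
    by (simp add: UNIV_bool frame_family_def add.commute)
  finally show ?thesis by (simp only: sum.distrib)
qed

lemma frame_expansion10:
  assumes F: "unitary_frame W e" and p: "p \<in> W" and v: "v \<in> T10 p"
  shows "v = (\<Sum>i\<in>{1..n}. g p v (conj_vec (e i p)) \<odot> e i p)"
proof -
  have "g p v (e i p) = 0" if "i \<in> {1..n}" for i
    using g_T10_T10 unitary_frame_tangent[OF F p that] v by blast
  then have "(\<Sum>i\<in>{1..n}. g p v (e i p) \<odot> conj_vec (e i p)) = 0"
    by (intro sum.neutral) simp
  then show ?thesis using frame_expansion[OF F p T10_tangent[OF v]] by simp
qed

text \<open>g vanishes on pairs of (0,1)-vectors, so the products with the e_i are the only frame
  coefficients of v that could be nonzero.\<close>

lemma T01_zeroI:
  assumes F: "unitary_frame W e" and p: "p \<in> W" and v: "v \<in> T01 p"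
    and 0: "\<And>i. i \<in> {1..n} \<Longrightarrow> g p v (e i p) = 0"
  shows "v = 0"
proof -
  have "g p v (conj_vec (e i p)) = 0" if "i \<in> {1..n}" for i
    using g_T01_T01 unitary_frame_tangent[OF F p that] v by blast
  then show ?thesis using frame_expansion[OF F p T01_tangent[OF v]] 0 by simp
qed

text \<open>At p the m fields and their conjugates span at most 2m < 2n dimensions, so some
  coordinate field leaves this span. It is projected and normalised as a field, on a neighbourhood
  where the projection stays nonzero.\<close>

lemma ortho_frame_extend:
  assumes F: "ortho_frame W m e" and p: "p \<in> W" and m: "m < n"
  obtains W' e' where "p \<in> W'" "ortho_frame W' (Suc m) e'"
proof -
  have W: "openin T W" and e10: "\<And>i. i \<in> {1..m} \<Longrightarrow> field10 W (e i)" using F by (auto simp: ortho_frame_def)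
  note pT = mem_topspace[OF W p]
  obtain U \<phi> where U: "(U, \<phi>) \<in> A" "p \<in> U" using chart_at[OF pT] by blast
  let ?S = "frame_family e p ` frame_index m"
  have "\<exists>b\<in>Basis. coord_field U \<phi> b p \<notin> tv.span ?S"
  proof (rule ccontr)
    assume "\<not> ?thesis"
    then have "(\<lambda>b. coord_field U \<phi> b p) ` Basis \<subseteq> tv.span ?S" by blast
    from tv.independent_span_bound[OF _ independent_coord_fields(1)[OF U] this]
    have "card ((\<lambda>b. coord_field U \<phi> b p) ` (Basis :: 'e set)) \<le> card ?S"
      using frame_index_finite(1) by blast
    also have "\<dots> \<le> 2 * m" using card_image_le[OF frame_index_finite(1), of "frame_family e p" m] frame_index_finite(2) by simp
    finally show False using m independent_coord_fields(2)[OF U] dimension by (simp add: card_image)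
  qed
  then obtain b where b: "b \<in> Basis" "coord_field U \<phi> b p \<notin> tv.span ?S" by blast
  define X where "X = coord_field U \<phi> b"
  define V where "V = U \<inter> W"
  have V: "openin T V" "p \<in> V" "V \<subseteq> W" "V \<subseteq> U" using W chart_openin[OF U(1)] U p by (auto simp: V_def)
  have X: "field_on V X" unfolding X_def by (rule field_on_subset[OF field_on_coord[OF U(1)] V(4)])
  have "part10 X p + part01 X p = X p" by (simp only: part10_eq part01_eq part_sum)
  then have "part10 X p \<notin> tv.span ?S \<or> part01 X p \<notin> tv.span ?S"
    using b(2) tv.span_add unfolding X_def by metis
  \<comment> \<open>One type component of X leaves the span at p. If it is the (0,1)-part, its
    conjugate serves as Z, which is why the conclusion is a disjunction.\<close>
  then obtain Z where Z: "field10 V Z" "Z p \<notin> tv.span ?S \<or> conj_vec (Z p) \<notin> tv.span ?S"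
    using field10_part10[OF V(1) X] field10_conj_part01[OF V(1) X]
    by (metis conj_field_def conj_vec_conj_vec)
  define c where "c i q = g q (Z q) (conj_vec (e i q))" for i q
  define w where "w q = Z q + (\<Sum>i\<in>{1..m}. (- c i q) \<odot> e i q)" for q
  have e10V: "field10 V (e i)" if "i \<in> {1..m}" for i using field10_subset[OF e10[OF that] V(3)] .
  have cs: "smooth_fun V (\<lambda>q. - c i q)" if "i \<in> {1..m}" for i
    using g_smooth[OF V(1) field10_field[OF Z(1)] field_on_conj[OF field10_field[OF e10V[OF that]]]] V(1)
    by (intro smooth_fun_minus) (simp_all add: c_def conj_field_def)
  have w10: "field10 V w"
  proof -
    have "w = Z + (\<lambda>q. \<Sum>i\<in>{1..m}. (- c i q) \<odot> e i q)" by (simp add: w_def fun_eq_iff)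
    moreover have "field10 V (Z + (\<lambda>q. \<Sum>i\<in>{1..m}. (- c i q) \<odot> e i q))"
      by (intro field10_add field10_sum field10_scale V(1) Z(1) cs e10V)
    ultimately show ?thesis by simp
  qed
  have fam: "e i p \<in> tv.span ?S" "conj_vec (e i p) \<in> tv.span ?S" if "i \<in> {1..m}" for i
  proof -
    have "frame_family e p (i, b) \<in> tv.span ?S" for b
      using that by (intro tv.span_base imageI) (simp add: frame_index_def)
    from this[of True] this[of False] show "e i p \<in> tv.span ?S" "conj_vec (e i p) \<in> tv.span ?S"
      by (simp_all add: frame_family_def)
  qed
  \<comment> \<open>The span is closed under conjugation, so \<open>w p = 0\<close> would put both
    \<open>Z p\<close> and its conjugate into it.\<close>
  have "w p \<noteq> 0"
  proof
    assume "w p = 0"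
    then have Zp: "Z p = (\<Sum>i\<in>{1..m}. c i p \<odot> e i p)"
      by (simp add: w_def tv.scale_minus_left sum_negf)
    have "Z p \<in> tv.span ?S" unfolding Zp by (intro tv.span_sum tv.span_scale fam)
    moreover have "conj_vec (Z p) \<in> tv.span ?S"
      unfolding Zp conj_vec_sum conj_vec_scale by (intro tv.span_sum tv.span_scale fam)
    ultimately show False using Z(2) by blast
  qed
  define N where "N q = g q (w q) (conj_vec (w q))" for q
  have Ns: "smooth_fun V N"
    unfolding N_def using g_smooth[OF V(1) field10_field[OF w10] field_on_conj[OF field10_field[OF w10]]]
    by (simp add: conj_field_def)
  have op: "open {z. 0 < Re z}" by (simp add: open_Collect_less continuous_intros)
  define W' where "W' = {q \<in> V. N q \<in> {z. 0 < Re z}}"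
  have W': "openin T W'" "W' \<subseteq> V" "W' \<subseteq> W"
    unfolding W'_def using smooth_fun_preimage_open[OF V(1) Ns op] V(3) by auto
  have pW': "p \<in> W'"
    using V(2) g_self_pos[OF pT T10_tangent[OF field10_T10[OF w10 V(2)]] \<open>w p \<noteq> 0\<close>] by (simp add: W'_def N_def)
  \<comment> \<open>N is the squared length of w, hence the exponent -1/2; on W' it is positive, so
    s is smooth.\<close>
  define s where "s q = complex_of_real (Re (N q) powr (-1/2))" for q
  have ss: "smooth_fun W' s"
    unfolding s_def by (rule smooth_fun_powr[OF W'(1) smooth_fun_subset[OF Ns W'(2)]]) (simp add: W'_def)
  define e' where "e' i = (if i = Suc m then (\<lambda>q. s q \<odot> w q) else e i)" for i
  have "ortho_frame W' (Suc m) e'"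
    unfolding ortho_frame_def
  proof (intro conjI ballI)
    show "openin T W'" by (rule W')
  next
    fix i assume "i \<in> {1..Suc m}"
    then show "field10 W' (e' i)"
      using field10_scale[OF W'(1) ss field10_subset[OF w10 W'(2)]] field10_subset[OF e10 W'(3), of i]
      by (auto simp: e'_def)
  next
    fix q i j assume q: "q \<in> W'" and i: "i \<in> {1..Suc m}" and j: "j \<in> {1..Suc m}"
    have qV: "q \<in> V" and qW: "q \<in> W" using q W' by auto
    note qT = mem_topspace[OF W'(1) q]
    have et: "e k q \<in> tangent_space q" if "k \<in> {1..m}" for k
      using T10_tangent[OF field10_T10[OF e10[OF that] qW]] .
    have wt: "w q \<in> tangent_space q" using T10_tangent[OF field10_T10[OF w10 qV]] .
    have Zt: "Z q \<in> tangent_space q" using T10_tangent[OF field10_T10[OF Z(1) qV]] .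
    have eo: "g q (e k q) (conj_vec (e l q)) = (if k = l then 1 else 0)" if "k \<in> {1..m}" "l \<in> {1..m}" for k l
      using F qW that by (simp add: ortho_frame_def)
    have we: "g q (w q) (conj_vec (e l q)) = 0" if l: "l \<in> {1..m}" for l
    proof -
      have "g q (w q) (conj_vec (e l q)) =
          c l q + g q (\<Sum>k\<in>{1..m}. (- c k q) \<odot> e k q) (conj_vec (e l q))"
        unfolding w_def c_def
        by (intro g_add[OF qT] tangent_space_sum tangent_space_scale tangent_space_conj et l Zt)
      also have "g q (\<Sum>k\<in>{1..m}. (- c k q) \<odot> e k q) (conj_vec (e l q)) =
          (\<Sum>k\<in>{1..m}. (- c k q) * g q (e k q) (conj_vec (e l q)))"
        by (intro g_lin[OF qT] tangent_space_conj et l)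
      also have "(\<Sum>k\<in>{1..m}. (- c k q) * g q (e k q) (conj_vec (e l q))) = (\<Sum>k\<in>{1..m}. if k = l then - c k q else 0)"
        by (rule sum.cong) (use eo l in auto)
      also have "\<dots> = - c l q" using l by simp
      finally show ?thesis by simp
    qed
    have ew: "g q (e l q) (conj_vec (w q)) = 0" if l: "l \<in> {1..m}" for l
      using g_conj_left[OF qT wt et[OF l]] g_sym[OF qT et[OF l] tangent_space_conj[OF wt]] we[OF l] by simp
    have Nq: "0 < Re (N q)" "N q = of_real (Re (N q))"
      using q g_self_real[OF qT wt] by (simp_all add: W'_def N_def complex_eq_iff)
    have "(Re (N q) powr (-1/2)) * (Re (N q) powr (-1/2)) = Re (N q) powr (-1)"
      by (simp add: powr_add[symmetric])
    then have "s q * s q * of_real (Re (N q)) = 1"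
      using Nq(1) unfolding s_def by (simp add: powr_minus field_simps flip: of_real_mult)
    then have sN: "s q * (s q * N q) = 1" using Nq(2) by (simp add: mult.assoc)
    have ww: "g q (s q \<odot> w q) (conj_vec (s q \<odot> w q)) = 1"
      using wt sN by (simp add: conj_vec_scale g_scale[OF qT] g_scale_right[OF qT] tangent_space_conj tangent_space_scale N_def)
        (simp add: s_def)
    consider "i = Suc m" "j = Suc m" | "i = Suc m" "j \<in> {1..m}" | "i \<in> {1..m}" "j = Suc m" | "i \<in> {1..m}" "j \<in> {1..m}"
      using i j by force
    then show "g q (e' i q) (conj_vec (e' j q)) = (if i = j then 1 else 0)"
    proof cases
      case 1
      then show ?thesis using ww by (simp add: e'_def)
    next
      case 2
      then show ?thesis using we[OF 2(2)] wt et[OF 2(2)] by (simp add: e'_def g_scale[OF qT] tangent_space_conj)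
    next
      case 3
      then show ?thesis using ew[OF 3(1)] wt et[OF 3(1)]
        by (simp add: e'_def conj_vec_scale g_scale_right[OF qT] tangent_space_conj)
    next
      case 4
      then show ?thesis using eo[OF 4] by (simp add: e'_def)
    qed
  qed
  then show ?thesis using that pW' by blast
qed

theorem unitary_frame_exists:
  assumes "p \<in> topspace T"
  obtains W e where "p \<in> W" "unitary_frame W e"
proof -
  have "\<exists>W e. p \<in> W \<and> ortho_frame W m e" if "m \<le> n" for m
    using that
  proof (induction m)
    case 0
    show ?case
      by (rule exI[of _ "topspace T"]) (simp add: ortho_frame_def assms)
  next
    case (Suc m)
    then obtain W e where "p \<in> W" "ortho_frame W m e" by auto
    then show ?case using ortho_frame_extend[of W m e p] Suc.prems by (metis Suc_le_eq)
  qed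
  from this[of n] show ?thesis using that by (auto simp: unitary_ortho_frame)
qed

end


section \<open>The strong maximum principle\<close>

text \<open>On the line through x in direction \<xi> the first derivative vanishes at x. Were the
  second one positive, the first would be positive just after x, and by the mean value theorem the
  function would exceed its maximum.\<close>

lemma second_derivative_max:
  fixes f :: "'e::euclidean_space \<Rightarrow> complex"
  assumes f: "Cinf_on S f" and S: "open S" "x \<in> S" and max: "\<And>y. y \<in> S \<Longrightarrow> Re (f y) \<le> Re (f x)"
  shows "Re (frechet_derivative (\<lambda>y. frechet_derivative f (at y) \<xi>) (at x) \<xi>) \<le> 0"
proof (rule ccontr)
  let ?D = "\<lambda>y. frechet_derivative f (at y)"
  let ?f' = "\<lambda>y. ?D y \<xi>"
  let ?D2 = "frechet_derivative ?f' (at x)"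
  assume "\<not> Re (?D2 \<xi>) \<le> 0"
  then have pos: "0 < Re (?D2 \<xi>)" by simp
  obtain r where r: "0 < r" "ball x r \<subseteq> S" using S openE by blast
  \<comment> \<open>The summand 1 keeps d meaningful for \<xi> = 0.\<close>
  define d where "d = r / (norm \<xi> + 1)"
  have d: "0 < d" using r by (simp add: d_def add_nonneg_pos)
  have mem: "x + s *\<^sub>R \<xi> \<in> S" if "\<bar>s\<bar> < d" for s
  proof -
    have "\<bar>s\<bar> * norm \<xi> \<le> \<bar>s\<bar> * (norm \<xi> + 1)" by (simp add: mult_left_mono)
    also have "\<dots> < d * (norm \<xi> + 1)" using that by (simp add: add_nonneg_pos)
    also have "\<dots> = r" using norm_ge_zero[of \<xi>] unfolding d_def by (simp add: add_nonneg_eq_0_iff)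
    finally show ?thesis using r(2) by (auto simp: dist_norm)
  qed
  have line: "((\<lambda>s. x + s *\<^sub>R \<xi>) has_derivative (\<lambda>s. s *\<^sub>R \<xi>)) (at s)" for s
    by (auto intro!: derivative_eq_intros)
  have der: "((\<lambda>s. Re (h (x + s *\<^sub>R \<xi>))) has_real_derivative Re (h' \<xi>)) (at s)"
    if h: "(h has_derivative h') (at (x + s *\<^sub>R \<xi>))" for h :: "'e \<Rightarrow> complex" and h' s
  proof -
    have "((\<lambda>s. Re (h (x + s *\<^sub>R \<xi>))) has_derivative (\<lambda>s. Re (h' (s *\<^sub>R \<xi>)))) (at s)"
      using has_derivative_compose[OF line h] by (rule bounded_linear.has_derivative[OF bounded_linear_Re])
    moreover have "(\<lambda>s. Re (h' (s *\<^sub>R \<xi>))) = (*) (Re (h' \<xi>))"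
      using linear_scale[OF has_derivative_linear[OF h]] by (simp add: fun_eq_iff)
    ultimately show ?thesis
      unfolding has_field_derivative_def by (simp only:)
  qed
  define \<psi> where "\<psi> s = Re (f (x + s *\<^sub>R \<xi>))" for s
  define \<psi>' where "\<psi>' s = Re (?f' (x + s *\<^sub>R \<xi>))" for s
  have D1: "(\<psi> has_real_derivative \<psi>' s) (at s)" if "\<bar>s\<bar> < d" for s
    unfolding \<psi>_def \<psi>'_def by (rule der[OF Cinf_on_has_derivative[OF f mem[OF that]]])
  have "(?f' has_derivative ?D2) (at (x + 0 *\<^sub>R \<xi>))"
    using Cinf_on_has_derivative[OF Cinf_on_deriv[OF f] S(2)] by simp
  then have D2: "(\<psi>' has_real_derivative Re (?D2 \<xi>)) (at 0)"
    unfolding \<psi>'_def by (rule der)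
  have "\<psi>' 0 = 0"
    by (rule DERIV_local_max[OF D1 d]) (use d max mem in \<open>auto simp: \<psi>_def\<close>)
  with DERIV_pos_inc_right[OF D2 pos] obtain d' where d': "0 < d'" "\<And>h. 0 < h \<Longrightarrow> h < d' \<Longrightarrow> 0 < \<psi>' h"
    by auto
  define s where "s = min d d' / 2"
  have s: "0 < s" "s < d" "s < d'" using d d'(1) by (auto simp: s_def)
  have "\<exists>z. 0 < z \<and> z < s \<and> \<psi> s - \<psi> 0 = (s - 0) * \<psi>' z"
    by (rule MVT2[OF s(1)]) (use D1 s in auto)
  then obtain z where "0 < z" "z < s" "\<psi> s - \<psi> 0 = s * \<psi>' z" by auto
  then have "\<psi> 0 < \<psi> s" using d'(2)[of z] s by (smt (verit) mult_pos_pos)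
  moreover have "\<psi> s \<le> \<psi> 0" using max[OF mem[of s]] s by (simp add: \<psi>_def)
  ultimately show False by simp
qed

lemma first_derivative_max:
  fixes f :: "'e::euclidean_space \<Rightarrow> complex"
  assumes f: "Cinf_on S f" and S: "open S" "x \<in> S" and max: "\<And>y. y \<in> S \<Longrightarrow> Re (f y) \<le> Re (f x)"
    and real: "\<And>y. y \<in> S \<Longrightarrow> Im (f y) = 0"
  shows "frechet_derivative f (at x) v = 0"
proof -
  let ?D = "frechet_derivative f (at x)"
  have D: "(f has_derivative ?D) (at x)" by (rule Cinf_on_has_derivative[OF f S(2)])
  have R: "((\<lambda>y. Re (f y)) has_derivative (\<lambda>v. Re (?D v))) (at x)"
    by (rule bounded_linear.has_derivative[OF bounded_linear_Re D])
  have I: "((\<lambda>y. Im (f y)) has_derivative (\<lambda>v. Im (?D v))) (at x)"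
    by (rule bounded_linear.has_derivative[OF bounded_linear_Im D])
  have "(\<lambda>v. Re (?D v)) = (\<lambda>v. 0)"
    by (rule differential_zero_maxmin[OF S(2,1) R]) (use max in auto)
  moreover have "(\<lambda>v. Im (?D v)) = (\<lambda>v. 0)"
    by (rule differential_zero_maxmin[OF S(2,1) I]) (use real S(2) in auto)
  ultimately show ?thesis by (simp add: complex_eq_iff fun_eq_iff)
qed

text \<open>Take x0 with F x0 < M close to z, and let y be a nearest point to x0 among the points
  with F = M. The closed ball with diameter from x0 to y lies in the ball around x0 through y and
  touches its boundary at y alone, so F = M at no other of its points.\<close>

lemma touching_ball:
  fixes F :: "'e::euclidean_space \<Rightarrow> real"
  assumes \<Omega>: "open \<Omega>" "z \<in> \<Omega>" and F: "continuous_on \<Omega> F" "\<And>x. x \<in> \<Omega> \<Longrightarrow> F x \<le> M" "F z = M"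
    and near: "\<And>r. 0 < r \<Longrightarrow> \<exists>x\<in>\<Omega>. dist z x < r \<and> F x < M"
  obtains y c \<rho> where "y \<in> \<Omega>" "F y = M" "0 < \<rho>" "dist c y = \<rho>" "cball c \<rho> \<subseteq> \<Omega>"
    "\<And>x. x \<in> cball c \<rho> \<Longrightarrow> x \<noteq> y \<Longrightarrow> F x < M"
proof -
  obtain r where r: "0 < r" "cball z r \<subseteq> \<Omega>" using \<Omega> open_contains_cball by blast
  obtain x0 where x0: "x0 \<in> \<Omega>" "dist z x0 < r / 2" "F x0 < M" using near[of "r/2"] r by auto
  define K where "K = cball z r \<inter> F -` {M}"
  have cont: "continuous_on (cball z r) F" using F(1) r(2) continuous_on_subset by blast
  have "closed K" unfolding K_def
    by (rule continuous_closed_preimage[OF cont]) auto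
  moreover have "z \<in> K" using F(3) r by (simp add: K_def)
  ultimately obtain y where y: "y \<in> K" "\<And>x. x \<in> K \<Longrightarrow> dist x0 y \<le> dist x0 x"
    using distance_attains_inf[of K x0] by blast
  have y': "y \<in> \<Omega>" "F y = M" using y(1) r(2) by (auto simp: K_def)
  define R where "R = dist x0 y"
  have R: "R \<le> dist x0 z" using y(2)[OF \<open>z \<in> K\<close>] by (simp add: R_def)
  have "R \<noteq> 0" using y' x0(3) by (auto simp: R_def)
  then have Rpos: "0 < R" by (simp add: R_def)
  \<comment> \<open>Both \<open>dist z x0\<close> and R are at most r/2; this is why x0 was chosen
    within r/2 of z.\<close>
  have sub: "cball x0 R \<subseteq> cball z r"
  proof
    fix x assume "x \<in> cball x0 R"
    then have "dist z x \<le> dist z x0 + R" using dist_triangle[of z x x0] by (simp add: dist_commute)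
    then show "x \<in> cball z r" using R x0(2) by (simp add: dist_commute)
  qed
  have inner: "F x < M" if "dist x0 x < R" for x
  proof -
    have "x \<in> cball x0 R" using that by simp
    then have xz: "x \<in> cball z r" using sub by blast
    have "x \<notin> K" using y(2)[of x] that by (auto simp: R_def)
    then have "F x \<noteq> M" using xz by (auto simp: K_def)
    then show ?thesis using F(2)[of x] xz r(2) by fastforce
  qed
  define c where "c = (1/2) *\<^sub>R (x0 + y)"
  have "c - y = (1/2) *\<^sub>R (x0 - y)" unfolding c_def by (simp add: algebra_simps flip: scaleR_add_left)
  then have cy: "dist c y = R / 2" by (simp add: dist_norm R_def)
  have "x0 - c = (1/2) *\<^sub>R (x0 - y)" unfolding c_def by (simp add: algebra_simps flip: scaleR_add_left)
  then have xc': "dist x0 c = R / 2" by (simp add: dist_norm R_def)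
  have in_R: "dist x0 x \<le> R" if "x \<in> cball c (R/2)" for x
    using dist_triangle[of x0 x c] that xc' by simp
  \<comment> \<open>\<open>dist x0 x = R\<close> would be equality in the triangle inequality
    through the midpoint c, forcing x0 - c = c - x and hence x = y.\<close>
  have strict: "dist x0 x < R" if x: "x \<in> cball c (R/2)" "x \<noteq> y" for x
  proof (rule ccontr)
    assume "\<not> dist x0 x < R"
    then have nx: "norm (x0 - x) = R" using in_R[OF x(1)] by (simp add: dist_norm)
    have cx: "norm (c - x) \<le> R / 2" using x(1) by (simp add: dist_norm)
    have nc: "norm (x0 - c) = R / 2" using xc' by (simp add: dist_norm)
    have split: "norm ((x0 - c) + (c - x)) = R" using nx by simp
    then have n2: "norm (c - x) = R / 2"
      using cx nc norm_triangle_ineq[of "x0 - c" "c - x"] by linarith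
    have eq: "norm ((x0 - c) + (c - x)) = norm (x0 - c) + norm (c - x)"
      unfolding split n2 nc by simp
    have "norm (x0 - c) *\<^sub>R (c - x) = norm (c - x) *\<^sub>R (x0 - c)"
      using eq by (simp only: norm_triangle_eq)
    then have "x0 - c = c - x" using n2 nc Rpos by simp
    then have "x = c + c - x0" by (simp add: algebra_simps)
    also have "\<dots> = y" unfolding c_def by (simp add: algebra_simps flip: scaleR_add_left)
    finally show False using x(2) by simp
  qed
  show ?thesis
  proof (rule that[OF y' _ cy])
    show "0 < R / 2" using Rpos by simp
    show "cball c (R / 2) \<subseteq> \<Omega>" using in_R sub r(2) by (meson mem_cball subset_iff)
    show "F x < M" if "x \<in> cball c (R / 2)" "x \<noteq> y" for x using inner strict that by blast
  qed
qed

text \<open>Hopf's barrier \<open>h\<close> vanishes on the sphere and is negative just outside it, while \<open>F\<close> is below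
  its maximum inside the ball; hence adding a small multiple of \<open>h\<close> to \<open>F\<close> produces an interior
  maximum close to the touching point \<open>y\<close>.\<close>

lemma barrier_max:
  fixes F :: "'e::euclidean_space \<Rightarrow> real"
  assumes N: "open N" "y \<in> N" and F: "continuous_on N F" "\<And>x. x \<in> N \<Longrightarrow> F x \<le> M" "F y = M"
    and touch: "\<And>x. x \<in> cball c \<rho> \<Longrightarrow> x \<in> N \<Longrightarrow> x \<noteq> y \<Longrightarrow> F x < M" and cy: "dist c y = \<rho>"
    and \<beta>: "0 \<le> \<beta>" and h: "\<And>x. h x = (\<rho>\<^sup>2 - (dist c x)\<^sup>2) + \<beta> * (\<rho>\<^sup>2 - (dist c x)\<^sup>2)\<^sup>2"
  obtains \<epsilon> x1 V where "0 < \<epsilon>" "open V" "x1 \<in> V" "V \<subseteq> N"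
    "\<And>x. x \<in> V \<Longrightarrow> F x + \<epsilon> * h x \<le> F x1 + \<epsilon> * h x1"
proof -
  have \<rho>0: "0 \<le> \<rho>" using zero_le_dist[of c y] unfolding cy .
  define t where "t x = \<rho>\<^sup>2 - (dist c x)\<^sup>2" for x
  have ht: "h x = t x * (1 + \<beta> * t x)" for x by (simp add: h t_def power2_eq_square algebra_simps)
  have ct: "continuous_on UNIV t" unfolding t_def by (intro continuous_intros)
  have ty: "t y = 0" by (simp add: t_def cy)
  have "open {x. 0 < 1 + \<beta> * t x}"
    by (intro open_Collect_less continuous_intros ct)
  then have "open (N \<inter> {x. 0 < 1 + \<beta> * t x})" using N by blast
  moreover have "y \<in> N \<inter> {x. 0 < 1 + \<beta> * t x}" using N ty by simp
  \<comment> \<open>\<delta> is so small that the factor 1 + \<beta> t is positive on the ball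
    around y. There h has the sign of t, so h is nonnegative only within distance \<rho> of
    c.\<close>
  ultimately obtain \<delta> where \<delta>: "0 < \<delta>" "cball y \<delta> \<subseteq> N \<inter> {x. 0 < 1 + \<beta> * t x}"
    using open_contains_cball by blast
  have cF: "continuous_on (cball y \<delta>) F" using F(1) \<delta>(2) continuous_on_subset by blast
  have ch: "continuous_on S h" for S unfolding ht by (intro continuous_intros continuous_on_subset[OF ct]) auto
  have tpos: "0 \<le> t x" if "x \<in> cball y \<delta>" "0 \<le> h x" for x
  proof (rule ccontr)
    assume "\<not> 0 \<le> t x"
    moreover have "0 < 1 + \<beta> * t x" using that(1) \<delta>(2) by auto
    ultimately have "h x < 0" unfolding ht by (simp add: mult_neg_pos)
    then show False using that(2) by simp
  qed
  have less: "F x < M" if "x \<in> sphere y \<delta>" "0 \<le> h x" for x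
  proof (rule touch)
    have x: "x \<in> cball y \<delta>" using that by simp
    have "(dist c x)\<^sup>2 \<le> \<rho>\<^sup>2" using tpos[OF x that(2)] by (simp add: t_def)
    then have "dist c x \<le> \<rho>" using \<rho>0 by (rule power2_le_imp_le)
    then show "x \<in> cball c \<rho>" by simp
    show "x \<in> N" using subsetD[OF \<delta>(2) x] by simp
    show "x \<noteq> y" using that(1) \<delta>(1) by auto
  qed
  define K where "K = sphere y \<delta> \<inter> h -` {0..}"
  have "compact K"
  proof -
    have "closed K" unfolding K_def by (rule continuous_closed_preimage[OF ch]) auto
    then have "compact (sphere y \<delta> \<inter> K)" by (rule compact_Int_closed[OF compact_sphere])
    moreover have "sphere y \<delta> \<inter> K = K" unfolding K_def by blast
    ultimately show ?thesis by simp
  qed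
  \<comment> \<open>K is the part of the small sphere where h could raise the sum. It lies in the
    touching ball away from y, so by compactness F stays below M on it by a fixed amount, and
    \<epsilon> is taken too small to use this amount up.\<close>
  obtain \<epsilon> where \<epsilon>: "0 < \<epsilon>" "\<And>x. x \<in> K \<Longrightarrow> F x + \<epsilon> * h x < M"
  proof (cases "K = {}")
    case True
    then show ?thesis using that[of 1] by simp
  next
    case False
    have cFK: "continuous_on K F" by (rule continuous_on_subset[OF cF]) (auto simp: K_def)
    obtain a where a: "a \<in> K" "\<And>x. x \<in> K \<Longrightarrow> F x \<le> F a"
      using continuous_attains_sup[OF \<open>compact K\<close> False cFK] by blast
    obtain b where b: "b \<in> K" "\<And>x. x \<in> K \<Longrightarrow> h x \<le> h b"
      using continuous_attains_sup[OF \<open>compact K\<close> False ch] by blast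
    have Fa: "F a < M" using a(1) less by (auto simp: K_def)
    have hb: "0 \<le> h b" using b(1) by (auto simp: K_def)
    \<comment> \<open>The gap M - F a, divided by a bound for h on K; the summand 1 keeps the
      denominator positive when \<open>h b = 0\<close>.\<close>
    define \<epsilon> where "\<epsilon> = (M - F a) / (h b + 1)"
    have "0 < \<epsilon>" using Fa hb by (simp add: \<epsilon>_def)
    moreover have "F x + \<epsilon> * h x < M" if "x \<in> K" for x
    proof -
      have "\<epsilon> * h x \<le> \<epsilon> * h b" using b(2)[OF that] \<open>0 < \<epsilon>\<close> by simp
      also have "\<dots> < \<epsilon> * (h b + 1)" using \<open>0 < \<epsilon>\<close> by simp
      also have "\<dots> = M - F a" using hb by (simp add: \<epsilon>_def)
      finally show ?thesis using a(2)[OF that] by simp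
    qed
    ultimately show ?thesis by (rule that)
  qed
  have sph: "F x + \<epsilon> * h x < M" if x: "x \<in> sphere y \<delta>" for x
  proof (cases "0 \<le> h x")
    case True
    then show ?thesis using \<epsilon>(2)[of x] x by (simp add: K_def)
  next
    case False
    then have "\<epsilon> * h x < 0" using \<epsilon>(1) by (simp add: mult_pos_neg)
    moreover have "F x \<le> M" using F(2) x \<delta>(2) by auto
    ultimately show ?thesis by simp
  qed
  have "continuous_on (cball y \<delta>) (\<lambda>x. F x + \<epsilon> * h x)" by (intro continuous_intros cF ch)
  then obtain x1 where x1: "x1 \<in> cball y \<delta>" "\<And>x. x \<in> cball y \<delta> \<Longrightarrow> F x + \<epsilon> * h x \<le> F x1 + \<epsilon> * h x1"
    using continuous_attains_sup[OF compact_cball, of y \<delta> "\<lambda>x. F x + \<epsilon> * h x"] \<delta>(1) by auto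
  \<comment> \<open>h vanishes at y, so the sum equals M there, while it is below M on the sphere;
    the maximum over the closed ball is therefore interior.\<close>
  have "M \<le> F x1 + \<epsilon> * h x1" using x1(2)[of y] \<delta>(1) by (simp add: F(3) ht ty)
  then have "x1 \<notin> sphere y \<delta>" using sph by fastforce
  then have "x1 \<in> ball y \<delta>" using x1(1) by auto
  moreover have "ball y \<delta> \<subseteq> N" using \<delta>(2) ball_subset_cball by blast
  ultimately show ?thesis using that[OF \<epsilon>(1) open_ball, of x1 y \<delta>] x1(2) by auto
qed

context smooth_manifold
begin

section \<open>Derivative tests at a maximum on a manifold\<close>

lemma coord_conj: "conj_vec v (coord \<phi> b) = cnj (v (coord \<phi> b))"
proof -
  have "(\<lambda>q. cnj (coord \<phi> b q)) = coord \<phi> b" by (simp add: coord_def fun_eq_iff)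
  then show ?thesis by (simp only: conj_vec_def)
qed

text \<open>The double sum contracts the Hessian of u in the chart with conj(a) and a. As u is real,
  so are the entries of the Hessian, and the real part of the sum splits into its quadratic forms at
  Re a and at Im a. Each of them is a second derivative along a line.\<close>

lemma coord_field_max:
  assumes U: "(U, \<phi>) \<in> A" "p \<in> U" and W: "openin T W" "p \<in> W" and u: "smooth_fun W u"
    and real: "\<And>q. q \<in> W \<Longrightarrow> Im (u q) = 0" and max: "\<And>q. q \<in> W \<Longrightarrow> Re (u q) \<le> Re (u p)"
  shows "coord_field U \<phi> b p u = 0"
    and "Re (\<Sum>b\<in>Basis. \<Sum>c\<in>Basis. (cnj (a b) * a c) * coord_field U \<phi> c p (\<lambda>q. coord_field U \<phi> b q u)) \<le> 0"
proof -
  let ?u = "u \<circ> inv_into U \<phi>" and ?S = "\<phi> ` (U \<inter> W)" and ?x = "\<phi> p"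
  let ?D = "\<lambda>x. frechet_derivative ?u (at x)"
  have S: "open ?S" "?x \<in> ?S" using chart_image_open[OF U(1) W(1)] U W by auto
  have Cu: "Cinf_on ?S ?u" by (rule smooth_funD[OF u U(1)])
  have Smax: "Re (?u y) \<le> Re (?u ?x)" "Im (?u y) = 0" if "y \<in> ?S" for y
    using that max real chart_inv[OF U(1)] U(2) by auto
  have near: "smooth_near q u" if "q \<in> W" for q using smooth_nearI[OF W(1) that u] .
  show "coord_field U \<phi> b p u = 0" for b
    using first_derivative_max[OF Cu S Smax, of b] near[OF W(2)]
    by (simp add: coord_field_def o_def)
  define H where "H c b = frechet_derivative (\<lambda>y. ?D y b) (at ?x) c" for c b
  have cH: "coord_field U \<phi> c p (\<lambda>q. coord_field U \<phi> b q u) = H c b" for c b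
  proof -
    have WU: "openin T (U \<inter> W)" using W chart_openin[OF U(1)] by blast
    have sm: "smooth_fun (U \<inter> W) (\<lambda>q. coord_field U \<phi> b q u)"
      by (rule field_on_smooth[OF field_on_coord[OF U(1)] WU _ smooth_fun_subset[OF u]]) auto
    have "frechet_derivative ((\<lambda>q. coord_field U \<phi> b q u) \<circ> inv_into U \<phi>) (at ?x) = frechet_derivative (\<lambda>y. ?D y b) (at ?x)"
      by (rule frechet_derivative_cong_open(2)[OF S]) (use near chart_inv[OF U(1)] in \<open>auto simp: coord_field_def\<close>)
    then show ?thesis using smooth_nearI[OF WU _ sm, of p] U W by (simp add: coord_field_def[of U \<phi> c p] H_def)
  qed
  have DD: "((\<lambda>y. ?D y b) has_derivative (\<lambda>c. H c b)) (at ?x)" for b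
    unfolding H_def by (rule Cinf_on_has_derivative[OF Cinf_on_deriv[OF Cu] S(2)])
  have Hlin: "H (\<Sum>c\<in>Basis. s c *\<^sub>R c) b = (\<Sum>c\<in>Basis. s c *\<^sub>R H c b)" for s b
  proof -
    interpret l: linear "\<lambda>c. H c b" by (rule has_derivative_linear[OF DD])
    show ?thesis unfolding l.sum l.scale ..
  qed
  have Im_H: "Im (H c b) = 0" for b c
  proof -
    have "((\<lambda>y. Im (?D y b)) has_derivative (\<lambda>c. Im (H c b))) (at ?x)"
      by (rule bounded_linear.has_derivative[OF bounded_linear_Im DD])
    moreover have "Im (?D y b) = 0" if y: "y \<in> ?S" for y
    proof -
      have "((\<lambda>y. Im (?u y)) has_derivative (\<lambda>v. Im (?D y v))) (at y)"
        by (rule bounded_linear.has_derivative[OF bounded_linear_Im Cinf_on_has_derivative[OF Cu y]])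
      then have "(\<lambda>v. Im (?D y v)) = (\<lambda>v. 0)"
        by (rule differential_zero_maxmin[OF y S(1)]) (use Smax(2) y in simp)
      then show ?thesis by (simp add: fun_eq_iff)
    qed
    ultimately have "(\<lambda>c. Im (H c b)) = (\<lambda>v. 0)"
      using S by (intro differential_zero_maxmin[OF S(2,1)]) auto
    then show ?thesis by (simp add: fun_eq_iff)
  qed
  have quad: "(\<Sum>b\<in>Basis. \<Sum>c\<in>Basis. (s b * s c) * Re (H c b)) \<le> 0" for s
  proof -
    define \<xi> where "\<xi> = (\<Sum>b\<in>Basis. s b *\<^sub>R b)"
    have D\<xi>: "?D y \<xi> = (\<Sum>b\<in>Basis. s b *\<^sub>R ?D y b)" if y: "y \<in> ?S" for y
    proof -
      interpret l: linear "?D y" by (rule has_derivative_linear[OF Cinf_on_has_derivative[OF Cu y]])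
      show ?thesis unfolding \<xi>_def l.sum l.scale ..
    qed
    have "frechet_derivative (\<lambda>y. ?D y \<xi>) (at ?x) = frechet_derivative (\<lambda>y. \<Sum>b\<in>Basis. s b *\<^sub>R ?D y b) (at ?x)"
      by (rule frechet_derivative_cong_open(2)[OF S D\<xi>])
    also have "\<dots> = (\<lambda>c. \<Sum>b\<in>Basis. s b *\<^sub>R H c b)"
      by (rule frechet_derivative_at[symmetric], intro has_derivative_sum has_derivative_scaleR_right DD)
    finally have "frechet_derivative (\<lambda>y. ?D y \<xi>) (at ?x) \<xi> = (\<Sum>b\<in>Basis. s b *\<^sub>R H \<xi> b)" by simp
    also have "\<dots> = (\<Sum>b\<in>Basis. \<Sum>c\<in>Basis. (s b * s c) *\<^sub>R H c b)"
      unfolding \<xi>_def Hlin by (simp add: scaleR_sum_right)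
    finally show ?thesis
      using second_derivative_max[OF Cu S Smax(1), of \<xi>] by (simp del: o_apply comp_apply add: Re_sum)
  qed
  have Re_eq: "Re ((cnj (a b) * a c) * H c b) = (Re (a b) * Re (a c)) * Re (H c b) + (Im (a b) * Im (a c)) * Re (H c b)" for b c
    by (simp add: Im_H algebra_simps)
  show "Re (\<Sum>b\<in>Basis. \<Sum>c\<in>Basis. (cnj (a b) * a c) * coord_field U \<phi> c p (\<lambda>q. coord_field U \<phi> b q u)) \<le> 0"
    using quad[of "\<lambda>b. Re (a b)"] quad[of "\<lambda>b. Im (a b)"]
    unfolding cH Re_sum Re_eq by (simp only: sum.distrib)
qed

lemma tangent_max:
  assumes W: "openin T W" "p \<in> W" and u: "smooth_fun W u"
    and real: "\<And>q. q \<in> W \<Longrightarrow> Im (u q) = 0" and max: "\<And>q. q \<in> W \<Longrightarrow> Re (u q) \<le> Re (u p)"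
    and v: "v \<in> tangent_space p"
  shows "v u = 0"
proof -
  have "p \<in> topspace T" using W openin_subset by blast
  then obtain U \<phi> where U: "(U, \<phi>) \<in> A" "p \<in> U" by (rule chart_at)
  have "v u = (\<Sum>b\<in>Basis. v (coord \<phi> b) \<odot> coord_field U \<phi> b p) u"
    using tangent_expansion[OF U v] by (rule fun_cong)
  also have "\<dots> = (\<Sum>b\<in>Basis. v (coord \<phi> b) * coord_field U \<phi> b p u)"
    unfolding sum_tvec_apply cscale_apply ..
  finally show ?thesis using coord_field_max(1)[OF U W u real max] by simp
qed

text \<open>In coordinates X (conj X u) is a contraction of the Hessian of u plus first derivatives
  of u multiplied by derivatives of the coefficients; the latter terms vanish at a maximum.\<close>

lemma field_max:
  assumes W: "openin T W" "p \<in> W" and u: "smooth_fun W u"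
    and real: "\<And>q. q \<in> W \<Longrightarrow> Im (u q) = 0" and max: "\<And>q. q \<in> W \<Longrightarrow> Re (u q) \<le> Re (u p)"
    and X: "field_on W X"
  shows "Re (X p (\<lambda>q. conj_field X q u)) \<le> 0"
proof -
  have "p \<in> topspace T" using W openin_subset by blast
  then obtain U \<phi> where U: "(U, \<phi>) \<in> A" "p \<in> U" by (rule chart_at)
  define a where "a q b = X q (coord \<phi> b)" for q b
  let ?V = "U \<inter> W"
  have V: "openin T ?V" "p \<in> ?V" using W U chart_openin[OF U(1)] by auto
  have as: "smooth_near p (\<lambda>q. cnj (a q b))" for b
    unfolding a_def
    by (rule smooth_nearI[OF V], rule smooth_fun_cnj[OF V(1)], rule field_on_smooth[OF X V(1)])
      (auto intro: smooth_fun_subset[OF smooth_fun_coord[OF U(1)]])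
  have us: "smooth_near p (\<lambda>q. coord_field U \<phi> b q u)" for b
    by (rule smooth_nearI[OF V], rule field_on_smooth[OF field_on_coord[OF U(1)] V(1)])
      (auto intro: smooth_fun_subset[OF u])
  note Xp = field_onD[OF X W(2)]
  have apply_exp: "v h = (\<Sum>b\<in>Basis. v (coord \<phi> b) * coord_field U \<phi> b q h)"
    if "q \<in> U" "v \<in> tangent_space q" for v q h
  proof -
    have "v h = (\<Sum>b\<in>Basis. v (coord \<phi> b) \<odot> coord_field U \<phi> b q) h"
      using tangent_expansion[OF U(1) that] by (rule fun_cong)
    then show ?thesis unfolding sum_tvec_apply cscale_apply .
  qed
  have "X p (\<lambda>q. conj_field X q u) = X p (\<lambda>q. \<Sum>b\<in>Basis. cnj (a q b) * coord_field U \<phi> b q u)"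
  proof (rule tangent_cong[OF Xp V])
    fix q assume q: "q \<in> ?V"
    show "conj_field X q u = (\<Sum>b\<in>Basis. cnj (a q b) * coord_field U \<phi> b q u)"
      using apply_exp[of q "conj_field X q" u] q field_onD[OF field_on_conj[OF X], of q]
      by (simp add: conj_field_def coord_conj a_def)
  qed
  also have "\<dots> = (\<Sum>b\<in>Basis. X p (\<lambda>q. cnj (a q b) * coord_field U \<phi> b q u))"
    by (rule tangent_sum[OF Xp smooth_near_mult[OF as us]])
  also have "\<dots> = (\<Sum>b\<in>Basis. cnj (a p b) * X p (\<lambda>q. coord_field U \<phi> b q u))"
    by (rule sum.cong) (simp_all add: tangent_mult[OF Xp as us] coord_field_max(1)[OF U W u real max])
  also have "\<dots> = (\<Sum>b\<in>Basis. \<Sum>c\<in>Basis. (cnj (a p b) * a p c) * coord_field U \<phi> c p (\<lambda>q. coord_field U \<phi> b q u))"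
    unfolding apply_exp[OF U(2) Xp] a_def[symmetric] by (simp add: sum_distrib_left mult.assoc)
  finally show ?thesis using coord_field_max(2)[OF U W u real max] by simp
qed

lemma smooth_fun_continuous_map:
  assumes "smooth_fun (topspace T) f"
  shows "continuous_map T euclidean f"
  unfolding continuous_map_def using smooth_fun_preimage_open[OF openin_topspace assms] by auto

end

context almost_hermitian_manifold
begin

section \<open>The operator of a unitary frame and the maximum principle\<close>

text \<open>A second order operator without term of order zero. If B is the sum of the nabla_{e_a}
  conj(e_a), it is the trace of the second covariant derivative of u over the pairs (e_a,
  conj(e_a)). B is left arbitrary because the maximum principle holds for every drift.\<close>

definition frame_operator ::
    "(nat \<Rightarrow> 'a vfield) \<Rightarrow> 'a vfield \<Rightarrow> ('a \<Rightarrow> complex) \<Rightarrow> 'a \<Rightarrow> complex" where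
  "frame_operator e B u q = (\<Sum>a\<in>{1..n}. e a q (\<lambda>r. conj_field (e a) r u)) - B q u"

lemma frame_operator_smooth:
  assumes F: "unitary_frame W e" and B: "field_on W B" and V: "openin T V" "V \<subseteq> W" and u: "smooth_fun V u"
  shows "smooth_fun V (frame_operator e B u)"
proof -
  have e: "field_on W (e a)" if "a \<in> {1..n}" for a using F that by (simp add: unitary_frame_def)
  have "smooth_fun V (\<lambda>q. e a q (\<lambda>r. conj_field (e a) r u))" if "a \<in> {1..n}" for a
    by (rule field_on_smooth[OF e[OF that] V], rule field_on_smooth[OF field_on_conj[OF e[OF that]] V u])
  moreover have "smooth_fun V (\<lambda>q. B q u)" by (rule field_on_smooth[OF B V u])
  ultimately have "smooth_fun V (\<lambda>q. (\<Sum>a\<in>{1..n}. e a q (\<lambda>r. conj_field (e a) r u)) - B q u)"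
    by (intro smooth_fun_diff smooth_fun_sum V(1))
  then show ?thesis by (simp add: frame_operator_def[abs_def])
qed

lemma frame_operator_max:
  assumes F: "unitary_frame W e" and B: "field_on W B" and V: "openin T V" "V \<subseteq> W" "p \<in> V"
    and u: "smooth_fun V u" and real: "\<And>q. q \<in> V \<Longrightarrow> Im (u q) = 0"
    and max: "\<And>q. q \<in> V \<Longrightarrow> Re (u q) \<le> Re (u p)"
  shows "Re (frame_operator e B u p) \<le> 0"
proof -
  have e: "field_on V (e a)" if "a \<in> {1..n}" for a
    using F that field_on_subset[OF _ V(2)] by (simp add: unitary_frame_def)
  have "B p u = 0"
    by (rule tangent_max[OF V(1,3) u real max]) (use field_onD[OF B] V in auto)
  moreover have "(\<Sum>a\<in>{1..n}. Re (e a p (\<lambda>r. conj_field (e a) r u))) \<le> 0"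
    by (rule sum_nonpos) (rule field_max[OF V(1,3) u real max e])
  ultimately show ?thesis by (simp add: frame_operator_def)
qed

lemma frame_operator_add:
  assumes F: "unitary_frame W e" and B: "field_on W B" and V: "openin T V" "V \<subseteq> W" "p \<in> V"
    and u: "smooth_fun V u" and w: "smooth_fun V w"
  shows "frame_operator e B (\<lambda>q. u q + c * w q) p = frame_operator e B u p + c * frame_operator e B w p"
proof -
  have e: "field_on V (e a)" if "a \<in> {1..n}" for a
    using F that field_on_subset[OF _ V(2)] by (simp add: unitary_frame_def)
  have lin: "X q (\<lambda>q. f q + c * h q) = X q f + c * X q h"
    if "field_on V X" "q \<in> V" "smooth_fun V f" "smooth_fun V h" for X q f h
  proof -
    note t = field_onD[OF that(1,2)] and s = smooth_nearI[OF V(1) that(2)]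
    show ?thesis
      using tangent_add[OF t s[OF that(3)] smooth_near_cmult[OF s[OF that(4)]]] tangent_cmult[OF t s[OF that(4)]] by simp
  qed
  have "e a p (\<lambda>r. conj_field (e a) r (\<lambda>q. u q + c * w q)) =
      e a p (\<lambda>r. conj_field (e a) r u) + c * e a p (\<lambda>r. conj_field (e a) r w)" if a: "a \<in> {1..n}" for a
  proof -
    note ca = field_on_conj[OF e[OF a]]
    have "e a p (\<lambda>r. conj_field (e a) r (\<lambda>q. u q + c * w q)) =
        e a p (\<lambda>r. conj_field (e a) r u + c * conj_field (e a) r w)"
      by (rule tangent_cong[OF field_onD[OF e[OF a] V(3)] V(1,3)]) (rule lin[OF ca _ u w])
    also have "\<dots> = e a p (\<lambda>r. conj_field (e a) r u) + c * e a p (\<lambda>r. conj_field (e a) r w)"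
      by (rule lin[OF e[OF a] V(3)]) (rule field_on_smooth[OF ca V(1) subset_refl], rule u w)+
    finally show ?thesis .
  qed
  moreover have "B p (\<lambda>q. u q + c * w q) = B p u + c * B p w"
    by (rule lin[OF field_on_subset[OF B V(2)] V(3) u w])
  ultimately show ?thesis
    by (simp add: frame_operator_def sum.distrib sum_distrib_left algebra_simps)
qed

text \<open>Applied to t^2 the operator L gives 2 t L t plus twice the sum of (e_a t)(conj(e_a) t),
  and for real t these products are |e_a t|^2. At a zero of t only the squares are left, so a large
  \<beta> can outweigh L t.\<close>

lemma frame_operator_barrier:
  assumes F: "unitary_frame W e" and B: "field_on W B" and V: "openin T V" "V \<subseteq> W" "p \<in> V"
    and t: "smooth_fun V t" "t p = 0" and real: "\<And>q. q \<in> V \<Longrightarrow> Im (t q) = 0"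
  shows "frame_operator e B (\<lambda>q. t q + \<beta> * (t q * t q)) p =
    frame_operator e B t p + 2 * \<beta> * (\<Sum>a\<in>{1..n}. e a p t * cnj (e a p t))"
proof -
  have e: "field_on V (e a)" if "a \<in> {1..n}" for a
    using F that field_on_subset[OF _ V(2)] by (simp add: unitary_frame_def)
  have first: "X q (\<lambda>q. t q + \<beta> * (t q * t q)) = (1 + 2 * \<beta> * t q) * X q t"
    if "field_on V X" "q \<in> V" for X q
  proof -
    note T = field_onD[OF that] and s = smooth_nearI[OF V(1) that(2) t(1)]
    show ?thesis
      using tangent_add[OF T s smooth_near_cmult[OF smooth_near_mult[OF s s]]]
        tangent_cmult[OF T smooth_near_mult[OF s s]] tangent_mult[OF T s s]
      by (simp add: algebra_simps)
  qed
  have conj_t: "conj_field X p t = cnj (X p t)" if X: "field_on V X" for X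
  proof -
    have "X p (\<lambda>q. cnj (t q)) = X p t"
      by (rule tangent_cong[OF field_onD[OF X V(3)] V(1,3)]) (use real in \<open>simp add: complex_eq_iff\<close>)
    then show ?thesis by (simp add: conj_field_def conj_vec_def)
  qed
  have "e a p (\<lambda>r. conj_field (e a) r (\<lambda>q. t q + \<beta> * (t q * t q))) =
      e a p (\<lambda>r. conj_field (e a) r t) + 2 * \<beta> * (e a p t * cnj (e a p t))" if a: "a \<in> {1..n}" for a
  proof -
    note ca = field_on_conj[OF e[OF a]] and T = field_onD[OF e[OF a] V(3)]
    note s = smooth_nearI[OF V(1,3) t(1)]
    note sc = smooth_nearI[OF V(1,3) field_on_smooth[OF ca V(1) subset_refl t(1)]]
    have sl: "smooth_near p (\<lambda>r. 1 + 2 * \<beta> * t r)"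
      by (intro smooth_near_add smooth_near_const smooth_near_cmult s smooth_near_topspace[OF s])
    have "e a p (\<lambda>r. conj_field (e a) r (\<lambda>q. t q + \<beta> * (t q * t q))) =
        e a p (\<lambda>r. (1 + 2 * \<beta> * t r) * conj_field (e a) r t)"
      by (rule tangent_cong[OF T V(1,3)]) (rule first[OF ca])
    also have "\<dots> = (1 + 2 * \<beta> * t p) * e a p (\<lambda>r. conj_field (e a) r t) +
        conj_field (e a) p t * e a p (\<lambda>r. 1 + 2 * \<beta> * t r)"
      by (rule tangent_mult[OF T sl sc])
    also have "e a p (\<lambda>r. 1 + 2 * \<beta> * t r) = 2 * \<beta> * e a p t"
      using tangent_add[OF T smooth_near_const[OF smooth_near_topspace[OF s]] smooth_near_cmult[OF s]]
        tangent_const[OF T] tangent_cmult[OF T s] by simp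
    finally show ?thesis using t(2) by (simp add: conj_t[OF e[OF a]])
  qed
  moreover have "B p (\<lambda>q. t q + \<beta> * (t q * t q)) = B p t"
    using first[OF field_on_subset[OF B V(2)] V(3)] t(2) by simp
  ultimately show ?thesis
    by (simp add: frame_operator_def sum.distrib sum_distrib_left)
qed

text \<open>Ellipticity. For real t the derivative along conj(e_a) is the conjugate of that along
  e_a; were all of them zero, t would have zero differential at p, as the frame and its conjugate
  span.\<close>

lemma frame_detects:
  assumes F: "unitary_frame W e" and p: "p \<in> W" and v: "v \<in> tangent_space p" "v t \<noteq> 0"
    and V: "openin T V" "p \<in> V" and real: "\<And>q. q \<in> V \<Longrightarrow> Im (t q) = 0"
  shows "0 < Re (\<Sum>a\<in>{1..n}. e a p t * cnj (e a p t))"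
proof -
  have c: "conj_vec (e a p) t = cnj (e a p t)" if "a \<in> {1..n}" for a
  proof -
    have "e a p (\<lambda>q. cnj (t q)) = e a p t"
      by (rule tangent_cong[OF unitary_frame_tangent(4)[OF F p that] V]) (use real in \<open>simp add: complex_eq_iff\<close>)
    then show ?thesis by (simp add: conj_vec_def)
  qed
  have "\<exists>a\<in>{1..n}. e a p t \<noteq> 0"
  proof (rule ccontr)
    assume "\<not> ?thesis"
    then have 0: "e a p t = 0" if "a \<in> {1..n}" for a using that by blast
    have "v t = ((\<Sum>i\<in>{1..n}. g p v (conj_vec (e i p)) \<odot> e i p) + (\<Sum>i\<in>{1..n}. g p v (e i p) \<odot> conj_vec (e i p))) t"
      by (rule fun_cong[OF frame_expansion[OF F p v(1)]])
    also have "\<dots> = 0"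
      unfolding plus_fun_apply sum_tvec_apply cscale_apply using 0 c by simp
    finally show False using v(2) by simp
  qed
  then obtain a where a: "a \<in> {1..n}" "e a p t \<noteq> 0" by blast
  have "0 < (\<Sum>a\<in>{1..n}. (cmod (e a p t))\<^sup>2)"
    by (rule sum_pos2[OF _ a(1)]) (use a(2) in auto)
  then show ?thesis by (simp add: complex_mult_cnj cmod_power2)
qed

text \<open>The maximum is attained by compactness. The set Z where it is attained is closed by
  continuity and open by Hopf's argument, hence everything by connectedness. F is global, but the
  frame and the drift may change from point to point, so the differential inequality is assumed
  locally.\<close>

theorem strong_maximum_principle:
  assumes conn: "connected_space T" and comp: "compact_space T"
    and real: "\<And>p. p \<in> topspace T \<Longrightarrow> Im (F p) = 0"
    and loc: "\<And>p. p \<in> topspace T \<Longrightarrow> \<exists>W e B. p \<in> W \<and> unitary_frame W e \<and> field_on W B \<and> smooth_fun W F \<and>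
      (\<forall>q\<in>W. 0 \<le> Re (frame_operator e B F q))"
    and pq: "p \<in> topspace T" "q \<in> topspace T"
  shows "F p = F q"
proof -
  have Fs: "smooth_fun (topspace T) F"
    by (rule smooth_fun_local) (use loc in \<open>fastforce simp: unitary_frame_def\<close>)
  have "compact (F ` topspace T)"
    using image_compactin[OF _ smooth_fun_continuous_map[OF Fs]] comp
    by (simp add: compact_space_def compactin_euclidean_iff)
  then have "compact (Re ` F ` topspace T)"
    by (rule compact_continuous_image[rotated]) (intro continuous_intros)
  then obtain p0 where p0: "p0 \<in> topspace T" "\<And>q. q \<in> topspace T \<Longrightarrow> Re (F q) \<le> Re (F p0)"
  proof -
    have "Re ` F ` topspace T \<noteq> {}" using pq(1) by blast
    then obtain s where "s \<in> Re ` F ` topspace T" "\<forall>t\<in>Re ` F ` topspace T. t \<le> s"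
      using compact_attains_sup[OF \<open>compact (Re ` F ` topspace T)\<close>] by blast
    then show ?thesis using that by blast
  qed
  define M where "M = Re (F p0)"
  have le: "Re (F q) \<le> M" if "q \<in> topspace T" for q using p0 that by (simp add: M_def)
  define Z where "Z = {q \<in> topspace T. Re (F q) = M}"
  have "openin T {q \<in> topspace T. F q \<in> {z. Re z \<noteq> M}}"
    by (rule smooth_fun_preimage_open[OF openin_topspace Fs])
      (intro open_Collect_neq continuous_intros)
  moreover have "topspace T - Z = {q \<in> topspace T. F q \<in> {z. Re z \<noteq> M}}" by (auto simp: Z_def)
  ultimately have "closedin T Z" unfolding closedin_def by (auto simp: Z_def)
  moreover have "openin T Z"
  proof (subst openin_subopen, intro ballI, rule ccontr)
    fix z assume zZ: "z \<in> Z" and no: "\<not> (\<exists>V. openin T V \<and> z \<in> V \<and> V \<subseteq> Z)"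
    have "z \<in> topspace T" using zZ by (simp add: Z_def)
    then obtain U \<phi> where U: "(U, \<phi>) \<in> A" "z \<in> U" by (rule chart_at)
    have UT: "U \<subseteq> topspace T" using chart_openin[OF U(1)] openin_subset by blast
    define G where "G x = Re (F (inv_into U \<phi> x))" for x
    have G: "G (\<phi> q) = Re (F q)" if "q \<in> U" for q using chart_inv[OF U(1) that] by (simp add: G_def)
    have op: "open (\<phi> ` U)" using chart[OF U(1)] by blast
    have cG: "continuous_on (\<phi> ` U) G"
    proof -
      have "continuous_on (\<phi> ` U) (F \<circ> inv_into U \<phi>)"
        using Cinf_on_continuous[OF smooth_funD[OF Fs U(1)]] UT by (simp add: inf.absorb1)
      then show ?thesis unfolding G_def by (intro continuous_intros) (simp add: o_def)
    qed
    have Gle: "G x \<le> M" if "x \<in> \<phi> ` U" for x using that G le UT by auto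
    have Gz: "G (\<phi> z) = M" using G[OF U(2)] zZ by (simp add: Z_def)
    have near: "\<exists>x\<in>\<phi> ` U. dist (\<phi> z) x < r \<and> G x < M" if "0 < r" for r
    proof -
      let ?V = "{q \<in> U. \<phi> q \<in> ball (\<phi> z) r}"
      have "openin T ?V" "z \<in> ?V" using chart_vimage_open[OF U(1) open_ball] U(2) that by auto
      then obtain q where q: "q \<in> ?V" "q \<notin> Z" using no by blast
      then have "Re (F q) < M" using le[of q] UT by (force simp: Z_def)
      then show ?thesis using q G by auto
    qed
    have zim: "\<phi> z \<in> \<phi> ` U" using U(2) by blast
    obtain y c \<rho> where y: "y \<in> \<phi> ` U" "G y = M" and \<rho>: "0 < \<rho>" "dist c y = \<rho>" "cball c \<rho> \<subseteq> \<phi> ` U"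
      and touch: "\<And>x. x \<in> cball c \<rho> \<Longrightarrow> x \<noteq> y \<Longrightarrow> G x < M"
      using touching_ball[OF op zim cG Gle Gz near] by metis
    obtain p where p: "p \<in> U" "y = \<phi> p" using y(1) by blast
    obtain W e B where W: "p \<in> W" "unitary_frame W e" "field_on W B" and FW: "smooth_fun W F"
      and L: "\<And>q. q \<in> W \<Longrightarrow> 0 \<le> Re (frame_operator e B F q)"
      using loc[of p] p UT by blast
    have oW: "openin T W" using W(2) by (simp add: unitary_frame_def)
    define V where "V = U \<inter> W"
    have V: "openin T V" "V \<subseteq> W" "p \<in> V" using oW chart_openin[OF U(1)] p W by (auto simp: V_def)
    define tr where "tr x = \<rho>\<^sup>2 - (dist c x)\<^sup>2" for x
    define t where "t q = complex_of_real (tr (\<phi> q))" for q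
    have tr_inner: "tr x = \<rho>\<^sup>2 + - ((x - c) \<bullet> (x - c))" for x
      by (simp add: tr_def dist_norm power2_norm_eq_inner inner_diff_left inner_diff_right inner_commute)
    have Ctr: "Cinf_on (\<phi> ` U) (\<lambda>x. complex_of_real (tr x))"
    proof -
      have "Cinf_on (\<phi> ` U) (\<lambda>x. x + - c)"
        by (rule Cinf_on_add[OF Cinf_on_bounded_linear Cinf_on_const op]) (simp_all add: op bounded_linear_ident)
      then have l: "Cinf_on (\<phi> ` U) (\<lambda>x. x - c)" by simp
      have "Cinf_on (\<phi> ` U) (\<lambda>x. \<rho>\<^sup>2 + - ((x - c) \<bullet> (x - c)))"
        by (rule Cinf_on_add[OF Cinf_on_const[OF op]
              Cinf_on_linear_compose[OF bounded_linear_minus[OF bounded_linear_ident]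
                Cinf_on_bilinear[OF bounded_bilinear_inner l l op] op] op])
      then show ?thesis unfolding tr_inner by (rule Cinf_on_linear_compose[OF bounded_linear_of_real _ op])
    qed
    have tU: "smooth_fun U t"
    proof (rule smooth_fun_chartI[OF U(1) chart_openin[OF U(1)] subset_refl])
      show "Cinf_on (\<phi> ` U) (t \<circ> inv_into U \<phi>)"
        using Ctr Cinf_on_cong[OF op, of "t \<circ> inv_into U \<phi>" "\<lambda>x. complex_of_real (tr x)"]
        by (simp add: t_def f_inv_into_f)
    qed
    have tV: "smooth_fun V t" by (rule smooth_fun_subset[OF tU]) (simp add: V_def)
    have tp: "t p = 0" using \<rho>(2) p(2) by (simp add: t_def tr_def)
    have t_real: "Im (t q) = 0" for q by (simp add: t_def)
    \<comment> \<open>The direction towards the centre c: along it t has derivative 2 |y - c|^2,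
      which is not zero.\<close>
    define \<xi> where "\<xi> = coord_field U \<phi> (c - y) p"
    have \<xi>: "\<xi> \<in> tangent_space p" unfolding \<xi>_def by (rule coord_field_tangent[OF U(1) p(1)])
    have "\<xi> t \<noteq> 0"
    proof -
      have "frechet_derivative (t \<circ> inv_into U \<phi>) (at y) = frechet_derivative (\<lambda>x. complex_of_real (tr x)) (at y)"
        by (rule frechet_derivative_cong_open(2)[OF op y(1)]) (simp add: t_def f_inv_into_f)
      also have "\<dots> = (\<lambda>v. complex_of_real (- ((y - c) \<bullet> v + v \<bullet> (y - c))))"
        unfolding tr_inner
        by (rule frechet_derivative_at[symmetric]) (auto intro!: derivative_eq_intros)
      finally have "\<xi> t = complex_of_real (2 * ((y - c) \<bullet> (y - c)))"
        using smooth_nearI[OF V(1,3) tV] p(2)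
        by (simp add: \<xi>_def coord_field_def inner_diff_left inner_diff_right inner_commute)
      moreover have "y \<noteq> c" using \<rho> by auto
      ultimately show ?thesis by simp
    qed
    then have S2: "0 < Re (\<Sum>a\<in>{1..n}. e a p t * cnj (e a p t))" (is "0 < ?S")
      using frame_detects[OF W(2,1) \<xi> _ V(1,3)] t_real by blast
    \<comment> \<open>Chosen so that 2 \<beta> times the sum of squares is |Re(L t)| + 1; the
      operator L then has real part at least 1 on h at p, whatever the sign of L t.\<close>
    define \<beta> where "\<beta> = (\<bar>Re (frame_operator e B t p)\<bar> + 1) / (2 * ?S)"
    have \<beta>: "0 < \<beta>" using S2 by (simp add: \<beta>_def add_nonneg_pos)
    define h where "h q = t q + complex_of_real \<beta> * (t q * t q)" for q
    define hr where "hr x = tr x + \<beta> * (tr x)\<^sup>2" for x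
    have h_hr: "h q = complex_of_real (hr (\<phi> q))" for q
      by (simp add: h_def hr_def t_def power2_eq_square)
    have hV: "smooth_fun V h" unfolding h_def
      by (intro smooth_fun_add smooth_fun_cmult smooth_fun_mult V(1) tV)
    have "Re (frame_operator e B h p) = Re (frame_operator e B t p) + 2 * \<beta> * ?S"
      using frame_operator_barrier[OF W(2,3) V tV tp t_real, of "complex_of_real \<beta>"]
      by (simp add: h_def[abs_def])
    also have "2 * \<beta> * ?S = \<bar>Re (frame_operator e B t p)\<bar> + 1" using S2 by (simp add: \<beta>_def)
    finally have hp: "0 < Re (frame_operator e B h p)" by linarith
    have opR: "open {z. 0 < Re z}" by (simp add: open_Collect_less continuous_intros)
    \<comment> \<open>By continuity the operator remains positive on h near p; the perturbed maximum
      has to be located inside this set.\<close>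
    define V1 where "V1 = {q \<in> V. frame_operator e B h q \<in> {z. 0 < Re z}}"
    have V1: "openin T V1" "V1 \<subseteq> V" "p \<in> V1" "V1 \<subseteq> U"
      unfolding V1_def using smooth_fun_preimage_open[OF V(1) frame_operator_smooth[OF W(2,3) V(1,2) hV] opR] V(3) hp
      by (auto simp: V_def)
    define N where "N = \<phi> ` V1"
    have N: "open N" "y \<in> N"
      using chart_image_open[OF U(1) V1(1)] V1(3,4) p(2) by (auto simp: N_def inf.absorb2)
    have NU: "N \<subseteq> \<phi> ` U" using V1(4) by (auto simp: N_def)
    obtain \<epsilon> x1 S where \<epsilon>: "0 < \<epsilon>" and S: "open S" "x1 \<in> S" "S \<subseteq> N"
      and mx: "\<And>x. x \<in> S \<Longrightarrow> G x + \<epsilon> * hr x \<le> G x1 + \<epsilon> * hr x1"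
    proof (rule barrier_max[OF N continuous_on_subset[OF cG NU] _ y(2) _ \<rho>(2), of \<beta> hr])
      show "G x \<le> M" if "x \<in> N" for x using Gle that NU by blast
      show "G x < M" if "x \<in> cball c \<rho>" "x \<noteq> y" for x using touch that by blast
      show "0 \<le> \<beta>" using \<beta> by simp
      show "hr x = (\<rho>\<^sup>2 - (dist c x)\<^sup>2) + \<beta> * (\<rho>\<^sup>2 - (dist c x)\<^sup>2)\<^sup>2" for x by (simp add: hr_def tr_def)
    qed (rule that)
    obtain q1 where q1: "q1 \<in> V1" "x1 = \<phi> q1" using S by (auto simp: N_def)
    define W1 where "W1 = {q \<in> U. \<phi> q \<in> S}"
    have W1U: "W1 \<subseteq> U" by (auto simp: W1_def)
    have W1: "openin T W1" "q1 \<in> W1"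
      unfolding W1_def using chart_vimage_open[OF U(1) S(1)] q1 S(2) V1(4) by auto
    have W1V1: "W1 \<subseteq> V1"
    proof
      fix q assume "q \<in> W1"
      then obtain q' where "q \<in> U" "q' \<in> V1" "\<phi> q = \<phi> q'" using S(3) by (auto simp: W1_def N_def)
      then show "q \<in> V1" using inj_onD[OF chart_inj[OF U(1)], of q q'] V1(4) by auto
    qed
    have W1W: "W1 \<subseteq> W" using W1V1 V1(2) V(2) by blast
    have FW1: "smooth_fun W1 F" and hW1: "smooth_fun W1 h"
      using smooth_fun_subset[OF FW W1W] smooth_fun_subset[OF hV] W1V1 V1(2) by auto
    \<comment> \<open>The contradiction: at its interior maximum q1 the operator is nonpositive on F
      + \<epsilon> h, although it is nonnegative on F and positive on h there.\<close>
    have "Re (frame_operator e B (\<lambda>q. F q + complex_of_real \<epsilon> * h q) q1) \<le> 0"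
    proof (rule frame_operator_max[OF W(2,3) W1(1) W1W W1(2)])
      show "smooth_fun W1 (\<lambda>q. F q + complex_of_real \<epsilon> * h q)"
        by (intro smooth_fun_add smooth_fun_cmult W1(1) FW1 hW1)
      show "Im (F q + complex_of_real \<epsilon> * h q) = 0" if "q \<in> W1" for q
        using real[of q] that W1U UT by (auto simp: h_hr)
      show "Re (F q + complex_of_real \<epsilon> * h q) \<le> Re (F q1 + complex_of_real \<epsilon> * h q1)" if "q \<in> W1" for q
        using mx[of "\<phi> q"] that W1(2) G[of q] G[of q1] q1(2) by (simp add: W1_def h_hr)
    qed
    moreover have "frame_operator e B (\<lambda>q. F q + complex_of_real \<epsilon> * h q) q1 =
        frame_operator e B F q1 + complex_of_real \<epsilon> * frame_operator e B h q1"
      by (rule frame_operator_add[OF W(2,3) W1(1) W1W W1(2) FW1 hW1])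
    moreover have "0 \<le> Re (frame_operator e B F q1)" using L W1W W1(2) by blast
    moreover have "0 < \<epsilon> * Re (frame_operator e B h q1)" using q1(1) \<epsilon> by (simp add: V1_def)
    ultimately show False by simp
  qed
  moreover have "Z \<noteq> {}" using p0 by (auto simp: Z_def M_def)
  ultimately have "Z = topspace T" using conn unfolding connected_space_clopen_in by blast
  then have "p \<in> Z" "q \<in> Z" using pq by simp_all
  then have "Re (F p) = Re (F q)" by (simp add: Z_def)
  then show ?thesis using real pq by (simp add: complex_eq_iff)
qed

end


section \<open>The canonical connection of a quasi Kaehler manifold\<close>

context smooth_manifold
begin

section \<open>Identities of the Lie bracket\<close>

lemma bracket_conj: "bracket (conj_field X) (conj_field Y) p = conj_vec (bracket X Y p)"
  by (simp add: bracket_def conj_field_def conj_vec_def fun_eq_iff smooth_near_cnj)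

lemma bracket_antisym: "bracket Y X p = - bracket X Y p"
  by (simp add: bracket_def fun_eq_iff)

lemma bracket_add_left:
  assumes W: "openin T W" "p \<in> W" and X: "field_on W X" "field_on W X'" and Y: "field_on W Y"
  shows "bracket (X + X') Y p = bracket X Y p + bracket X' Y p"
proof
  fix f
  show "bracket (X + X') Y p f = (bracket X Y p + bracket X' Y p) f"
    using tangent_add[OF field_onD[OF Y W(2)] field_on_smooth_near[OF X(1) W] field_on_smooth_near[OF X(2) W], of f f]
    by (cases "smooth_near p f") (simp_all add: bracket_def)
qed

lemma bracket_scale_left:
  assumes W: "openin T W" "p \<in> W" and X: "field_on W X" and Y: "field_on W Y" and h: "smooth_fun W h"
  shows "bracket (\<lambda>q. h q \<odot> X q) Y p = h p \<odot> bracket X Y p - (Y p h) \<odot> X p"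
proof
  fix f
  show "bracket (\<lambda>q. h q \<odot> X q) Y p f = (h p \<odot> bracket X Y p - (Y p h) \<odot> X p) f"
  proof (cases "smooth_near p f")
    case True
    then show ?thesis
      using tangent_mult[OF field_onD[OF Y W(2)] smooth_nearI[OF W h] field_on_smooth_near[OF X W True]]
      by (simp add: bracket_def algebra_simps)
  qed (simp add: bracket_def tangent_outside[OF field_onD[OF X W(2)]])
qed

lemma bracket_cong:
  assumes W: "openin T W" "p \<in> W" and X: "field_on W X" "\<And>q. q \<in> W \<Longrightarrow> X q = X' q"
    and Y: "field_on W Y" "\<And>q. q \<in> W \<Longrightarrow> Y q = Y' q"
  shows "bracket X Y p = bracket X' Y' p"
proof
  fix f
  have "X p (\<lambda>q. Y q f) = X p (\<lambda>q. Y' q f)" "Y p (\<lambda>q. X q f) = Y p (\<lambda>q. X' q f)"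
    by (rule tangent_cong[OF field_onD[OF X(1) W(2)] W], use Y(2) in simp)
      (rule tangent_cong[OF field_onD[OF Y(1) W(2)] W], use X(2) in simp)
  then show "bracket X Y p f = bracket X' Y' p f"
    using X(2)[OF W(2)] Y(2)[OF W(2)] by (simp add: bracket_def)
qed

text \<open>Expanded on a function f, the three double brackets give each of the six orders of X, Y,
  Z twice, with opposite signs. \<open>br\<close> expands an inner bracket under an outer
  derivation, which is legitimate on the neighbourhood where f is smooth.\<close>

lemma jacobi:
  assumes W: "openin T W" "p \<in> W" and X: "field_on W X" and Y: "field_on W Y" and Z: "field_on W Z"
  shows "bracket X (bracket Y Z) p + bracket Y (bracket Z X) p + bracket Z (bracket X Y) p = 0"
proof
  fix f
  show "(bracket X (bracket Y Z) p + bracket Y (bracket Z X) p + bracket Z (bracket X Y) p) f = 0 f"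
  proof (cases "smooth_near p f")
    case True
    obtain V where V: "openin T V" "p \<in> V" "smooth_fun V f" using True unfolding smooth_near_def by blast
    have VW: "openin T (V \<inter> W)" "p \<in> V \<inter> W" using V W by auto
    have fs: "smooth_fun (V \<inter> W) f" by (rule smooth_fun_subset[OF V(3)]) simp
    have s2: "smooth_near p (\<lambda>q. A q (\<lambda>r. B r f))" if "field_on W A" "field_on W B" for A B
      by (intro field_on_smooth_near[OF that(1) W] field_on_smooth_near[OF that(2) W] True)
    have br: "C p (\<lambda>q. bracket A B q f) = C p (\<lambda>q. A q (\<lambda>r. B r f)) - C p (\<lambda>q. B q (\<lambda>r. A r f))"
      if "field_on W A" "field_on W B" "field_on W C" for A B C
    proof -
      have "C p (\<lambda>q. bracket A B q f) = C p (\<lambda>q. A q (\<lambda>r. B r f) - B q (\<lambda>r. A r f))"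
        by (rule tangent_cong[OF field_onD[OF that(3) W(2)] VW])
          (rule bracket_apply, rule smooth_nearI[OF VW(1) _ fs])
      then show ?thesis
        using tangent_diff[OF field_onD[OF that(3) W(2)] s2[OF that(1,2)] s2[OF that(2,1)]] by simp
    qed
    have b2: "bracket A (bracket B C) p f = A p (\<lambda>q. bracket B C q f) - (B p (\<lambda>q. C q (\<lambda>r. A r f)) - C p (\<lambda>q. B q (\<lambda>r. A r f)))"
      if "field_on W A" for A B C
      using bracket_apply[OF True, of A "bracket B C"] bracket_apply[OF field_on_smooth_near[OF that W True], of B C] by simp
    show ?thesis
      unfolding plus_fun_apply b2[OF X] b2[OF Y] b2[OF Z] br[OF Y Z X] br[OF Z X Y] br[OF X Y Z] by simp
  next
    case False
    then show ?thesis by (simp add: bracket_def)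
  qed
qed

end

locale quasi_kaehler_connection = almost_hermitian_manifold T A J g n
  for T :: "'a topology" and A :: "('a, 'e::euclidean_space) chart set"
    and J :: "'a \<Rightarrow> 'a tvec \<Rightarrow> 'a tvec" and g :: "'a \<Rightarrow> 'a tvec \<Rightarrow> 'a tvec \<Rightarrow> complex" and n :: nat +
  fixes nabla :: "'a vfield \<Rightarrow> 'a vfield \<Rightarrow> 'a vfield"
  assumes qk: "quasi_kaehler" and cc: "canonical_connection nabla"
begin

section \<open>Rules for the canonical connection and its torsion\<close>

lemma nabla_rules:
  assumes W: "openin T W" and X: "field_on W X" and X': "field_on W X'" and Y: "field_on W Y" and Y': "field_on W Y'"
    and f: "smooth_fun W f"
  shows "field_on W (nabla X Y)"
    and "(\<And>q. q \<in> W \<Longrightarrow> X q = X' q) \<Longrightarrow> (\<And>q. q \<in> W \<Longrightarrow> Y q = Y' q) \<Longrightarrow> p \<in> W \<Longrightarrow> nabla X Y p = nabla X' Y' p"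
    and "p \<in> W \<Longrightarrow> nabla (X + X') Y p = nabla X Y p + nabla X' Y p"
    and "p \<in> W \<Longrightarrow> nabla (\<lambda>q. f q \<odot> X q) Y p = f p \<odot> nabla X Y p"
    and "p \<in> W \<Longrightarrow> nabla X (Y + Y') p = nabla X Y p + nabla X Y' p"
    and "p \<in> W \<Longrightarrow> nabla X (\<lambda>q. f q \<odot> Y q) p = X p f \<odot> Y p + f p \<odot> nabla X Y p"
    and "p \<in> W \<Longrightarrow> nabla (conj_field X) (conj_field Y) p = conj_vec (nabla X Y p)"
proof -
  have "affine_connection nabla" using cc by (simp add: canonical_connection_def)
  note ac = this[unfolded affine_connection_def, rule_format, OF conjI[OF W conjI[OF X conjI[OF X' conjI[OF Y conjI[OF Y' f]]]]]]
  show "field_on W (nabla X Y)" using ac by simp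
  show "(\<And>q. q \<in> W \<Longrightarrow> X q = X' q) \<Longrightarrow> (\<And>q. q \<in> W \<Longrightarrow> Y q = Y' q) \<Longrightarrow> p \<in> W \<Longrightarrow> nabla X Y p = nabla X' Y' p"
    using ac by simp
  show "p \<in> W \<Longrightarrow> nabla (X + X') Y p = nabla X Y p + nabla X' Y p"
    "p \<in> W \<Longrightarrow> nabla (\<lambda>q. f q \<odot> X q) Y p = f p \<odot> nabla X Y p"
    "p \<in> W \<Longrightarrow> nabla X (Y + Y') p = nabla X Y p + nabla X Y' p"
    "p \<in> W \<Longrightarrow> nabla X (\<lambda>q. f q \<odot> Y q) p = X p f \<odot> Y p + f p \<odot> nabla X Y p"
    "p \<in> W \<Longrightarrow> nabla (conj_field X) (conj_field Y) p = conj_vec (nabla X Y p)"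
    using ac by simp_all
qed

context
  fixes W assumes W: "openin T W"
begin

lemma nabla_field: "field_on W X \<Longrightarrow> field_on W Y \<Longrightarrow> field_on W (nabla X Y)"
  by (rule nabla_rules(1)[OF W _ _ _ _ smooth_fun_const[OF W]])

lemma nabla_cong: "field_on W X \<Longrightarrow> field_on W Y \<Longrightarrow> (\<And>q. q \<in> W \<Longrightarrow> X q = X' q) \<Longrightarrow>
    (\<And>q. q \<in> W \<Longrightarrow> Y q = Y' q) \<Longrightarrow> p \<in> W \<Longrightarrow> nabla X Y p = nabla X' Y' p"
  by (rule nabla_rules(2)[OF W _ _ _ _ smooth_fun_const[OF W]]) (simp_all add: field_on_cong[of W X X'] field_on_cong[of W Y Y'])

lemma nabla_add1: "field_on W X \<Longrightarrow> field_on W X' \<Longrightarrow> field_on W Y \<Longrightarrow> p \<in> W \<Longrightarrow>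
    nabla (X + X') Y p = nabla X Y p + nabla X' Y p"
  by (rule nabla_rules(3)[OF W _ _ _ _ smooth_fun_const[OF W]])

lemma nabla_scale1: "field_on W X \<Longrightarrow> field_on W Y \<Longrightarrow> smooth_fun W f \<Longrightarrow> p \<in> W \<Longrightarrow>
    nabla (\<lambda>q. f q \<odot> X q) Y p = f p \<odot> nabla X Y p"
  by (rule nabla_rules(4)[OF W])

lemma nabla_add2: "field_on W X \<Longrightarrow> field_on W Y \<Longrightarrow> field_on W Y' \<Longrightarrow> p \<in> W \<Longrightarrow>
    nabla X (Y + Y') p = nabla X Y p + nabla X Y' p"
  by (rule nabla_rules(5)[OF W _ _ _ _ smooth_fun_const[OF W]])

lemma nabla_scale2: "field_on W X \<Longrightarrow> field_on W Y \<Longrightarrow> smooth_fun W f \<Longrightarrow> p \<in> W \<Longrightarrow>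
    nabla X (\<lambda>q. f q \<odot> Y q) p = X p f \<odot> Y p + f p \<odot> nabla X Y p"
  by (rule nabla_rules(6)[OF W])

lemma nabla_conj:
  assumes "field_on W X" "field_on W Y" "p \<in> W"
  shows "nabla X (conj_field Y) p = conj_vec (nabla (conj_field X) Y p)"
proof -
  note cX = field_on_conj[OF assms(1)]
  have "nabla (conj_field (conj_field X)) (conj_field Y) p = conj_vec (nabla (conj_field X) Y p)"
    by (rule nabla_rules(7)[OF W cX cX assms(2,2) smooth_fun_const[OF W] assms(3)])
  then show ?thesis by simp
qed

lemma nabla_cscale2: "field_on W X \<Longrightarrow> field_on W Y \<Longrightarrow> p \<in> W \<Longrightarrow> nabla X (\<lambda>q. c \<odot> Y q) p = c \<odot> nabla X Y p"
  using nabla_scale2[of X Y "\<lambda>q. c" p] smooth_fun_const[OF W] tangent_const[OF field_onD] by simp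

lemma field_minus: "(- X) = (\<lambda>q. (-1) \<odot> X q)" for X :: "'a vfield"
  by (simp add: fun_eq_iff)

lemma nabla_diff1:
  assumes X: "field_on W X" and X': "field_on W X'" and Y: "field_on W Y" and p: "p \<in> W"
  shows "nabla (X - X') Y p = nabla X Y p - nabla X' Y p"
proof -
  have "nabla (- X') Y p = (-1) \<odot> nabla X' Y p"
    unfolding field_minus by (rule nabla_scale1[OF X' Y smooth_fun_const[OF W] p])
  then show ?thesis using nabla_add1[OF X field_on_uminus[OF W X'] Y p] by simp
qed

lemma nabla_diff2:
  assumes X: "field_on W X" and Y: "field_on W Y" and Y': "field_on W Y'" and p: "p \<in> W"
  shows "nabla X (Y - Y') p = nabla X Y p - nabla X Y' p"
proof -
  have "nabla X (- Y') p = (-1) \<odot> nabla X Y' p"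
    unfolding field_minus by (rule nabla_cscale2[OF X Y' p])
  then show ?thesis using nabla_add2[OF X Y field_on_uminus[OF W Y'] p] by simp
qed

lemma nabla_metric: "field_on W X \<Longrightarrow> field_on W Y \<Longrightarrow> field_on W Z \<Longrightarrow> p \<in> W \<Longrightarrow>
    X p (\<lambda>q. g q (Y q) (Z q)) = g p (nabla X Y p) (Z p) + g p (Y p) (nabla X Z p)"
  using cc[unfolded canonical_connection_def, THEN conjunct2, THEN conjunct1, rule_format, of W X Y Z p] W by simp

lemma nabla_J: "field_on W X \<Longrightarrow> field_on W Y \<Longrightarrow> p \<in> W \<Longrightarrow> nabla X (J_field Y) p = J p (nabla X Y p)"
  using cc[unfolded canonical_connection_def, THEN conjunct2, THEN conjunct2, THEN conjunct1, rule_format, of W X Y p] W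
  by simp

lemma torsion_mixed: "field10 W X \<Longrightarrow> field10 W Y \<Longrightarrow> p \<in> W \<Longrightarrow> torsion nabla X (conj_field Y) p = 0"
  using cc[unfolded canonical_connection_def, THEN conjunct2, THEN conjunct2, THEN conjunct2, rule_format, of W X Y p] W
  by (simp add: field10_def)

text \<open>nabla J = 0, so nabla_X commutes with J and preserves its eigenbundle for i.\<close>

lemma nabla_field10:
  assumes X: "field_on W X" and Y: "field10 W Y"
  shows "field10 W (nabla X Y)"
proof (rule field10I[OF nabla_field[OF X field10_field[OF Y]]])
  fix p assume p: "p \<in> W"
  note Yf = field10_field[OF Y]
  have "J p (nabla X Y p) = nabla X (J_field Y) p" by (rule nabla_J[OF X Yf p, symmetric])
  also have "\<dots> = nabla X (\<lambda>q. \<i> \<odot> Y q) p"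
    by (rule nabla_cong[OF X field_on_J[OF W Yf] _ _ p])
      (use field10_T10[OF Y] in \<open>simp_all add: J_field_def T10_def\<close>)
  also have "\<dots> = \<i> \<odot> nabla X Y p" by (rule nabla_cscale2[OF X Yf p])
  finally show "nabla X Y p \<in> T10 p"
    using field_onD[OF nabla_field[OF X Yf] p] by (simp add: T10_def)
qed

lemma torsion_eq: "torsion nabla X Y p = nabla X Y p - nabla Y X p - bracket X Y p"
  by (simp add: torsion_def)

lemma torsion_field: "field_on W X \<Longrightarrow> field_on W Y \<Longrightarrow> field_on W (torsion nabla X Y)"
  unfolding torsion_def by (intro field_on_diff W nabla_field field_on_bracket)

lemma torsion_antisym: "torsion nabla Y X p = - torsion nabla X Y p"
  unfolding torsion_eq bracket_antisym[of Y X] by simp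

lemma torsion_add1: "field_on W X \<Longrightarrow> field_on W X' \<Longrightarrow> field_on W Y \<Longrightarrow> p \<in> W \<Longrightarrow>
    torsion nabla (X + X') Y p = torsion nabla X Y p + torsion nabla X' Y p"
  unfolding torsion_eq by (simp only: nabla_add1 nabla_add2 bracket_add_left[OF W]) simp

text \<open>The derivative of f along Y enters through \<open>nabla Y\<close> of the product and
  through the bracket, with opposite signs; the torsion is a tensor.\<close>

lemma torsion_scale1:
  assumes "field_on W X" "field_on W Y" "smooth_fun W f" "p \<in> W"
  shows "torsion nabla (\<lambda>q. f q \<odot> X q) Y p = f p \<odot> torsion nabla X Y p"
  unfolding torsion_eq nabla_scale1[OF assms] nabla_scale2[OF assms(2,1,3,4)]
    bracket_scale_left[OF W assms(4,1,2,3)]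
  by (simp add: fun_eq_iff algebra_simps)

lemma torsion_cong:
  assumes "field_on W X" "field_on W Y" "\<And>q. q \<in> W \<Longrightarrow> X q = X' q" "\<And>q. q \<in> W \<Longrightarrow> Y q = Y' q" "p \<in> W"
  shows "torsion nabla X Y p = torsion nabla X' Y' p"
proof -
  have "nabla X Y p = nabla X' Y' p" by (rule nabla_cong[OF assms])
  moreover have "nabla Y X p = nabla Y' X' p" by (rule nabla_cong[OF assms(2,1,4,3,5)])
  moreover have "bracket X Y p = bracket X' Y' p" by (rule bracket_cong[OF W assms(5,1,3,2,4)])
  ultimately show ?thesis by (simp add: torsion_eq)
qed

lemma torsion_zero1:
  assumes "field_on W X" "field_on W Y" "\<And>q. q \<in> W \<Longrightarrow> X q = 0" "p \<in> W"
  shows "torsion nabla X Y p = 0"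
proof -
  have "torsion nabla X Y p = torsion nabla (\<lambda>q. 0 \<odot> X q) Y p"
    by (rule torsion_cong[OF assms(1,2) _ _ assms(4)]) (simp_all add: assms(3))
  then show ?thesis
    using torsion_scale1[OF assms(1,2) smooth_fun_const[OF W] assms(4), of 0] by simp
qed

lemma torsion_conj_conj:
  assumes "field_on W X" "field_on W Y" "p \<in> W"
  shows "torsion nabla (conj_field X) (conj_field Y) p = conj_vec (torsion nabla X Y p)"
  using nabla_conj[OF field_on_conj[OF assms(1)] assms(2,3)] nabla_conj[OF field_on_conj[OF assms(2)] assms(1,3)]
  by (simp add: torsion_eq bracket_conj conj_vec_diff)

section \<open>The exterior derivative of the fundamental form and the type of the torsion\<close>

lemma fundamental_form_antisym:
  assumes p: "p \<in> topspace T" and u: "u \<in> tangent_space p" and v: "v \<in> tangent_space p"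
  shows "fundamental_form p u v = - fundamental_form p v u"
proof -
  have "g p (J p u) v = g p (J p (J p u)) (J p v)"
    using g_J[OF p J_closed[OF p u] v] by simp
  also have "\<dots> = - g p u (J p v)"
    using g_uminus[OF p u J_closed[OF p v]] by (simp add: J_square[OF p u])
  finally show ?thesis using g_sym[OF p u J_closed[OF p v]] by (simp add: fundamental_form_def)
qed

lemma fundamental_form_diff:
  "p \<in> topspace T \<Longrightarrow> u \<in> tangent_space p \<Longrightarrow> v \<in> tangent_space p \<Longrightarrow> w \<in> tangent_space p \<Longrightarrow>
    fundamental_form p (u - v) w = fundamental_form p u w - fundamental_form p v w"
  by (simp add: fundamental_form_def J_diff g_diff J_closed)

lemma fundamental_form_zero:
  assumes "p \<in> topspace T" "v \<in> tangent_space p"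
  shows "fundamental_form p 0 v = 0" "fundamental_form p v 0 = 0"
  using g_zero[OF assms] g_zero_right[OF assms(1) J_closed[OF assms]] T10_zero[OF assms(1)]
  by (simp_all add: fundamental_form_def T10_def)

text \<open>The fundamental form is parallel, so that its exterior derivative is a cyclic sum of torsions.\<close>

lemma ext_d_fundamental_form:
  assumes X: "field_on W X" and Y: "field_on W Y" and Z: "field_on W Z" and p: "p \<in> W"
  shows "ext_d fundamental_form X Y Z p = fundamental_form p (torsion nabla X Y p) (Z p)
    - fundamental_form p (torsion nabla X Z p) (Y p) + fundamental_form p (torsion nabla Y Z p) (X p)"
proof -
  note pT = mem_topspace[OF W p]
  have par: "A p (\<lambda>q. fundamental_form q (B q) (C q)) =
      fundamental_form p (nabla A B p) (C p) - fundamental_form p (nabla A C p) (B p)"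
    if "field_on W A" "field_on W B" "field_on W C" for A B C
  proof -
    have "A p (\<lambda>q. g q (J_field B q) (C q)) = g p (nabla A (J_field B) p) (C p) + g p (J_field B p) (nabla A C p)"
      by (rule nabla_metric[OF that(1) field_on_J[OF W that(2)] that(3) p])
    then have "A p (\<lambda>q. fundamental_form q (B q) (C q)) =
        fundamental_form p (nabla A B p) (C p) + fundamental_form p (B p) (nabla A C p)"
      by (simp add: fundamental_form_def J_field_def nabla_J[OF that(1,2) p, unfolded J_field_def])
    then show ?thesis
      using fundamental_form_antisym[OF pT field_onD[OF that(2) p] field_onD[OF nabla_field[OF that(1,3)] p]] by simp
  qed
  have tor: "fundamental_form p (torsion nabla A B p) (C p) =
      fundamental_form p (nabla A B p) (C p) - fundamental_form p (nabla B A p) (C p) - fundamental_form p (bracket A B p) (C p)"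
    if "field_on W A" "field_on W B" "field_on W C" for A B C
  proof -
    note t = field_onD[OF nabla_field[OF that(1,2)] p] field_onD[OF nabla_field[OF that(2,1)] p]
      field_onD[OF field_on_bracket[OF W that(1,2)] p] field_onD[OF that(3) p]
    show ?thesis unfolding torsion_eq
      by (simp add: fundamental_form_diff[OF pT] t tangent_space_diff)
  qed
  show ?thesis
    unfolding ext_d_def par[OF X Y Z] par[OF Y X Z] par[OF Z X Y] tor[OF X Y Z] tor[OF X Z Y] tor[OF Y Z X]
    by simp
qed

end

text \<open>The (1,2)-part of d omega, evaluated on conj X, conj Y and a (1,0)-field Z, reduces to
  omega(\<tau>(conj X, conj Y), Z): the other two torsions in the cyclic sum are mixed and vanish.
  So quasi Kaehler means that \<tau>(conj X, conj Y) has no (0,1)-part, and conjugation gives the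
  claim.\<close>

lemma torsion_T01:
  assumes W: "openin T W" and X: "field10 W X" and Y: "field10 W Y" and p: "p \<in> W"
  shows "torsion nabla X Y p \<in> T01 p"
proof -
  note pT = mem_topspace[OF W p]
  obtain W0 e where e0: "p \<in> W0" "unitary_frame W0 e" using unitary_frame_exists[OF pT] by blast
  have W0: "openin T W0" using e0 by (simp add: unitary_frame_def)
  define V where "V = W \<inter> W0"
  have V: "openin T V" "p \<in> V" "V \<subseteq> W" "V \<subseteq> W0" using W W0 p e0 by (auto simp: V_def)
  define cX cY where "cX = conj_field X" and "cY = conj_field Y"
  have XV: "field10 V X" and YV: "field10 V Y" using field10_subset X Y V(3) by blast+
  have cX: "field_on V cX" and cY: "field_on V cY"
    unfolding cX_def cY_def using field_on_conj field10_field XV YV by blast+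
  have T01: "cX q \<in> T01 q" "cY q \<in> T01 q" if "q \<in> V" for q
    using conj_T10[OF mem_topspace[OF V(1) that]] field10_T10[OF XV that] field10_T10[OF YV that]
    by (simp_all add: cX_def cY_def conj_field_def)
  define w where "w = torsion nabla cX cY p"
  have wt: "w \<in> tangent_space p" unfolding w_def by (rule field_onD[OF torsion_field[OF V(1) cX cY] V(2)])
  have key: "fundamental_form p w (Z p) = 0" if Z: "field10 V Z" for Z
  proof -
    note Zf = field10_field[OF Z]
    note f10 = field_on_part10[OF V(1)] and f01 = field_on_part01[OF V(1)]
    have c: "part10 cX q = 0" "part01 cX q = cX q" "part10 cY q = 0" "part01 cY q = cY q"
      "part10 Z q = Z q" "part01 Z q = 0" if "q \<in> V" for q
      using T01[OF that] field10_T10[OF Z that]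
      by (simp_all add: part10_eq part01_eq part10v_of_T01 part01v_of_T01 part10v_of_T10 part01v_of_T10)
    have z: "fundamental_form p 0 (B p) = 0" "fundamental_form p (B p) 0 = 0" if "field_on V B" for B
      using fundamental_form_zero[OF V(1) pT field_onD[OF that V(2)]] by simp_all
    have mixed: "torsion nabla cX Z p = 0" "torsion nabla cY Z p = 0"
      using torsion_mixed[OF V(1) Z XV V(2)] torsion_mixed[OF V(1) Z YV V(2)]
        torsion_antisym[OF V(1), of cX Z p] torsion_antisym[OF V(1), of cY Z p] by (simp_all add: cX_def cY_def)
    have 1: "ext_d fundamental_form (part10 cX) (part01 cY) (part01 Z) p = 0"
      unfolding ext_d_fundamental_form[OF V(1) f10[OF cX] f01[OF cY] f01[OF Zf] V(2)]
      using c[OF V(2)] z torsion_field[OF V(1)] f10 f01 cX cY Zf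
        torsion_zero1[OF V(1) f10[OF cX] f01[OF Zf] c(1) V(2)]
      by simp
    have 2: "ext_d fundamental_form (part01 cX) (part10 cY) (part01 Z) p = 0"
      unfolding ext_d_fundamental_form[OF V(1) f01[OF cX] f10[OF cY] f01[OF Zf] V(2)]
      using c[OF V(2)] z torsion_field[OF V(1)] f10 f01 cX cY Zf
        torsion_zero1[OF V(1) f10[OF cY] f01[OF Zf] c(3) V(2)]
      by simp
    have t: "torsion nabla (part01 cX) (part01 cY) p = w"
      "torsion nabla (part01 cX) (part10 Z) p = 0" "torsion nabla (part01 cY) (part10 Z) p = 0"
      using torsion_cong[OF V(1) f01[OF cX] f01[OF cY] c(2,4) V(2)]
        torsion_cong[OF V(1) f01[OF cX] f10[OF Zf] c(2,5) V(2)]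
        torsion_cong[OF V(1) f01[OF cY] f10[OF Zf] c(4,5) V(2)] mixed by (simp_all add: w_def)
    have 3: "ext_d fundamental_form (part01 cX) (part01 cY) (part10 Z) p = fundamental_form p w (Z p)"
      unfolding ext_d_fundamental_form[OF V(1) f01[OF cX] f01[OF cY] f10[OF Zf] V(2)] t
      using c[OF V(2)] z cX cY by simp
    have "part12 (ext_d fundamental_form) cX cY Z p = 0"
      using qk[unfolded quasi_kaehler_def] V(1,2) cX cY Zf by blast
    then show ?thesis unfolding part12_def 1 2 3 by simp
  qed
  have FV: "unitary_frame V e" using e0(2) V(1,4) unfolding unitary_frame_def type10_on_def
    by (auto intro: field_on_subset)
  \<comment> \<open>With a and b the (1,0)- and (0,1)-parts of w, omega(w, e_i) = i g(a, e_i) - i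
    g(b, e_i), and g(a, e_i) = 0 by type. Hence the vanishing of omega(w, e_i) for all i kills
    b.\<close>
  have "part01v p w = 0"
  proof (rule T01_zeroI[OF FV V(2) part01v_T01[OF pT wt]])
    fix i assume i: "i \<in> {1..n}"
    note et = unitary_frame_tangent[OF FV V(2) i]
    have "field10 V (e i)" using FV i by (simp add: unitary_frame_def field10_def)
    then have 0: "g p (J p w) (e i p) = 0" using key by (simp add: fundamental_form_def)
    define a b where "a = part10v p w" and "b = part01v p w"
    have ab: "a \<in> T10 p" "b \<in> T01 p" using part10v_T10[OF pT wt] part01v_T01[OF pT wt] by (simp_all add: a_def b_def)
    have w: "w = a + b" by (simp add: a_def b_def part_sum)
    have "J p w = \<i> \<odot> a + (- \<i>) \<odot> b"
      unfolding w using ab by (simp add: J_add[OF pT] T10_def T01_def)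
    then have "g p (J p w) (e i p) = \<i> * g p a (e i p) + (- \<i>) * g p b (e i p)"
      using T10_tangent[OF ab(1)] T01_tangent[OF ab(2)] et(4)
      by (simp add: g_add[OF pT] g_scale[OF pT] tangent_space_scale del: tv.scale_minus_left)
    then show "g p (part01v p w) (e i p) = 0" using 0 g_T10_T10[OF pT ab(1) et(2)] by (simp add: b_def)
  qed
  then have "w = part10v p w" using part_sum[of p w] by simp
  then have "w \<in> T10 p" using part10v_T10[OF pT wt] by simp
  moreover have "w = conj_vec (torsion nabla X Y p)"
    unfolding w_def cX_def cY_def
    by (rule torsion_conj_conj[OF V(1) field10_field[OF XV] field10_field[OF YV] V(2)])
  ultimately show ?thesis by (simp add: T01_iff[OF pT])
qed

end


section \<open>Tensors on the (1,0)-tangent bundle and their covariant derivatives\<close>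

context quasi_kaehler_connection
begin

text \<open>Smooth sections over \<open>W\<close> of the dual of the (1,0)-tangent bundle are encoded as functions on
  vector fields that are linear over the smooth functions on \<open>W\<close>.\<close>

definition lin :: "'a set \<Rightarrow> ('a vfield \<Rightarrow> 'a \<Rightarrow> complex) \<Rightarrow> bool" where
  "lin W Q \<longleftrightarrow>
    (\<forall>X. field10 W X \<longrightarrow> smooth_fun W (Q X)) \<and>
    (\<forall>X X' p. field10 W X \<and> field10 W X' \<and> p \<in> W \<longrightarrow> Q (X + X') p = Q X p + Q X' p) \<and>
    (\<forall>f X p. smooth_fun W f \<and> field10 W X \<and> p \<in> W \<longrightarrow> Q (\<lambda>q. f q \<odot> X q) p = f p * Q X p) \<and>
    (\<forall>X X' p. field10 W X \<and> (\<forall>q\<in>W. X q = X' q) \<and> p \<in> W \<longrightarrow> Q X p = Q X' p)"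

lemma lin_smooth: "lin W Q \<Longrightarrow> field10 W X \<Longrightarrow> smooth_fun W (Q X)"
  by (simp add: lin_def)

lemma lin_add: "lin W Q \<Longrightarrow> field10 W X \<Longrightarrow> field10 W X' \<Longrightarrow> p \<in> W \<Longrightarrow> Q (X + X') p = Q X p + Q X' p"
  by (simp add: lin_def)

lemma lin_scale: "lin W Q \<Longrightarrow> smooth_fun W f \<Longrightarrow> field10 W X \<Longrightarrow> p \<in> W \<Longrightarrow> Q (\<lambda>q. f q \<odot> X q) p = f p * Q X p"
  by (simp add: lin_def)

lemma lin_cong: "lin W Q \<Longrightarrow> field10 W X \<Longrightarrow> (\<And>q. q \<in> W \<Longrightarrow> X q = X' q) \<Longrightarrow> p \<in> W \<Longrightarrow> Q X p = Q X' p"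
  by (simp add: lin_def)

lemma linI:
  assumes "\<And>X. field10 W X \<Longrightarrow> smooth_fun W (Q X)"
    and "\<And>X X' p. field10 W X \<Longrightarrow> field10 W X' \<Longrightarrow> p \<in> W \<Longrightarrow> Q (X + X') p = Q X p + Q X' p"
    and "\<And>f X p. smooth_fun W f \<Longrightarrow> field10 W X \<Longrightarrow> p \<in> W \<Longrightarrow> Q (\<lambda>q. f q \<odot> X q) p = f p * Q X p"
    and "\<And>X X' p. field10 W X \<Longrightarrow> (\<And>q. q \<in> W \<Longrightarrow> X q = X' q) \<Longrightarrow> p \<in> W \<Longrightarrow> Q X p = Q X' p"
  shows "lin W Q"
  unfolding lin_def
proof (intro conjI allI impI; (elim conjE)?)
  show "smooth_fun W (Q X)" if "field10 W X" for X by (rule assms(1)[OF that])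
  show "Q (X + X') p = Q X p + Q X' p" if "field10 W X" "field10 W X'" "p \<in> W" for X X' p
    by (rule assms(2)[OF that])
  show "Q (\<lambda>q. f q \<odot> X q) p = f p * Q X p" if "smooth_fun W f" "field10 W X" "p \<in> W" for f X p
    by (rule assms(3)[OF that])
  show "Q X p = Q X' p" if "field10 W X" "\<forall>q\<in>W. X q = X' q" "p \<in> W" for X X' p
    by (rule assms(4)[OF that(1) bspec[OF that(2)] that(3)])
qed

definition trilin :: "'a set \<Rightarrow> ('a vfield \<Rightarrow> 'a vfield \<Rightarrow> 'a vfield \<Rightarrow> 'a \<Rightarrow> complex) \<Rightarrow> bool" where
  "trilin W P \<longleftrightarrow> (\<forall>Y Z. field10 W Y \<and> field10 W Z \<longrightarrow>
     lin W (\<lambda>X. P X Y Z) \<and> lin W (\<lambda>X. P Y X Z) \<and> lin W (\<lambda>X. P Y Z X))"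

lemma trilinD:
  assumes "trilin W P" "field10 W Y" "field10 W Z"
  shows "lin W (\<lambda>X. P X Y Z)" "lin W (\<lambda>X. P Y X Z)" "lin W (\<lambda>X. P Y Z X)"
  using assms by (simp_all add: trilin_def)

lemma trilin_smooth:
  assumes "trilin W P" "field10 W X" "field10 W Y" "field10 W Z"
  shows "smooth_fun W (P X Y Z)"
  using lin_smooth[OF trilinD(1)[OF assms(1,3,4)] assms(2)] by simp

text \<open>The covariant derivative of a 3-tensor on (1,0)-fields. The direction V may have any
  type, because nabla_V keeps the arguments of type (1,0).\<close>

definition cov :: "'a vfield \<Rightarrow> ('a vfield \<Rightarrow> 'a vfield \<Rightarrow> 'a vfield \<Rightarrow> 'a \<Rightarrow> complex) \<Rightarrow>
    'a vfield \<Rightarrow> 'a vfield \<Rightarrow> 'a vfield \<Rightarrow> 'a \<Rightarrow> complex" where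
  "cov V P X Y Z p = V p (P X Y Z) - P (nabla V X) Y Z p - P X (nabla V Y) Z p - P X Y (nabla V Z) p"

definition tor :: "'a vfield \<Rightarrow> 'a vfield \<Rightarrow> 'a vfield \<Rightarrow> 'a \<Rightarrow> complex" where
  "tor X Y Z p = g p (torsion nabla X Y p) (Z p)"

text \<open>Hermitian product of two 3-tensors in the frame e, conjugate linear in the second; |T|^2
  is \<open>pairing e tor tor\<close>.\<close>

definition pairing :: "(nat \<Rightarrow> 'a vfield) \<Rightarrow>
    ('a vfield \<Rightarrow> 'a vfield \<Rightarrow> 'a vfield \<Rightarrow> 'a \<Rightarrow> complex) \<Rightarrow>
    ('a vfield \<Rightarrow> 'a vfield \<Rightarrow> 'a vfield \<Rightarrow> 'a \<Rightarrow> complex) \<Rightarrow> 'a \<Rightarrow> complex" where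
  "pairing e P Q p = (\<Sum>i\<in>{1..n}. \<Sum>j\<in>{1..n}. \<Sum>k\<in>{1..n}. P (e i) (e j) (e k) p * cnj (Q (e i) (e j) (e k) p))"

context
  fixes W assumes W: "openin T W"
begin

section \<open>Linearity over smooth functions\<close>

lemma lin_zero:
  assumes Q: "lin W Q" and p: "p \<in> W"
  shows "Q (\<lambda>q. 0) p = 0"
proof -
  have z: "field10 W (\<lambda>q. 0)"
    by (rule field10I) (use field_on_zero[of W] T10_zero mem_topspace[OF W] in \<open>simp_all add: zero_fun_def\<close>)
  have "Q (\<lambda>q. 0 \<odot> 0) p = 0 * Q (\<lambda>q. 0) p"
    by (rule lin_scale[OF Q smooth_fun_const[OF W] z p])
  then show ?thesis by (simp only: tv.scale_zero_right mult_zero_left)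
qed

lemma lin_sum:
  assumes Q: "lin W Q" and I: "finite I" and F: "\<And>i. i \<in> I \<Longrightarrow> field10 W (F i)"
    and c: "\<And>i. i \<in> I \<Longrightarrow> smooth_fun W (c i)" and p: "p \<in> W"
  shows "Q (\<lambda>q. \<Sum>i\<in>I. c i q \<odot> F i q) p = (\<Sum>i\<in>I. c i p * Q (F i) p)"
  using I F c
proof (induction I)
  case empty
  show ?case unfolding sum.empty by (rule lin_zero[OF Q p])
next
  case (insert i I)
  have "(\<lambda>q. \<Sum>i\<in>insert i I. c i q \<odot> F i q) = (\<lambda>q. c i q \<odot> F i q) + (\<lambda>q. \<Sum>i\<in>I. c i q \<odot> F i q)"
    by (rule ext) (simp only: sum.insert[OF insert.hyps] plus_fun_apply)
  then have "Q (\<lambda>q. \<Sum>i\<in>insert i I. c i q \<odot> F i q) p =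
      Q ((\<lambda>q. c i q \<odot> F i q) + (\<lambda>q. \<Sum>i\<in>I. c i q \<odot> F i q)) p" by (rule arg_cong)
  also have "\<dots> = Q (\<lambda>q. c i q \<odot> F i q) p + Q (\<lambda>q. \<Sum>i\<in>I. c i q \<odot> F i q) p"
  proof (rule lin_add[OF Q _ _ p])
    show "field10 W (\<lambda>q. c i q \<odot> F i q)"
      by (rule field10_scale[OF W]) (use insert.prems in auto)
    show "field10 W (\<lambda>q. \<Sum>i\<in>I. c i q \<odot> F i q)"
      by (rule field10_sum[OF W], rule field10_scale[OF W]) (use insert.prems in auto)
  qed
  also have "Q (\<lambda>q. c i q \<odot> F i q) p = c i p * Q (F i) p"
    by (rule lin_scale[OF Q _ _ p]) (use insert.prems in auto)
  also have "Q (\<lambda>q. \<Sum>i\<in>I. c i q \<odot> F i q) p = (\<Sum>i\<in>I. c i p * Q (F i) p)"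
    by (rule insert.IH) (use insert.prems in auto)
  finally show ?case unfolding sum.insert[OF insert.hyps] .
qed

lemma lin_diff:
  assumes Q: "lin W Q" and R: "lin W R"
  shows "lin W (\<lambda>X p. Q X p - R X p)"
proof (rule linI)
  show "smooth_fun W (\<lambda>p. Q X p - R X p)" if "field10 W X" for X
    using smooth_fun_diff[OF W lin_smooth[OF Q that] lin_smooth[OF R that]] .
  show "Q (X + X') p - R (X + X') p = Q X p - R X p + (Q X' p - R X' p)"
    if "field10 W X" "field10 W X'" "p \<in> W" for X X' p
    using lin_add[OF Q that] lin_add[OF R that] by simp
  show "Q (\<lambda>q. f q \<odot> X q) p - R (\<lambda>q. f q \<odot> X q) p = f p * (Q X p - R X p)"
    if "smooth_fun W f" "field10 W X" "p \<in> W" for f X p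
    using lin_scale[OF Q that] lin_scale[OF R that] by (simp add: algebra_simps)
  show "Q X p - R X p = Q X' p - R X' p" if "field10 W X" "\<And>q. q \<in> W \<Longrightarrow> X q = X' q" "p \<in> W" for X X' p
    using lin_cong[OF Q that] lin_cong[OF R that] by simp
qed

lemma field10_diff: "field10 W X \<Longrightarrow> field10 W Y \<Longrightarrow> field10 W (X - Y)"
  by (rule field10I) (simp_all add: field_on_diff[OF W] field10_field T10_diff field10_T10 mem_topspace[OF W])

lemma lin_diff_arg:
  assumes Q: "lin W Q" and X: "field10 W X" and Y: "field10 W Y" and p: "p \<in> W"
  shows "Q (X - Y) p = Q X p - Q Y p"
  using lin_add[OF Q field10_diff[OF X Y] Y p] by simp

text \<open>Both V(Q(fX)) and Q(nabla_V(fX)) produce the term (V f) Q X, which cancels: the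
  covariant derivative of a one-form is again a one-form.\<close>

lemma lin_cov:
  assumes Q: "lin W Q" and V: "field_on W V"
  shows "lin W (\<lambda>X p. V p (Q X) - Q (nabla V X) p)"
proof (rule linI)
  note nt = nabla_field10[OF W V]
  show "smooth_fun W (\<lambda>p. V p (Q X) - Q (nabla V X) p)" if "field10 W X" for X
    by (intro smooth_fun_diff W field_on_smooth[OF V W subset_refl] lin_smooth[OF Q] nt that)
  show "V p (Q (X + X')) - Q (nabla V (X + X')) p = V p (Q X) - Q (nabla V X) p + (V p (Q X') - Q (nabla V X') p)"
    if X: "field10 W X" "field10 W X'" and p: "p \<in> W" for X X' p
  proof -
    have "V p (Q (X + X')) = V p (\<lambda>q. Q X q + Q X' q)"
      by (rule tangent_cong[OF field_onD[OF V p] W p]) (rule lin_add[OF Q X])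
    also have "\<dots> = V p (Q X) + V p (Q X')"
      by (rule tangent_add[OF field_onD[OF V p]]; rule smooth_nearI[OF W p], rule lin_smooth[OF Q], rule X)
    finally have 1: "V p (Q (X + X')) = V p (Q X) + V p (Q X')" .
    have "Q (nabla V (X + X')) p = Q (nabla V X + nabla V X') p"
      by (rule lin_cong[OF Q nt[OF field10_add[OF W X]] _ p])
        (simp add: nabla_add2[OF W V field10_field[OF X(1)] field10_field[OF X(2)]])
    also have "\<dots> = Q (nabla V X) p + Q (nabla V X') p"
      by (rule lin_add[OF Q nt[OF X(1)] nt[OF X(2)] p])
    finally show ?thesis using 1 by simp
  qed
  show "V p (Q (\<lambda>q. f q \<odot> X q)) - Q (nabla V (\<lambda>q. f q \<odot> X q)) p = f p * (V p (Q X) - Q (nabla V X) p)"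
    if f: "smooth_fun W f" and X: "field10 W X" and p: "p \<in> W" for f X p
  proof -
    have "V p (Q (\<lambda>q. f q \<odot> X q)) = V p (\<lambda>q. f q * Q X q)"
      by (rule tangent_cong[OF field_onD[OF V p] W p]) (rule lin_scale[OF Q f X])
    also have "\<dots> = f p * V p (Q X) + Q X p * V p f"
      by (rule tangent_mult[OF field_onD[OF V p] smooth_nearI[OF W p f] smooth_nearI[OF W p lin_smooth[OF Q X]]])
    finally have 1: "V p (Q (\<lambda>q. f q \<odot> X q)) = f p * V p (Q X) + Q X p * V p f" .
    have Vf: "smooth_fun W (\<lambda>q. V q f)" by (rule field_on_smooth[OF V W subset_refl f])
    have "Q (nabla V (\<lambda>q. f q \<odot> X q)) p = Q ((\<lambda>q. V q f \<odot> X q) + (\<lambda>q. f q \<odot> nabla V X q)) p"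
      by (rule lin_cong[OF Q nt[OF field10_scale[OF W f X]] _ p])
        (simp add: nabla_scale2[OF W V field10_field[OF X] f])
    also have "\<dots> = Q (\<lambda>q. V q f \<odot> X q) p + Q (\<lambda>q. f q \<odot> nabla V X q) p"
      by (rule lin_add[OF Q field10_scale[OF W Vf X] field10_scale[OF W f nt[OF X]] p])
    also have "\<dots> = V p f * Q X p + f p * Q (nabla V X) p"
      using lin_scale[OF Q Vf X p] lin_scale[OF Q f nt[OF X] p] by simp
    finally show ?thesis using 1 by (simp add: algebra_simps)
  qed
  show "V p (Q X) - Q (nabla V X) p = V p (Q X') - Q (nabla V X') p"
    if X: "field10 W X" "\<And>q. q \<in> W \<Longrightarrow> X q = X' q" and p: "p \<in> W" for X X' p
  proof -
    have "V p (Q X) = V p (Q X')"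
      by (rule tangent_cong[OF field_onD[OF V p] W p]) (rule lin_cong[OF Q X])
    moreover have "Q (nabla V X) p = Q (nabla V X') p"
      by (rule lin_cong[OF Q nt[OF X(1)] _ p]) (rule nabla_cong[OF W V field10_field[OF X(1)] refl X(2)])
    ultimately show ?thesis by simp
  qed
qed

text \<open>With two arguments fixed, \<open>cov V P\<close> is the covariant derivative of a
  one-form in the remaining slot, minus two one-forms coming from the derivatives of the fixed
  arguments.\<close>

lemma trilin_cov:
  assumes P: "trilin W P" and V: "field_on W V"
  shows "trilin W (cov V P)"
  unfolding trilin_def
proof (intro allI impI, elim conjE)
  fix Y Z assume Y: "field10 W Y" and Z: "field10 W Z"
  note nY = nabla_field10[OF W V Y] and nZ = nabla_field10[OF W V Z]
  have "lin W (\<lambda>X p. V p (P X Y Z) - P (nabla V X) Y Z p - P X (nabla V Y) Z p - P X Y (nabla V Z) p)"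
    by (rule lin_diff[OF lin_diff[OF lin_cov[OF trilinD(1)[OF P Y Z] V] trilinD(1)[OF P nY Z]] trilinD(1)[OF P Y nZ]])
  moreover have "lin W (\<lambda>X p. V p (P Y X Z) - P Y (nabla V X) Z p - P (nabla V Y) X Z p - P Y X (nabla V Z) p)"
    by (rule lin_diff[OF lin_diff[OF lin_cov[OF trilinD(2)[OF P Y Z] V] trilinD(2)[OF P nY Z]] trilinD(2)[OF P Y nZ]])
  moreover have "lin W (\<lambda>X p. V p (P Y Z X) - P Y Z (nabla V X) p - P (nabla V Y) Z X p - P Y (nabla V Z) X p)"
    by (rule lin_diff[OF lin_diff[OF lin_cov[OF trilinD(3)[OF P Y Z] V] trilinD(3)[OF P nY Z]] trilinD(3)[OF P Y nZ]])
  moreover have "(\<lambda>X p. V p (P Y X Z) - P Y (nabla V X) Z p - P (nabla V Y) X Z p - P Y X (nabla V Z) p) = (\<lambda>X. cov V P Y X Z)"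
    "(\<lambda>X p. V p (P Y Z X) - P Y Z (nabla V X) p - P (nabla V Y) Z X p - P Y (nabla V Z) X p) = (\<lambda>X. cov V P Y Z X)"
    "(\<lambda>X p. V p (P X Y Z) - P (nabla V X) Y Z p - P X (nabla V Y) Z p - P X Y (nabla V Z) p) = (\<lambda>X. cov V P X Y Z)"
    by (intro ext; simp add: cov_def)+
  ultimately show "lin W (\<lambda>X. cov V P X Y Z) \<and> lin W (\<lambda>X. cov V P Y X Z) \<and> lin W (\<lambda>X. cov V P Y Z X)"
    by (simp only:)
qed

lemma trilin_tor: "trilin W tor"
  unfolding trilin_def
proof (intro allI impI, elim conjE)
  fix Y Z assume Y: "field10 W Y" and Z: "field10 W Z"
  note Yf = field10_field[OF Y] and Zf = field10_field[OF Z]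
  have 1: "lin W (\<lambda>X. tor X Y Z)"
  proof (rule linI)
    show "smooth_fun W (tor X Y Z)" if "field10 W X" for X
      unfolding tor_def[abs_def] by (rule g_smooth[OF W torsion_field[OF W field10_field[OF that] Yf] Zf])
    show "tor (X + X') Y Z p = tor X Y Z p + tor X' Y Z p"
      if X: "field10 W X" "field10 W X'" and p: "p \<in> W" for X X' p
      using field_onD[OF torsion_field[OF W field10_field[OF X(1)] Yf] p]
        field_onD[OF torsion_field[OF W field10_field[OF X(2)] Yf] p] field_onD[OF Zf p]
      by (simp add: tor_def torsion_add1[OF W field10_field[OF X(1)] field10_field[OF X(2)] Yf p] g_add[OF mem_topspace[OF W p]])
    show "tor (\<lambda>q. f q \<odot> X q) Y Z p = f p * tor X Y Z p"
      if f: "smooth_fun W f" and X: "field10 W X" and p: "p \<in> W" for f X p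
      using field_onD[OF torsion_field[OF W field10_field[OF X] Yf] p] field_onD[OF Zf p]
      by (simp add: tor_def torsion_scale1[OF W field10_field[OF X] Yf f p] g_scale[OF mem_topspace[OF W p]])
    show "tor X Y Z p = tor X' Y Z p" if X: "field10 W X" "\<And>q. q \<in> W \<Longrightarrow> X q = X' q" and p: "p \<in> W" for X X' p
      using torsion_cong[OF W field10_field[OF X(1)] Yf X(2) refl p] by (simp add: tor_def)
  qed
  have anti: "tor Y X Z p = - tor X Y Z p" if "field10 W X" "p \<in> W" for X p
    using field_onD[OF torsion_field[OF W field10_field[OF that(1)] Yf] that(2)] field_onD[OF Zf that(2)]
    by (simp add: tor_def torsion_antisym[OF W, of Y X] g_uminus[OF mem_topspace[OF W that(2)]])
  have 2: "lin W (\<lambda>X. tor Y X Z)"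
  proof (rule linI)
    show "smooth_fun W (tor Y X Z)" if "field10 W X" for X
      unfolding tor_def[abs_def] by (rule g_smooth[OF W torsion_field[OF W Yf field10_field[OF that]] Zf])
    show "tor Y (X + X') Z p = tor Y X Z p + tor Y X' Z p"
      if X: "field10 W X" "field10 W X'" and p: "p \<in> W" for X X' p
      using lin_add[OF 1 X p] anti[OF field10_add[OF W X] p] anti[OF X(1) p] anti[OF X(2) p] by simp
    show "tor Y (\<lambda>q. f q \<odot> X q) Z p = f p * tor Y X Z p"
      if f: "smooth_fun W f" and X: "field10 W X" and p: "p \<in> W" for f X p
      using lin_scale[OF 1 f X p] anti[OF field10_scale[OF W f X] p] anti[OF X p] by simp
    show "tor Y X Z p = tor Y X' Z p" if X: "field10 W X" "\<And>q. q \<in> W \<Longrightarrow> X q = X' q" and p: "p \<in> W" for X X' p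
      using torsion_cong[OF W Yf field10_field[OF X(1)] refl X(2) p] by (simp add: tor_def)
  qed
  have 3: "lin W (\<lambda>X. tor Y Z X)"
  proof (rule linI)
    note t = field_onD[OF torsion_field[OF W Yf Zf]]
    show "smooth_fun W (tor Y Z X)" if "field10 W X" for X
      unfolding tor_def[abs_def] by (rule g_smooth[OF W torsion_field[OF W Yf Zf] field10_field[OF that]])
    show "tor Y Z (X + X') p = tor Y Z X p + tor Y Z X' p"
      if X: "field10 W X" "field10 W X'" and p: "p \<in> W" for X X' p
      using t[OF p] field_onD[OF field10_field[OF X(1)] p] field_onD[OF field10_field[OF X(2)] p]
      by (simp add: tor_def g_add_right[OF mem_topspace[OF W p]])
    show "tor Y Z (\<lambda>q. f q \<odot> X q) p = f p * tor Y Z X p"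
      if f: "smooth_fun W f" and X: "field10 W X" and p: "p \<in> W" for f X p
      using t[OF p] field_onD[OF field10_field[OF X] p] by (simp add: tor_def g_scale_right[OF mem_topspace[OF W p]])
    show "tor Y Z X p = tor Y Z X' p" if X: "field10 W X" "\<And>q. q \<in> W \<Longrightarrow> X q = X' q" and p: "p \<in> W" for X X' p
      using X(2)[OF p] by (simp add: tor_def)
  qed
  show "lin W (\<lambda>X. tor X Y Z) \<and> lin W (\<lambda>X. tor Y X Z) \<and> lin W (\<lambda>X. tor Y Z X)"
    using 1 2 3 by simp
qed

section \<open>Curvature, the first Bianchi identity and the torsion\<close>

lemma curvature_op_eq:
  "curvature_op nabla U V X p = nabla U (nabla V X) p - nabla V (nabla U X) p - nabla (bracket U V) X p"
  by (simp add: curvature_op_def)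

lemma curvature_op_field10:
  assumes U: "field_on W U" and V: "field_on W V" and X: "field10 W X"
  shows "field10 W (curvature_op nabla U V X)"
  unfolding curvature_op_def
  by (intro field10_diff nabla_field10[OF W] U V X field_on_bracket[OF W])

lemma curvature_op_cong:
  assumes U: "field_on W U" "\<And>q. q \<in> W \<Longrightarrow> U q = U' q" and V: "field_on W V" "\<And>q. q \<in> W \<Longrightarrow> V q = V' q"
    and X: "field_on W X" "\<And>q. q \<in> W \<Longrightarrow> X q = X' q" and p: "p \<in> W"
  shows "curvature_op nabla U V X p = curvature_op nabla U' V' X' p"
proof -
  note VX = nabla_cong[OF W V(1) X(1) V(2) X(2)] and UX = nabla_cong[OF W U(1) X(1) U(2) X(2)]
  have 1: "nabla U (nabla V X) p = nabla U' (nabla V' X') p"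
    by (rule nabla_cong[OF W U(1) nabla_field[OF W V(1) X(1)] U(2) VX p])
  have 2: "nabla V (nabla U X) p = nabla V' (nabla U' X') p"
    by (rule nabla_cong[OF W V(1) nabla_field[OF W U(1) X(1)] V(2) UX p])
  have "bracket U V q = bracket U' V' q" if "q \<in> W" for q
    by (rule bracket_cong[OF W that U(1,2) V(1,2)])
  then have 3: "nabla (bracket U V) X p = nabla (bracket U' V') X' p"
    by (intro nabla_cong[OF W field_on_bracket[OF W U(1) V(1)] X(1) _ X(2) p])
  show ?thesis unfolding curvature_op_eq 1 2 3 ..
qed

text \<open>On the function g(X,Y) the operator UV - VU - [U,V] is zero. Expanded with nabla g = 0,
  the terms in which each of X and Y is differentiated once are symmetric in U and V and drop
  out.\<close>

lemma curvature_skew: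
  assumes U: "field_on W U" and V: "field_on W V" and X: "field_on W X" and Y: "field_on W Y" and p: "p \<in> W"
  shows "g p (curvature_op nabla U V X p) (Y p) = - g p (X p) (curvature_op nabla U V Y p)"
proof -
  note pT = mem_topspace[OF W p]
  note nf = nabla_field[OF W] and BUV = field_on_bracket[OF W U V]
  have gs: "smooth_fun W (\<lambda>q. g q (A q) (B q))" if "field_on W A" "field_on W B" for A B
    by (rule g_smooth[OF W that])
  have second: "A p (\<lambda>q. B q (\<lambda>r. g r (X r) (Y r))) =
      g p (nabla A (nabla B X) p) (Y p) + g p (nabla B X p) (nabla A Y p)
      + (g p (nabla A X p) (nabla B Y p) + g p (X p) (nabla A (nabla B Y) p))"
    if A: "field_on W A" and B: "field_on W B" for A B
  proof -
    have "A p (\<lambda>q. B q (\<lambda>r. g r (X r) (Y r))) = A p (\<lambda>q. g q (nabla B X q) (Y q) + g q (X q) (nabla B Y q))"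
      by (rule tangent_cong[OF field_onD[OF A p] W p]) (rule nabla_metric[OF W B X Y])
    also have "\<dots> = A p (\<lambda>q. g q (nabla B X q) (Y q)) + A p (\<lambda>q. g q (X q) (nabla B Y q))"
      by (rule tangent_add[OF field_onD[OF A p]]; rule smooth_nearI[OF W p]; rule gs)
        (rule nf[OF B X] Y X nf[OF B Y])+
    finally show ?thesis
      using nabla_metric[OF W A nf[OF B X] Y p] nabla_metric[OF W A X nf[OF B Y] p] by simp
  qed
  have "bracket U V p (\<lambda>r. g r (X r) (Y r)) = U p (\<lambda>q. V q (\<lambda>r. g r (X r) (Y r))) - V p (\<lambda>q. U q (\<lambda>r. g r (X r) (Y r)))"
    by (rule bracket_apply[OF smooth_nearI[OF W p gs[OF X Y]]])
  then have *: "g p (nabla (bracket U V) X p) (Y p) + g p (X p) (nabla (bracket U V) Y p) =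
      g p (nabla U (nabla V X) p) (Y p) + g p (X p) (nabla U (nabla V Y) p)
      - (g p (nabla V (nabla U X) p) (Y p) + g p (X p) (nabla V (nabla U Y) p))"
    using nabla_metric[OF W BUV X Y p] second[OF U V] second[OF V U] by simp
  have t: "A p \<in> tangent_space p" if "field_on W A" for A using field_onD[OF that p] .
  have l: "g p (curvature_op nabla U V X p) (Y p) = g p (nabla U (nabla V X) p) (Y p)
      - g p (nabla V (nabla U X) p) (Y p) - g p (nabla (bracket U V) X p) (Y p)"
    unfolding curvature_op_eq
    by (simp add: g_diff[OF pT] tangent_space_diff t nf U V X Y BUV)
  have r: "g p (X p) (curvature_op nabla U V Y p) = g p (X p) (nabla U (nabla V Y) p)
      - g p (X p) (nabla V (nabla U Y) p) - g p (X p) (nabla (bracket U V) Y p)"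
    unfolding curvature_op_eq
    by (simp add: g_sym[OF pT t[OF X]] g_diff[OF pT] tangent_space_diff t nf U V X Y BUV)
  show ?thesis unfolding l r using * by (simp add: algebra_simps)
qed

text \<open>Paired with a (1,0)-field, every term of type (1,0) drops out of the first Bianchi identity.\<close>

lemma bianchi:
  assumes X: "field10 W X" and Y: "field10 W Y" and Z: "field10 W Z" and I: "field10 W I" and p: "p \<in> W"
  shows "g p (curvature_op nabla X Y (conj_field Z) p) (I p) = cov (conj_field Z) tor X Y I p"
proof -
  note pT = mem_topspace[OF W p]
  define C where "C = conj_field Z"
  note Xf = field10_field[OF X] and Yf = field10_field[OF Y] and If = field10_field[OF I]
  have Cf: "field_on W C" unfolding C_def by (rule field_on_conj[OF field10_field[OF Z]])
  note nf = nabla_field[OF W] and bf = field_on_bracket[OF W] and tf = torsion_field[OF W]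
  have t: "A p \<in> tangent_space p" if "field_on W A" for A using field_onD[OF that p] .
  have mixed: "bracket A C q = nabla A C q - nabla C A q" if "field10 W A" "q \<in> W" for A q
    using torsion_mixed[OF W that(1) Z that(2)] by (simp add: torsion_eq[OF W] C_def)
  have s1: "nabla D (bracket A C) p = nabla D (nabla A C) p - nabla D (nabla C A) p"
    if "field10 W A" "field_on W D" for A D
  proof -
    have "nabla D (bracket A C) p = nabla D (nabla A C - nabla C A) p"
      by (rule nabla_cong[OF W that(2) bf[OF field10_field[OF that(1)] Cf] refl _ p]) (simp add: mixed[OF that(1)])
    then show ?thesis using nabla_diff2[OF W that(2) nf[OF field10_field[OF that(1)] Cf] nf[OF Cf field10_field[OF that(1)]] p] by simp
  qed
  have s2: "nabla C (bracket X Y) p = nabla C (nabla X Y) p - nabla C (nabla Y X) p - nabla C (torsion nabla X Y) p"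
  proof -
    have "bracket X Y = nabla X Y - nabla Y X - torsion nabla X Y"
      by (simp add: torsion_def)
    then show ?thesis
      using nabla_diff2[OF W Cf field_on_diff[OF W nf[OF Xf Yf] nf[OF Yf Xf]] tf[OF Xf Yf] p]
        nabla_diff2[OF W Cf nf[OF Xf Yf] nf[OF Yf Xf] p] by simp
  qed
  \<comment> \<open>a and b are the other two curvature terms of the cyclic sum, up to the sign of
    b. Their last arguments X and Y are of type (1,0), hence so are a and b.\<close>
  define a where "a = curvature_op nabla Y C X p"
  define b where "b = curvature_op nabla X C Y p"
  have a10: "a \<in> T10 p" and b10: "b \<in> T10 p"
    unfolding a_def b_def using field10_T10[OF curvature_op_field10[OF _ Cf] p] X Y Xf Yf by blast+
  have jac: "bracket X (bracket Y C) p + bracket Y (bracket C X) p + bracket C (bracket X Y) p = 0"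
    by (rule jacobi[OF W p Xf Yf Cf])
  have tor1: "torsion nabla X (bracket Y C) p = nabla X (bracket Y C) p - nabla (bracket Y C) X p - bracket X (bracket Y C) p"
    by (rule torsion_eq[OF W])
  have tor2: "torsion nabla Y (bracket X C) p = nabla Y (bracket X C) p - nabla (bracket X C) Y p + bracket Y (bracket C X) p"
  proof -
    have "bracket Y (bracket X C) p = - bracket Y (bracket C X) p"
    proof -
      have "bracket Y (bracket X C) p = - bracket (bracket X C) Y p" by (rule bracket_antisym)
      also have "bracket (bracket X C) Y p = bracket (\<lambda>q. (-1) \<odot> bracket C X q) Y p"
        by (rule bracket_cong[OF W p bf[OF Xf Cf] _ Yf refl]) (simp add: bracket_antisym[of X C])
      also have "\<dots> = - bracket (bracket C X) Y p"
        using bracket_scale_left[OF W p bf[OF Cf Xf] Yf smooth_fun_const[OF W, of "-1"]] tangent_const[OF t[OF Yf]]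
        by simp
      finally show ?thesis using bracket_antisym[of Y "bracket C X" p] by simp
    qed
    then show ?thesis by (simp add: torsion_eq[OF W])
  qed
  have tor3: "torsion nabla C (bracket X Y) p = nabla C (bracket X Y) p - nabla (bracket X Y) C p - bracket C (bracket X Y) p"
    by (rule torsion_eq[OF W])
  \<comment> \<open>The first Bianchi identity of a connection with torsion, solved for R(X,Y)C. It
    is obtained by writing the nested brackets through torsion and using the Jacobi
    identity.\<close>
  have main: "curvature_op nabla X Y C p = nabla C (torsion nabla X Y) p + torsion nabla X (bracket Y C) p
      - torsion nabla Y (bracket X C) p + torsion nabla C (bracket X Y) p - a + b"
  proof -
    have "torsion nabla X (bracket Y C) p - torsion nabla Y (bracket X C) p + torsion nabla C (bracket X Y) p =
      (nabla X (bracket Y C) p - nabla (bracket Y C) X p) - (nabla Y (bracket X C) p - nabla (bracket X C) Y p)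
      + (nabla C (bracket X Y) p - nabla (bracket X Y) C p)
      - (bracket X (bracket Y C) p + bracket Y (bracket C X) p + bracket C (bracket X Y) p)"
      unfolding tor1 tor2 tor3 by simp
    then have "torsion nabla X (bracket Y C) p - torsion nabla Y (bracket X C) p + torsion nabla C (bracket X Y) p =
      (nabla X (bracket Y C) p - nabla (bracket Y C) X p) - (nabla Y (bracket X C) p - nabla (bracket X C) Y p)
      + (nabla C (bracket X Y) p - nabla (bracket X Y) C p)"
      unfolding jac by simp
    then show ?thesis
      unfolding a_def b_def curvature_op_eq s1[OF Y Xf] s1[OF X Yf] s2 by (simp add: algebra_simps)
  qed
  \<comment> \<open>nabla_B C is the conjugate of a (1,0)-field, so its torsion with a (1,0)-field
    is mixed and vanishes.\<close>
  have mixed_tor: "torsion nabla A (nabla B C) p = 0" if A: "field10 W A" and B: "field_on W B" for A B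
  proof -
    have D: "field10 W (nabla (conj_field B) Z)" by (rule nabla_field10[OF W field_on_conj[OF B] Z])
    have "torsion nabla A (nabla B C) p = torsion nabla A (conj_field (nabla (conj_field B) Z)) p"
      by (rule torsion_cong[OF W field10_field[OF A] nf[OF B Cf] refl _ p])
        (simp only: C_def nabla_conj[OF W B field10_field[OF Z]] conj_field_def[of "nabla (conj_field B) Z"])
    then show ?thesis using torsion_mixed[OF W A D p] by simp
  qed
  have diff_tor: "torsion nabla A (B - B') p = torsion nabla A B p - torsion nabla A B' p"
    if "field_on W A" "field_on W B" "field_on W B'" for A B B'
    using torsion_add1[OF W field_on_diff[OF W that(2,3)] that(3,1) p]
      torsion_antisym[OF W, of A "B - B'" p] torsion_antisym[OF W, of A B p] torsion_antisym[OF W, of A B' p] by simp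
  have T1: "torsion nabla X (bracket Y C) p = - torsion nabla X (nabla C Y) p"
  proof -
    have "torsion nabla X (bracket Y C) p = torsion nabla X (nabla Y C - nabla C Y) p"
      by (rule torsion_cong[OF W Xf bf[OF Yf Cf] refl _ p]) (simp add: mixed[OF Y])
    then show ?thesis using diff_tor[OF Xf nf[OF Yf Cf] nf[OF Cf Yf]] mixed_tor[OF X Yf] by simp
  qed
  have T2: "torsion nabla Y (bracket X C) p = torsion nabla (nabla C X) Y p"
  proof -
    have "torsion nabla Y (bracket X C) p = torsion nabla Y (nabla X C - nabla C X) p"
      by (rule torsion_cong[OF W Yf bf[OF Xf Cf] refl _ p]) (simp add: mixed[OF X])
    then show ?thesis using diff_tor[OF Yf nf[OF Xf Cf] nf[OF Cf Xf]] mixed_tor[OF Y Xf]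
        torsion_antisym[OF W, of Y "nabla C X" p] by simp
  qed
  \<comment> \<open>Replace [X,Y] by nabla_X Y - nabla_Y X - \<tau>(X,Y). The first two have zero
    torsion with C, and \<tau>(X,Y) is of type (0,1) like C, so that their torsion is of type
    (1,0).\<close>
  have T3: "torsion nabla C (bracket X Y) p \<in> T10 p"
  proof -
    have tt: "field10 W (conj_field (torsion nabla X Y))"
      by (rule field10I[OF field_on_conj[OF tf[OF Xf Yf]]])
        (simp add: conj_field_def conj_T01[OF mem_topspace[OF W]] torsion_T01[OF W X Y])
    have cA: "torsion nabla C A p = 0" if "field10 W A" for A
      using torsion_mixed[OF W that Z p] torsion_antisym[OF W, of C A p] by (simp add: C_def)
    have "torsion nabla C (bracket X Y) p = torsion nabla C (nabla X Y - nabla Y X - torsion nabla X Y) p"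
      by (simp add: torsion_def)
    also have "\<dots> = - torsion nabla C (torsion nabla X Y) p"
      using diff_tor[OF Cf field_on_diff[OF W nf[OF Xf Yf] nf[OF Yf Xf]] tf[OF Xf Yf]]
        diff_tor[OF Cf nf[OF Xf Yf] nf[OF Yf Xf]] cA[OF nabla_field10[OF W Xf Y]] cA[OF nabla_field10[OF W Yf X]] by simp
    also have "torsion nabla C (torsion nabla X Y) p = torsion nabla (conj_field Z) (conj_field (conj_field (torsion nabla X Y))) p"
      by (simp add: C_def)
    also have "\<dots> = conj_vec (torsion nabla Z (conj_field (torsion nabla X Y)) p)"
      by (rule torsion_conj_conj[OF W field10_field[OF Z] field10_field[OF tt] p])
    finally have "torsion nabla C (bracket X Y) p = - conj_vec (torsion nabla Z (conj_field (torsion nabla X Y)) p)" .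
    moreover have "- conj_vec (torsion nabla Z (conj_field (torsion nabla X Y)) p) \<in> T10 p"
      using T10_scale[OF pT conj_T01[OF pT torsion_T01[OF W Z tt p]], of "-1"] by simp
    ultimately show ?thesis by simp
  qed
  have z: "g p v (I p) = 0" if "v \<in> T10 p" for v
    by (rule g_T10_T10[OF pT that field10_T10[OF I p]])
  have "g p (curvature_op nabla X Y C p) (I p) = g p (nabla C (torsion nabla X Y) p) (I p)
      - g p (torsion nabla X (nabla C Y) p) (I p) - g p (torsion nabla (nabla C X) Y p) (I p)"
  proof -
    \<comment> \<open>u is (nabla_C \<tau>)(X,Y), and v collects what has type (1,0) and is
      invisible to g(-, I).\<close>
    define u where "u = nabla C (torsion nabla X Y) p - torsion nabla X (nabla C Y) p - torsion nabla (nabla C X) Y p"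
    define v where "v = torsion nabla C (bracket X Y) p - a + b"
    have "curvature_op nabla X Y C p = u + v" unfolding main T1 T2 u_def v_def by simp
    moreover have v: "v \<in> T10 p" unfolding v_def by (intro T10_add T10_diff pT T3 a10 b10)
    moreover have "u \<in> tangent_space p"
      unfolding u_def by (intro tangent_space_diff t nf tf Cf Xf Yf)
    ultimately have "g p (curvature_op nabla X Y C p) (I p) = g p u (I p)"
      using z[OF v] T10_tangent[OF v] t[OF If] by (simp add: g_add[OF pT])
    then show ?thesis
      unfolding u_def by (simp add: g_diff[OF pT] tangent_space_diff t nf tf Cf Xf Yf If)
  qed
  moreover have "C p (tor X Y I) = g p (nabla C (torsion nabla X Y) p) (I p) + g p (torsion nabla X Y p) (nabla C I p)"
    unfolding tor_def[abs_def] by (rule nabla_metric[OF W Cf tf[OF Xf Yf] If p])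
  ultimately show ?thesis by (simp add: cov_def tor_def C_def)
qed

text \<open>Skew-symmetry moves the operator R(X,Y) from I to conj Z, at the cost of a sign; there
  the Bianchi identity turns it into a derivative of T.\<close>

lemma curvature20_tor:
  assumes X: "field10 W X" and Y: "field10 W Y" and Z: "field10 W Z" and I: "field10 W I" and p: "p \<in> W"
  shows "curvature20 nabla I (conj_field Z) X Y p = - cov (conj_field Z) tor X Y I p"
proof -
  note pT = mem_topspace[OF W p]
  have c: "part10 A q = A q" if "field10 W A" "q \<in> W" for A q
    using part10v_of_T10[OF field10_T10[OF that]] by (simp add: part10_eq)
  have "curvature_op nabla (part10 X) (part10 Y) (part10 I) p = curvature_op nabla X Y I p"
    by (rule curvature_op_cong) (use c X Y I p in \<open>auto intro: field_on_part10[OF W] field10_field\<close>)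
  moreover have "part01 (conj_field Z) p = conj_field Z p"
    using part01v_of_T01[OF conj_T10[OF pT field10_T10[OF Z p]]] by (simp add: part01_eq conj_field_def)
  ultimately have "curvature20 nabla I (conj_field Z) X Y p = g p (curvature_op nabla X Y I p) (conj_field Z p)"
    by (simp add: curvature20_def curvature_def)
  also have "\<dots> = - g p (I p) (curvature_op nabla X Y (conj_field Z) p)"
    by (rule curvature_skew) (use X Y I Z p in \<open>auto intro: field10_field field_on_conj\<close>)
  also have "g p (I p) (curvature_op nabla X Y (conj_field Z) p) = g p (curvature_op nabla X Y (conj_field Z) p) (I p)"
  proof (rule g_sym[OF pT])
    show "I p \<in> tangent_space p" using field_onD[OF field10_field[OF I] p] .
    have "field_on W (curvature_op nabla X Y (conj_field Z))"
      unfolding curvature_op_def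
      by (intro field_on_diff[OF W] nabla_field[OF W] field_on_bracket[OF W] field_on_conj field10_field X Y Z)
    then show "curvature_op nabla X Y (conj_field Z) p \<in> tangent_space p" using field_onD p by blast
  qed
  finally show ?thesis using bianchi[OF X Y Z I p] by simp
qed

text \<open>The difference of the two sides is the second covariant derivative of T along V and conj
  Z. By \<open>curvature20_tor\<close> it is minus the covariant derivative of the (2,0)-curvature;
  the right side comes from differentiating the slot that contains conj Z.\<close>

lemma parallel_tor:
  assumes par: "parallel_curvature20 nabla" and V: "field_on W V" and Z: "field10 W Z"
    and X: "field10 W X" and Y: "field10 W Y" and I: "field10 W I" and p: "p \<in> W"
  shows "cov V (cov (conj_field Z) tor) X Y I p = cov (nabla V (conj_field Z)) tor X Y I p"
proof -
  let ?C = "conj_field Z"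
  note Xf = field10_field[OF X] and Yf = field10_field[OF Y] and If = field10_field[OF I] and Zf = field10_field[OF Z]
  note Cf = field_on_conj[OF Zf]
  note n10 = nabla_field10[OF W V]
  \<comment> \<open>nabla_V conj Z is the conjugate of the (1,0)-field D, so
    \<open>curvature20_tor\<close> also covers this slot.\<close>
  define D where "D = nabla (conj_field V) Z"
  have D: "field10 W D" unfolding D_def by (rule nabla_field10[OF W field_on_conj[OF V] Z])
  have nC: "nabla V ?C q = conj_field D q" if "q \<in> W" for q
    using nabla_conj[OF W V Zf that] by (simp add: D_def conj_field_def)
  have c1: "V p (curvature20 nabla I ?C X Y) = - V p (cov ?C tor X Y I)"
  proof -
    have sm: "smooth_fun W (cov ?C tor X Y I)"
      by (rule trilin_smooth[OF trilin_cov[OF trilin_tor Cf] X Y I])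
    have "V p (curvature20 nabla I ?C X Y) = V p (\<lambda>q. (-1) * cov ?C tor X Y I q)"
      by (rule tangent_cong[OF field_onD[OF V p] W p]) (simp add: curvature20_tor[OF X Y Z I])
    then show ?thesis using tangent_cmult[OF field_onD[OF V p] smooth_nearI[OF W p sm], of "-1"] by simp
  qed
  have c2: "curvature20 nabla I (nabla V ?C) X Y p = - cov (nabla V ?C) tor X Y I p"
  proof -
    have "curvature20 nabla I (nabla V ?C) X Y p = curvature20 nabla I (conj_field D) X Y p"
      by (simp add: curvature20_def curvature_def part01_eq nC[OF p])
    also have "\<dots> = - cov (conj_field D) tor X Y I p" by (rule curvature20_tor[OF X Y D I p])
    also have "cov (conj_field D) tor X Y I p = cov (nabla V ?C) tor X Y I p"
    proof -
      have Df: "field_on W (conj_field D)" by (rule field_on_conj[OF field10_field[OF D]])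
      have n: "nabla (conj_field D) B q = nabla (nabla V ?C) B q" if "field10 W B" "q \<in> W" for B q
        by (rule nabla_cong[OF W Df field10_field[OF that(1)] _ refl that(2)]) (simp add: nC)
      note nD = nabla_field10[OF W Df]
      show ?thesis
        unfolding cov_def nC[OF p]
        using lin_cong[OF trilinD(1)[OF trilin_tor Y I] nD[OF X] n[OF X] p]
          lin_cong[OF trilinD(2)[OF trilin_tor X I] nD[OF Y] n[OF Y] p]
          lin_cong[OF trilinD(3)[OF trilin_tor X Y] nD[OF I] n[OF I] p] by simp
    qed
    finally show ?thesis .
  qed
  have "V p (curvature20 nabla I ?C X Y) - curvature20 nabla (nabla V I) ?C X Y p - curvature20 nabla I (nabla V ?C) X Y p
     - curvature20 nabla I ?C (nabla V X) Y p - curvature20 nabla I ?C X (nabla V Y) p = 0"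
    using par[unfolded parallel_curvature20_def, rule_format, of W V I ?C X Y p] W V If Cf Xf Yf p by simp
  then show ?thesis
    unfolding c1 c2 curvature20_tor[OF X Y Z n10[OF I] p] curvature20_tor[OF n10[OF X] Y Z I p]
      curvature20_tor[OF X n10[OF Y] Z I p]
    unfolding cov_def[of V] by (simp add: algebra_simps)
qed

section \<open>Commuting covariant derivatives\<close>

lemma cov_diff_direction:
  assumes P: "trilin W P" and U: "field_on W U" and V: "field_on W V"
    and X: "field10 W X" and Y: "field10 W Y" and Z: "field10 W Z" and p: "p \<in> W"
  shows "cov (U - V) P X Y Z p = cov U P X Y Z p - cov V P X Y Z p"
proof -
  note UV = field_on_diff[OF W U V]
  have n: "nabla (U - V) B q = (nabla U B - nabla V B) q" if "field10 W B" "q \<in> W" for B q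
    using nabla_diff1[OF W U V field10_field[OF that(1)] that(2)] by simp
  have l: "Q (nabla (U - V) B) p = Q (nabla U B) p - Q (nabla V B) p" if Q: "lin W Q" and B: "field10 W B" for Q B
    by (rule trans[OF lin_cong[OF Q nabla_field10[OF W UV B] n[OF B] p]
          lin_diff_arg[OF Q nabla_field10[OF W U B] nabla_field10[OF W V B] p]])
  show ?thesis
    unfolding cov_def
    using l[OF trilinD(1)[OF P Y Z] X] l[OF trilinD(2)[OF P X Z] Y] l[OF trilinD(3)[OF P X Y] Z] by simp
qed

lemma cov_cong_direction:
  assumes P: "trilin W P" and U: "field_on W U" "\<And>q. q \<in> W \<Longrightarrow> U q = V q"
    and X: "field10 W X" and Y: "field10 W Y" and Z: "field10 W Z" and p: "p \<in> W"
  shows "cov U P X Y Z p = cov V P X Y Z p"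
proof -
  have n: "nabla U B q = nabla V B q" if "field10 W B" "q \<in> W" for B q
    by (rule nabla_cong[OF W U(1) field10_field[OF that(1)] U(2) refl that(2)])
  note nU = nabla_field10[OF W U(1)]
  show ?thesis
    unfolding cov_def U(2)[OF p]
    using lin_cong[OF trilinD(1)[OF P Y Z] nU[OF X] n[OF X] p]
      lin_cong[OF trilinD(2)[OF P X Z] nU[OF Y] n[OF Y] p]
      lin_cong[OF trilinD(3)[OF P X Y] nU[OF Z] n[OF Z] p] by simp
qed

text \<open>Terms with one derivative on P and one on an argument, or with derivatives on two
  different arguments, are symmetric in U and V and cancel. There remains the curvature operator on
  each argument, negative because P is covariant.\<close>

lemma ricci_identity:
  assumes P: "trilin W P" and U: "field_on W U" and V: "field_on W V"
    and X: "field10 W X" and Y: "field10 W Y" and Z: "field10 W Z" and p: "p \<in> W"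
  shows "cov U (cov V P) X Y Z p - cov V (cov U P) X Y Z p - cov (bracket U V) P X Y Z p =
    - (P (curvature_op nabla U V X) Y Z p + P X (curvature_op nabla U V Y) Z p + P X Y (curvature_op nabla U V Z) p)"
proof -
  note nU = nabla_field10[OF W U] and nV = nabla_field10[OF W V]
  note nB = nabla_field10[OF W field_on_bracket[OF W U V]]
  have expand: "cov A (cov B P) X Y Z p =
      A p (\<lambda>q. B q (P X Y Z)) - A p (P (nabla B X) Y Z) - A p (P X (nabla B Y) Z) - A p (P X Y (nabla B Z))
      - cov B P (nabla A X) Y Z p - cov B P X (nabla A Y) Z p - cov B P X Y (nabla A Z) p"
    if A: "field_on W A" and B: "field_on W B" for A B
  proof -
    note nb = nabla_field10[OF W B]
    note s = smooth_nearI[OF W p]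
    have 0: "smooth_near p (\<lambda>q. B q (P X Y Z))"
      by (rule s, rule field_on_smooth[OF B W subset_refl], rule trilin_smooth[OF P X Y Z])
    have 1: "smooth_near p (P (nabla B X) Y Z)" by (rule s, rule trilin_smooth[OF P nb[OF X] Y Z])
    have 2: "smooth_near p (P X (nabla B Y) Z)" by (rule s, rule trilin_smooth[OF P X nb[OF Y] Z])
    have 3: "smooth_near p (P X Y (nabla B Z))" by (rule s, rule trilin_smooth[OF P X Y nb[OF Z]])
    have sd: "smooth_near p (\<lambda>q. f q - h q)" if "smooth_near p f" "smooth_near p h" for f h
      using smooth_near_add[OF that(1) smooth_near_cmult[OF that(2), of "-1"]] by simp
    note At = field_onD[OF A p]
    have "A p (cov B P X Y Z) = A p (\<lambda>q. B q (P X Y Z)) - A p (P (nabla B X) Y Z) - A p (P X (nabla B Y) Z) - A p (P X Y (nabla B Z))"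
      unfolding cov_def[abs_def]
      using tangent_diff[OF At sd[OF sd[OF 0 1] 2] 3] tangent_diff[OF At sd[OF 0 1] 2] tangent_diff[OF At 0 1] by simp
    then show ?thesis by (simp add: cov_def[of A])
  qed
  have br: "bracket U V p (P X Y Z) = U p (\<lambda>q. V q (P X Y Z)) - V p (\<lambda>q. U q (P X Y Z))"
    by (rule bracket_apply[OF smooth_nearI[OF W p trilin_smooth[OF P X Y Z]]])
  have curv: "Q (curvature_op nabla U V B) p = Q (nabla U (nabla V B)) p - Q (nabla V (nabla U B)) p - Q (nabla (bracket U V) B) p"
    if Q: "lin W Q" and B: "field10 W B" for Q B
    unfolding curvature_op_def
    using lin_diff_arg[OF Q field10_diff[OF nU[OF nV[OF B]] nV[OF nU[OF B]]] nB[OF B] p]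
      lin_diff_arg[OF Q nU[OF nV[OF B]] nV[OF nU[OF B]] p] by simp
  show ?thesis
    unfolding expand[OF U V] expand[OF V U] curv[OF trilinD(1)[OF P Y Z] X] curv[OF trilinD(2)[OF P X Z] Y]
      curv[OF trilinD(3)[OF P X Y] Z]
    unfolding cov_def br by simp
qed

end

end


section \<open>The Bochner formula for the torsion\<close>

context almost_hermitian_manifold
begin

lemma unitary_frame_field10: "unitary_frame W e \<Longrightarrow> i \<in> {1..n} \<Longrightarrow> field10 W (e i)"
  by (simp add: unitary_frame_def field10_def)

lemma unitary_frame_open: "unitary_frame W e \<Longrightarrow> openin T W"
  by (simp add: unitary_frame_def)

lemma unitary_frame_subset:
  assumes "unitary_frame W e" "openin T V" "V \<subseteq> W"
  shows "unitary_frame V e"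
  using assms unfolding unitary_frame_def type10_on_def by (auto intro: field_on_subset)

lemma frame_operator_cong:
  assumes F: "unitary_frame W e" and B: "field_on W B" and p: "p \<in> W" and u: "\<And>q. q \<in> W \<Longrightarrow> u q = w q"
  shows "frame_operator e B u p = frame_operator e B w p"
proof -
  note W = unitary_frame_open[OF F] and f = field10_field[OF unitary_frame_field10[OF F]]
  have c: "X q u = X q w" if "field_on W X" "q \<in> W" for X q
    by (rule tangent_cong[OF field_onD[OF that] W that(2) u])
  have "e a p (\<lambda>r. conj_field (e a) r u) = e a p (\<lambda>r. conj_field (e a) r w)" if a: "a \<in> {1..n}" for a
    by (rule tangent_cong[OF field_onD[OF f[OF a] p] W p c[OF field_on_conj[OF f[OF a]]]])
  then show ?thesis using c[OF B p] by (simp add: frame_operator_def)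
qed

end

lemma sum3_rotate:
  fixes f :: "'i \<Rightarrow> 'j \<Rightarrow> 'k \<Rightarrow> 'c::comm_monoid_add"
  shows "(\<Sum>i\<in>A. \<Sum>j\<in>B. \<Sum>k\<in>C. f i j k) = (\<Sum>j\<in>B. \<Sum>k\<in>C. \<Sum>i\<in>A. f i j k)"
proof -
  have "(\<Sum>i\<in>A. \<Sum>j\<in>B. \<Sum>k\<in>C. f i j k) = (\<Sum>j\<in>B. \<Sum>i\<in>A. \<Sum>k\<in>C. f i j k)" by (rule sum.swap)
  also have "\<dots> = (\<Sum>j\<in>B. \<Sum>k\<in>C. \<Sum>i\<in>A. f i j k)" by (rule sum.cong[OF refl], rule sum.swap)
  finally show ?thesis .
qed

context quasi_kaehler_connection
begin

text \<open>Minus the action of R(V, conj V) on T as a derivation; paired with T and summed over a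
  frame it has the three R''-terms as its real part.\<close>

definition ric :: "'a vfield \<Rightarrow> 'a vfield \<Rightarrow> 'a vfield \<Rightarrow> 'a vfield \<Rightarrow> 'a \<Rightarrow> complex" where
  "ric V X Y Z p = tor (curvature_op nabla V (conj_field V) X) Y Z p
    + tor X (curvature_op nabla V (conj_field V) Y) Z p + tor X Y (curvature_op nabla V (conj_field V) Z) p"

text \<open>With this drift \<open>frame_operator\<close> becomes the trace of a second covariant
  derivative.\<close>

definition frame_drift :: "(nat \<Rightarrow> 'a vfield) \<Rightarrow> 'a vfield" where
  "frame_drift e = (\<lambda>q. \<Sum>a\<in>{1..n}. nabla (e a) (conj_field (e a)) q)"

lemma pairing_self:
  "pairing e P P p = of_real (\<Sum>i\<in>{1..n}. \<Sum>j\<in>{1..n}. \<Sum>k\<in>{1..n}. (cmod (P (e i) (e j) (e k) p))\<^sup>2)"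
  unfolding pairing_def by (simp only: complex_norm_square of_real_sum)

lemma pairing_self_nonneg: "0 \<le> Re (pairing e P P p)"
  unfolding pairing_self Re_complex_of_real by (intro sum_nonneg) simp

context
  fixes W e assumes F: "unitary_frame W e"
begin

private lemmas W = unitary_frame_open[OF F]
private lemmas e10 = unitary_frame_field10[OF F]
private lemmas ef = field10_field[OF e10]

section \<open>Differentiating the Hermitian pairing in a unitary frame\<close>

lemma lin_frame:
  assumes Q: "lin W Q" and X: "field10 W X" and p: "p \<in> W"
  shows "Q X p = (\<Sum>i\<in>{1..n}. g p (X p) (conj_vec (e i p)) * Q (e i) p)"
proof -
  have "Q X p = Q (\<lambda>q. \<Sum>i\<in>{1..n}. g q (X q) (conj_vec (e i q)) \<odot> e i q) p"
    by (rule lin_cong[OF Q X _ p]) (rule frame_expansion10[OF F _ field10_T10[OF X]])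
  also have "\<dots> = (\<Sum>i\<in>{1..n}. g p (X p) (conj_vec (e i p)) * Q (e i) p)"
  proof (rule lin_sum[OF W Q _ e10 _ p])
    show "smooth_fun W (\<lambda>q. g q (X q) (conj_vec (e i q)))" if "i \<in> {1..n}" for i
      using g_smooth[OF W field10_field[OF X] field_on_conj[OF ef[OF that]]] by (simp add: conj_field_def)
  qed simp
  finally show ?thesis .
qed

text \<open>Differentiate the constant function g(e_i, conj(e_m)) along V; the second factor
  contributes the conjugate of a derivative along conj V.\<close>

lemma frame_connection_antihermitian:
  assumes V: "field_on W V" and p: "p \<in> W" and i: "i \<in> {1..n}" and m: "m \<in> {1..n}"
  shows "g p (nabla V (e i) p) (conj_vec (e m p)) = - cnj (g p (nabla (conj_field V) (e m) p) (conj_vec (e i p)))"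
proof -
  note pT = mem_topspace[OF W p]
  let ?d = "nabla (conj_field V) (e m) p"
  note d = field_onD[OF nabla_field[OF W field_on_conj[OF V] ef[OF m]] p] and t = unitary_frame_tangent[OF F p]
  have "V p (\<lambda>q. g q (e i q) (conj_field (e m) q)) = V p (\<lambda>q. if i = m then 1 else 0)"
    by (rule tangent_cong[OF field_onD[OF V p] W p]) (use F i m in \<open>simp add: unitary_frame_def conj_field_def\<close>)
  then have "g p (nabla V (e i) p) (conj_field (e m) p) + g p (e i p) (nabla V (conj_field (e m)) p) = 0"
    using nabla_metric[OF W V ef[OF i] field_on_conj[OF ef[OF m]] p] tangent_const[OF field_onD[OF V p]] by simp
  moreover have "g p (e i p) (conj_vec ?d) = cnj (g p ?d (conj_vec (e i p)))"
    using g_conj_left[OF pT d t(4)[OF i]] g_sym[OF pT t(4)[OF i] tangent_space_conj[OF d]] by simp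
  ultimately show ?thesis
    using nabla_conj[OF W V ef[OF m] p] by (simp add: conj_field_def add_eq_0_iff2)
qed

text \<open>Expanded in the frame, the two terms carry the connection matrices G of V and H of conj
  V, and G is minus the conjugate transpose of H. So no connection coefficients survive in the
  derivative of a pairing.\<close>

lemma lin_pairing_cancel:
  assumes P: "lin W P" and Q: "lin W Q" and V: "field_on W V" and p: "p \<in> W"
  shows "(\<Sum>i\<in>{1..n}. P (nabla V (e i)) p * cnj (Q (e i) p) + P (e i) p * cnj (Q (nabla (conj_field V) (e i)) p)) = 0"
proof -
  define G where "G i m = g p (nabla V (e i) p) (conj_vec (e m p))" for i m
  define H where "H i m = g p (nabla (conj_field V) (e i) p) (conj_vec (e m p))" for i m
  have GH: "G i m = - cnj (H m i)" if "i \<in> {1..n}" "m \<in> {1..n}" for i m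
    unfolding G_def H_def by (rule frame_connection_antihermitian[OF V p that])
  have 1: "P (nabla V (e i)) p = (\<Sum>m\<in>{1..n}. G i m * P (e m) p)" if "i \<in> {1..n}" for i
    unfolding G_def by (rule lin_frame[OF P nabla_field10[OF W V e10[OF that]] p])
  have 2: "Q (nabla (conj_field V) (e i)) p = (\<Sum>m\<in>{1..n}. H i m * Q (e m) p)" if "i \<in> {1..n}" for i
    unfolding H_def by (rule lin_frame[OF Q nabla_field10[OF W field_on_conj[OF V] e10[OF that]] p])
  have "(\<Sum>i\<in>{1..n}. P (nabla V (e i)) p * cnj (Q (e i) p)) = (\<Sum>i\<in>{1..n}. \<Sum>m\<in>{1..n}. G i m * P (e m) p * cnj (Q (e i) p))"
    by (rule sum.cong) (simp_all add: 1 sum_distrib_right)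
  also have "\<dots> = (\<Sum>m\<in>{1..n}. \<Sum>i\<in>{1..n}. G i m * P (e m) p * cnj (Q (e i) p))" by (rule sum.swap)
  also have "\<dots> = (\<Sum>m\<in>{1..n}. - (P (e m) p * cnj (Q (nabla (conj_field V) (e m)) p)))"
  proof (rule sum.cong[OF refl])
    fix m assume m: "m \<in> {1..n}"
    have "(\<Sum>i\<in>{1..n}. G i m * P (e m) p * cnj (Q (e i) p)) = (\<Sum>i\<in>{1..n}. - (P (e m) p * (cnj (H m i) * cnj (Q (e i) p))))"
      by (rule sum.cong) (simp_all add: GH[OF _ m])
    then show "(\<Sum>i\<in>{1..n}. G i m * P (e m) p * cnj (Q (e i) p)) = - (P (e m) p * cnj (Q (nabla (conj_field V) (e m)) p))"
      by (simp add: 2[OF m] sum_negf sum_distrib_left)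
  qed
  finally show ?thesis by (simp add: sum.distrib sum_negf)
qed

lemma pairing_smooth:
  assumes P: "trilin W P" and Q: "trilin W Q"
  shows "smooth_fun W (pairing e P Q)"
proof -
  have "smooth_fun W (\<lambda>p. P (e i) (e j) (e k) p * cnj (Q (e i) (e j) (e k) p))"
    if "i \<in> {1..n}" "j \<in> {1..n}" "k \<in> {1..n}" for i j k
    by (rule smooth_fun_mult[OF W trilin_smooth[OF P e10 e10 e10] smooth_fun_cnj[OF W trilin_smooth[OF Q e10 e10 e10]]]; rule that)
  then show ?thesis
    unfolding pairing_def[abs_def] by (intro smooth_fun_sum[OF W]) simp_all
qed

text \<open>The second tensor enters conjugated, and V of a conjugate is the conjugate of conj V;
  hence it is differentiated along conj V. \<open>A1\<close>, \<open>A2\<close>, \<open>A3\<close>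
  collect the connection terms of the three slots, each cancelling by itself.\<close>

lemma pairing_derivative:
  assumes P: "trilin W P" and Q: "trilin W Q" and V: "field_on W V" and p: "p \<in> W"
  shows "V p (pairing e P Q) = pairing e (cov V P) Q p + pairing e P (cov (conj_field V) Q) p"
proof -
  note Vt = field_onD[OF V p] and s = smooth_nearI[OF W p]
  have pT: "p \<in> topspace T" by (rule mem_topspace[OF W p])
  let ?I = "{1..n}"
  let ?c = "conj_field V"
  let ?P = "\<lambda>i j k. P (e i) (e j) (e k)" and ?Q = "\<lambda>i j k. Q (e i) (e j) (e k)"
  define A1 where "A1 i j k = P (nabla V (e i)) (e j) (e k) p * cnj (?Q i j k p) + ?P i j k p * cnj (Q (nabla ?c (e i)) (e j) (e k) p)" for i j k
  define A2 where "A2 i j k = P (e i) (nabla V (e j)) (e k) p * cnj (?Q i j k p) + ?P i j k p * cnj (Q (e i) (nabla ?c (e j)) (e k) p)" for i j k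
  define A3 where "A3 i j k = P (e i) (e j) (nabla V (e k)) p * cnj (?Q i j k p) + ?P i j k p * cnj (Q (e i) (e j) (nabla ?c (e k)) p)" for i j k
  have sm: "smooth_near p (\<lambda>q. ?P i j k q * cnj (?Q i j k q))" if "i \<in> ?I" "j \<in> ?I" "k \<in> ?I" for i j k
    by (rule s, rule smooth_fun_mult[OF W trilin_smooth[OF P e10 e10 e10] smooth_fun_cnj[OF W trilin_smooth[OF Q e10 e10 e10]]]; rule that)
  have expand: "V p (\<lambda>q. ?P i j k q * cnj (?Q i j k q)) =
      cov V P (e i) (e j) (e k) p * cnj (?Q i j k p) + ?P i j k p * cnj (cov ?c Q (e i) (e j) (e k) p)
      + (A1 i j k + A2 i j k + A3 i j k)"
    if i: "i \<in> ?I" and j: "j \<in> ?I" and k: "k \<in> ?I" for i j k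
  proof -
    have sP: "smooth_near p (?P i j k)" and sQ: "smooth_near p (\<lambda>q. cnj (?Q i j k q))"
      using s[OF trilin_smooth[OF P e10[OF i] e10[OF j] e10[OF k]]]
        s[OF smooth_fun_cnj[OF W trilin_smooth[OF Q e10[OF i] e10[OF j] e10[OF k]]]] by auto
    have "V p (\<lambda>q. ?P i j k q * cnj (?Q i j k q)) = ?P i j k p * cnj (?c p (?Q i j k)) + cnj (?Q i j k p) * V p (?P i j k)"
      using tangent_mult[OF Vt sP sQ] by (simp add: conj_field_def conj_vec_def)
    then show ?thesis by (simp add: cov_def A1_def A2_def A3_def algebra_simps)
  qed
  have "V p (pairing e P Q) = (\<Sum>i\<in>?I. \<Sum>j\<in>?I. \<Sum>k\<in>?I. V p (\<lambda>q. ?P i j k q * cnj (?Q i j k q)))"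
  proof -
    have "V p (pairing e P Q) = (\<Sum>i\<in>?I. V p (\<lambda>q. \<Sum>j\<in>?I. \<Sum>k\<in>?I. ?P i j k q * cnj (?Q i j k q)))"
      unfolding pairing_def[abs_def] by (rule tangent_sum[OF Vt]) (intro smooth_near_sum[OF pT] sm)
    also have "\<dots> = (\<Sum>i\<in>?I. \<Sum>j\<in>?I. V p (\<lambda>q. \<Sum>k\<in>?I. ?P i j k q * cnj (?Q i j k q)))"
      by (rule sum.cong[OF refl], rule tangent_sum[OF Vt]) (intro smooth_near_sum[OF pT] sm)
    also have "\<dots> = (\<Sum>i\<in>?I. \<Sum>j\<in>?I. \<Sum>k\<in>?I. V p (\<lambda>q. ?P i j k q * cnj (?Q i j k q)))"
      by (rule sum.cong[OF refl], rule sum.cong[OF refl], rule tangent_sum[OF Vt], rule sm)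
    finally show ?thesis .
  qed
  also have "\<dots> = (\<Sum>i\<in>?I. \<Sum>j\<in>?I. \<Sum>k\<in>?I. cov V P (e i) (e j) (e k) p * cnj (?Q i j k p)
      + ?P i j k p * cnj (cov ?c Q (e i) (e j) (e k) p) + (A1 i j k + A2 i j k + A3 i j k))"
    by (intro sum.cong refl expand)
  also have "\<dots> = pairing e (cov V P) Q p + pairing e P (cov ?c Q) p
      + ((\<Sum>i\<in>?I. \<Sum>j\<in>?I. \<Sum>k\<in>?I. A1 i j k) + (\<Sum>i\<in>?I. \<Sum>j\<in>?I. \<Sum>k\<in>?I. A2 i j k) + (\<Sum>i\<in>?I. \<Sum>j\<in>?I. \<Sum>k\<in>?I. A3 i j k))"
    unfolding pairing_def by (simp add: sum.distrib)
  finally have main: "V p (pairing e P Q) = pairing e (cov V P) Q p + pairing e P (cov ?c Q) p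
      + ((\<Sum>i\<in>?I. \<Sum>j\<in>?I. \<Sum>k\<in>?I. A1 i j k) + (\<Sum>i\<in>?I. \<Sum>j\<in>?I. \<Sum>k\<in>?I. A2 i j k) + (\<Sum>i\<in>?I. \<Sum>j\<in>?I. \<Sum>k\<in>?I. A3 i j k))" .
  have z1: "(\<Sum>i\<in>?I. A1 i j k) = 0" if "j \<in> ?I" "k \<in> ?I" for j k
    unfolding A1_def
    by (rule lin_pairing_cancel[OF trilinD(1)[OF P e10[OF that(1)] e10[OF that(2)]]
          trilinD(1)[OF Q e10[OF that(1)] e10[OF that(2)]] V p])
  have z2: "(\<Sum>j\<in>?I. A2 i j k) = 0" if "i \<in> ?I" "k \<in> ?I" for i k
    unfolding A2_def
    by (rule lin_pairing_cancel[OF trilinD(2)[OF P e10[OF that(1)] e10[OF that(2)]]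
          trilinD(2)[OF Q e10[OF that(1)] e10[OF that(2)]] V p])
  have z3: "(\<Sum>k\<in>?I. A3 i j k) = 0" if "i \<in> ?I" "j \<in> ?I" for i j
    unfolding A3_def
    by (rule lin_pairing_cancel[OF trilinD(3)[OF P e10[OF that(1)] e10[OF that(2)]]
          trilinD(3)[OF Q e10[OF that(1)] e10[OF that(2)]] V p])
  have 1: "(\<Sum>i\<in>?I. \<Sum>j\<in>?I. \<Sum>k\<in>?I. A1 i j k) = 0"
    unfolding sum3_rotate[of A1 ?I ?I ?I] by (intro sum.neutral ballI z1)
  have 2: "(\<Sum>i\<in>?I. \<Sum>j\<in>?I. \<Sum>k\<in>?I. A2 i j k) = (\<Sum>i\<in>?I. \<Sum>k\<in>?I. \<Sum>j\<in>?I. A2 i j k)"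
    by (rule sum.cong[OF refl], rule sum.swap)
  have 3: "(\<Sum>i\<in>?I. \<Sum>k\<in>?I. \<Sum>j\<in>?I. A2 i j k) = 0"
    by (intro sum.neutral ballI z2)
  have 4: "(\<Sum>i\<in>?I. \<Sum>j\<in>?I. \<Sum>k\<in>?I. A3 i j k) = 0"
    by (intro sum.neutral ballI z3)
  show ?thesis unfolding main 1 2 3 4 by simp
qed

lemma pairing_cong:
  assumes "\<And>X Y Z. field10 W X \<Longrightarrow> field10 W Y \<Longrightarrow> field10 W Z \<Longrightarrow> P X Y Z p = P' X Y Z p"
    and "\<And>X Y Z. field10 W X \<Longrightarrow> field10 W Y \<Longrightarrow> field10 W Z \<Longrightarrow> Q X Y Z p = Q' X Y Z p"
  shows "pairing e P Q p = pairing e P' Q' p"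
  unfolding pairing_def by (intro sum.cong refl) (simp add: assms[OF e10 e10 e10])

lemma frame_drift_field: "field_on W (frame_drift e)"
  unfolding frame_drift_def by (intro field_on_sum nabla_field[OF W] ef field_on_conj)

section \<open>Subharmonicity of the squared torsion\<close>

text \<open>For E = e_a, C = conj E and N = nabla_E C, two applications of the Leibniz rule give two
  squares and two terms with second derivatives of T. Parallelism reduces nabla_E nabla_C T to
  nabla_N T; commuting reduces nabla_C nabla_E T to the derivative of T along conj N plus
  \<open>ric\<close>. Paired with T, the two first order terms are the derivative of |T|^2 along N,
  which the drift removes.\<close>

theorem bochner:
  assumes par: "parallel_curvature20 nabla" and p: "p \<in> W"
  shows "frame_operator e (frame_drift e) (pairing e tor tor) p =
    (\<Sum>a\<in>{1..n}. pairing e (cov (conj_field (e a)) tor) (cov (conj_field (e a)) tor) p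
      + pairing e (cov (e a) tor) (cov (e a) tor) p + pairing e tor (ric (e a)) p)"
proof -
  let ?F = "pairing e tor tor"
  note T = trilin_tor[OF W]
  have "e a p (\<lambda>r. conj_field (e a) r ?F) - nabla (e a) (conj_field (e a)) p ?F =
      pairing e (cov (conj_field (e a)) tor) (cov (conj_field (e a)) tor) p
      + pairing e (cov (e a) tor) (cov (e a) tor) p + pairing e tor (ric (e a)) p"
    if a: "a \<in> {1..n}" for a
  proof -
    define E C where "E = e a" and "C = conj_field (e a)"
    have E10: "field10 W E" and Ef: "field_on W E" and Cf: "field_on W C" and cE: "conj_field E = C" and cC: "conj_field C = E"
      using e10[OF a] ef[OF a] field_on_conj[OF ef[OF a]] by (simp_all add: E_def C_def)
    define N where "N = nabla E C"
    have Nf: "field_on W N" unfolding N_def by (rule nabla_field[OF W Ef Cf])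
    note tE = trilin_cov[OF W T Ef] and tC = trilin_cov[OF W T Cf] and Et = field_onD[OF Ef p]
    note s = smooth_nearI[OF W p]
    have Cq: "C q ?F = pairing e (cov C tor) tor q + pairing e tor (cov E tor) q" if "q \<in> W" for q
      using pairing_derivative[OF T T Cf that] by (simp add: cC)
    have "E p (\<lambda>r. C r ?F) = E p (\<lambda>q. pairing e (cov C tor) tor q + pairing e tor (cov E tor) q)"
      by (rule tangent_cong[OF Et W p]) (rule Cq)
    moreover have "E p (\<lambda>q. pairing e (cov C tor) tor q + pairing e tor (cov E tor) q) =
        E p (pairing e (cov C tor) tor) + E p (pairing e tor (cov E tor))"
      by (rule tangent_add[OF Et s[OF pairing_smooth[OF tC T]] s[OF pairing_smooth[OF T tE]]])
    moreover have "E p (pairing e (cov C tor) tor) = pairing e (cov E (cov C tor)) tor p + pairing e (cov C tor) (cov C tor) p"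
      using pairing_derivative[OF tC T Ef p] unfolding cE .
    moreover have "E p (pairing e tor (cov E tor)) = pairing e (cov E tor) (cov E tor) p + pairing e tor (cov C (cov E tor)) p"
      using pairing_derivative[OF T tE Ef p] unfolding cE .
    ultimately have 0: "E p (\<lambda>r. C r ?F) = pairing e (cov E (cov C tor)) tor p + pairing e (cov C tor) (cov C tor) p
        + (pairing e (cov E tor) (cov E tor) p + pairing e tor (cov C (cov E tor)) p)" by (simp only:)
    have par': "cov E (cov C tor) X Y Z p = cov N tor X Y Z p"
      if "field10 W X" "field10 W Y" "field10 W Z" for X Y Z
      using parallel_tor[OF W par Ef E10 that p] by (simp add: cE N_def)
    have "pairing e (cov E (cov C tor)) tor p = pairing e (cov N tor) tor p"
      by (rule pairing_cong) (rule par', assumption+, rule refl)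
    with 0 have 1: "E p (\<lambda>r. C r ?F) = pairing e (cov N tor) tor p + pairing e (cov C tor) (cov C tor) p
        + (pairing e (cov E tor) (cov E tor) p + pairing e tor (cov C (cov E tor)) p)" by (simp only:)
    \<comment> \<open>N - [E,C] = nabla_C E because the mixed torsion vanishes, and nabla_C E is the
      conjugate of nabla_E C.\<close>
    have Nd: "(N - bracket E C) q = conj_field N q" if "q \<in> W" for q
    proof -
      have "torsion nabla E C q = 0" using torsion_mixed[OF W E10 E10 that] by (simp add: cE)
      then have "N q - bracket E C q = nabla C E q" by (simp add: torsion_eq[OF W] N_def algebra_simps)
      moreover have "N q = conj_vec (nabla C E q)" using nabla_conj[OF W Ef Ef that] by (simp add: cE N_def)
      ultimately show ?thesis by (simp add: conj_field_def)
    qed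
    have bf: "field_on W (bracket E C)" by (rule field_on_bracket[OF W Ef Cf])
    have comm: "cov C (cov E tor) X Y Z p = cov (conj_field N) tor X Y Z p + ric E X Y Z p"
      if XYZ: "field10 W X" "field10 W Y" "field10 W Z" for X Y Z
    proof -
      have c1: "cov C (cov E tor) X Y Z p = cov N tor X Y Z p - cov (bracket E C) tor X Y Z p + ric E X Y Z p"
        using ricci_identity[OF W T Ef Cf XYZ p] par'[OF XYZ] by (simp add: ric_def cE algebra_simps)
      have c2: "cov N tor X Y Z p - cov (bracket E C) tor X Y Z p = cov (N - bracket E C) tor X Y Z p"
        by (rule cov_diff_direction[OF W T Nf bf XYZ p, symmetric])
      have c3: "cov (N - bracket E C) tor X Y Z p = cov (conj_field N) tor X Y Z p"
        by (rule cov_cong_direction[OF W T field_on_diff[OF W Nf bf] Nd XYZ p])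
      show ?thesis unfolding c1 c2 c3 ..
    qed
    have p1: "pairing e tor (cov C (cov E tor)) p = pairing e tor (\<lambda>X Y Z p. cov (conj_field N) tor X Y Z p + ric E X Y Z p) p"
      by (rule pairing_cong) (rule refl, rule comm)
    have 2: "pairing e tor (cov C (cov E tor)) p = pairing e tor (cov (conj_field N) tor) p + pairing e tor (ric E) p"
      unfolding p1 unfolding pairing_def complex_cnj_add distrib_left sum.distrib ..
    have 3: "N p ?F = pairing e (cov N tor) tor p + pairing e tor (cov (conj_field N) tor) p"
      by (rule pairing_derivative[OF T T Nf p])
    show ?thesis
      unfolding E_def[symmetric] cE N_def[symmetric] 1 2 3 by simp
  qed
  then show ?thesis
    unfolding frame_operator_def frame_drift_def sum_tvec_apply sum_subtractf[symmetric] by (rule sum.cong[OF refl])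
qed

text \<open>The sum over a of R(e_a, conj(e_a)) is the matrix of R''. It stands under a conjugation
  here, so the whole sum is conjugated first, which leaves its real part unchanged and puts
  conjugates of the components of Q into the Hermitian form.\<close>

lemma ricci_slot:
  assumes Q: "lin W Q" and p: "p \<in> W"
  shows "Re (\<Sum>a\<in>{1..n}. \<Sum>i\<in>{1..n}. Q (e i) p * cnj (Q (curvature_op nabla (e a) (conj_field (e a)) (e i)) p)) =
    second_ricci_form nabla e (\<lambda>i. cnj (Q (e i) p)) p"
proof -
  let ?I = "{1..n}"
  define G where "G a i m = g p (curvature_op nabla (e a) (conj_field (e a)) (e i) p) (conj_vec (e m p))" for a i m
  have R: "Q (curvature_op nabla (e a) (conj_field (e a)) (e i)) p = (\<Sum>m\<in>?I. G a i m * Q (e m) p)"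
    if "a \<in> ?I" "i \<in> ?I" for a i
    unfolding G_def
    by (rule lin_frame[OF Q curvature_op_field10[OF W ef[OF that(1)] field_on_conj[OF ef[OF that(1)]] e10[OF that(2)]] p])
  have S: "second_ricci nabla e i m p = (\<Sum>a\<in>?I. G a i m)" for i m
    by (simp add: second_ricci_def curvature_def G_def conj_field_def)
  have "cnj (\<Sum>a\<in>?I. \<Sum>i\<in>?I. Q (e i) p * cnj (Q (curvature_op nabla (e a) (conj_field (e a)) (e i)) p)) =
      (\<Sum>a\<in>?I. \<Sum>i\<in>?I. \<Sum>m\<in>?I. G a i m * cnj (Q (e i) p) * Q (e m) p)"
    by (simp add: R sum_distrib_left mult_ac)
  also have "\<dots> = (\<Sum>i\<in>?I. \<Sum>m\<in>?I. \<Sum>a\<in>?I. G a i m * cnj (Q (e i) p) * Q (e m) p)" by (rule sum3_rotate)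
  also have "\<dots> = (\<Sum>i\<in>?I. \<Sum>m\<in>?I. second_ricci nabla e i m p * cnj (Q (e i) p) * cnj (cnj (Q (e m) p)))"
    by (simp add: S sum_distrib_right)
  finally have c: "cnj (\<Sum>a\<in>?I. \<Sum>i\<in>?I. Q (e i) p * cnj (Q (curvature_op nabla (e a) (conj_field (e a)) (e i)) p)) =
      (\<Sum>i\<in>?I. \<Sum>m\<in>?I. second_ricci nabla e i m p * cnj (Q (e i) p) * cnj (cnj (Q (e m) p)))" .
  show ?thesis unfolding second_ricci_form_def c[symmetric] by (rule cnj.simps(1)[symmetric])
qed

lemma ricci_term:
  assumes p: "p \<in> W"
  shows "Re (\<Sum>a\<in>{1..n}. pairing e tor (ric (e a)) p) =
    (\<Sum>j\<in>{1..n}. \<Sum>k\<in>{1..n}. second_ricci_form nabla e (\<lambda>i. cnj (tor (e i) (e j) (e k) p)) p)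
    + (\<Sum>i\<in>{1..n}. \<Sum>k\<in>{1..n}. second_ricci_form nabla e (\<lambda>j. cnj (tor (e i) (e j) (e k) p)) p)
    + (\<Sum>i\<in>{1..n}. \<Sum>j\<in>{1..n}. second_ricci_form nabla e (\<lambda>k. cnj (tor (e i) (e j) (e k) p)) p)"
proof -
  let ?I = "{1..n}"
  note T = trilin_tor[OF W]
  define R where "R a X = curvature_op nabla (e a) (conj_field (e a)) X" for a X
  let ?t = "\<lambda>i j k. tor (e i) (e j) (e k) p"
  have s1: "Re (\<Sum>a\<in>?I. \<Sum>i\<in>?I. ?t i j k * cnj (tor (R a (e i)) (e j) (e k) p)) =
      second_ricci_form nabla e (\<lambda>i. cnj (?t i j k)) p" if "j \<in> ?I" "k \<in> ?I" for j k
    unfolding R_def by (rule ricci_slot[OF trilinD(1)[OF T e10[OF that(1)] e10[OF that(2)]] p])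
  have s2: "Re (\<Sum>a\<in>?I. \<Sum>j\<in>?I. ?t i j k * cnj (tor (e i) (R a (e j)) (e k) p)) =
      second_ricci_form nabla e (\<lambda>j. cnj (?t i j k)) p" if "i \<in> ?I" "k \<in> ?I" for i k
    unfolding R_def by (rule ricci_slot[OF trilinD(2)[OF T e10[OF that(1)] e10[OF that(2)]] p])
  have s3: "Re (\<Sum>a\<in>?I. \<Sum>k\<in>?I. ?t i j k * cnj (tor (e i) (e j) (R a (e k)) p)) =
      second_ricci_form nabla e (\<lambda>k. cnj (?t i j k)) p" if "i \<in> ?I" "j \<in> ?I" for i j
    unfolding R_def by (rule ricci_slot[OF trilinD(3)[OF T e10[OF that(1)] e10[OF that(2)]] p])
  let ?A1 = "\<lambda>a i j k. ?t i j k * cnj (tor (R a (e i)) (e j) (e k) p)"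
  let ?A2 = "\<lambda>a i j k. ?t i j k * cnj (tor (e i) (R a (e j)) (e k) p)"
  let ?A3 = "\<lambda>a i j k. ?t i j k * cnj (tor (e i) (e j) (R a (e k)) p)"
  have total: "(\<Sum>a\<in>?I. pairing e tor (ric (e a)) p) = (\<Sum>a\<in>?I. \<Sum>i\<in>?I. \<Sum>j\<in>?I. \<Sum>k\<in>?I. ?A1 a i j k)
      + (\<Sum>a\<in>?I. \<Sum>i\<in>?I. \<Sum>j\<in>?I. \<Sum>k\<in>?I. ?A2 a i j k) + (\<Sum>a\<in>?I. \<Sum>i\<in>?I. \<Sum>j\<in>?I. \<Sum>k\<in>?I. ?A3 a i j k)"
    by (simp add: pairing_def ric_def R_def distrib_left sum.distrib)
  have 1: "(\<Sum>a\<in>?I. \<Sum>i\<in>?I. \<Sum>j\<in>?I. \<Sum>k\<in>?I. ?A1 a i j k) = (\<Sum>j\<in>?I. \<Sum>k\<in>?I. \<Sum>a\<in>?I. \<Sum>i\<in>?I. ?A1 a i j k)"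
    by (rule trans[OF sum.cong[OF refl sum3_rotate] sum3_rotate])
  have 2: "(\<Sum>a\<in>?I. \<Sum>i\<in>?I. \<Sum>j\<in>?I. \<Sum>k\<in>?I. ?A2 a i j k) = (\<Sum>i\<in>?I. \<Sum>k\<in>?I. \<Sum>a\<in>?I. \<Sum>j\<in>?I. ?A2 a i j k)"
    by (rule trans[OF sum.cong[OF refl sum.cong[OF refl sum.swap]] sum3_rotate])
  have 3: "(\<Sum>a\<in>?I. \<Sum>i\<in>?I. \<Sum>j\<in>?I. \<Sum>k\<in>?I. ?A3 a i j k) = (\<Sum>i\<in>?I. \<Sum>j\<in>?I. \<Sum>a\<in>?I. \<Sum>k\<in>?I. ?A3 a i j k)"
    by (rule sum3_rotate)
  have R2: "Re (\<Sum>x\<in>?I. \<Sum>y\<in>?I. f x y) = (\<Sum>x\<in>?I. \<Sum>y\<in>?I. h x y)"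
    if "\<And>x y. x \<in> ?I \<Longrightarrow> y \<in> ?I \<Longrightarrow> Re (f x y) = h x y" for f h
    unfolding Re_sum by (intro sum.cong refl that)
  have r1: "Re (\<Sum>j\<in>?I. \<Sum>k\<in>?I. \<Sum>a\<in>?I. \<Sum>i\<in>?I. ?A1 a i j k) =
      (\<Sum>j\<in>?I. \<Sum>k\<in>?I. second_ricci_form nabla e (\<lambda>i. cnj (?t i j k)) p)"
    by (rule R2) (rule s1)
  have r2: "Re (\<Sum>i\<in>?I. \<Sum>k\<in>?I. \<Sum>a\<in>?I. \<Sum>j\<in>?I. ?A2 a i j k) =
      (\<Sum>i\<in>?I. \<Sum>k\<in>?I. second_ricci_form nabla e (\<lambda>j. cnj (?t i j k)) p)"
    by (rule R2) (rule s2)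
  have r3: "Re (\<Sum>i\<in>?I. \<Sum>j\<in>?I. \<Sum>a\<in>?I. \<Sum>k\<in>?I. ?A3 a i j k) =
      (\<Sum>i\<in>?I. \<Sum>j\<in>?I. second_ricci_form nabla e (\<lambda>k. cnj (?t i j k)) p)"
    by (rule R2) (rule s3)
  show ?thesis
    unfolding total 1 2 3 plus_complex.sel r1 r2 r3 ..
qed

text \<open>All gradient terms and all Ricci terms are nonnegative. The first bound retains the
  Ricci terms of the first slot of T; where the operator vanishes and R'' is definite, they force T
  = 0.\<close>

lemma frame_operator_nonneg:
  assumes par: "parallel_curvature20 nabla" and p: "p \<in> W"
    and semi: "second_ricci_semidefinite_at nabla p"
  shows "(\<Sum>j\<in>{1..n}. \<Sum>k\<in>{1..n}. second_ricci_form nabla e (\<lambda>i. cnj (tor (e i) (e j) (e k) p)) p)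
      \<le> Re (frame_operator e (frame_drift e) (pairing e tor tor) p)"
    and "0 \<le> Re (frame_operator e (frame_drift e) (pairing e tor tor) p)"
proof -
  let ?I = "{1..n}"
  have r: "0 \<le> second_ricci_form nabla e \<xi> p" for \<xi>
    using semi F p unfolding second_ricci_semidefinite_at_def by blast
  have nn: "0 \<le> (\<Sum>j\<in>?I. \<Sum>k\<in>?I. second_ricci_form nabla e (\<xi> j k) p)" for \<xi>
    by (intro sum_nonneg r)
  have "0 \<le> (\<Sum>a\<in>?I. Re (pairing e (cov (conj_field (e a)) tor) (cov (conj_field (e a)) tor) p))"
    "0 \<le> (\<Sum>a\<in>?I. Re (pairing e (cov (e a) tor) (cov (e a) tor) p))"
    by (intro sum_nonneg pairing_self_nonneg)+
  then have "Re (\<Sum>a\<in>?I. pairing e tor (ric (e a)) p) \<le> Re (frame_operator e (frame_drift e) (pairing e tor tor) p)"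
    unfolding bochner[OF par p] by (simp add: sum.distrib Re_sum)
  then show 1: "(\<Sum>j\<in>?I. \<Sum>k\<in>?I. second_ricci_form nabla e (\<lambda>i. cnj (tor (e i) (e j) (e k) p)) p)
      \<le> Re (frame_operator e (frame_drift e) (pairing e tor tor) p)"
    unfolding ricci_term[OF p]
    using nn[of "\<lambda>i k j. cnj (tor (e i) (e j) (e k) p)"] nn[of "\<lambda>i j k. cnj (tor (e i) (e j) (e k) p)"] by linarith
  show "0 \<le> Re (frame_operator e (frame_drift e) (pairing e tor tor) p)"
    using 1 nn[of "\<lambda>j k i. cnj (tor (e i) (e j) (e k) p)"] by linarith
qed

end

section \<open>The squared torsion as a global function, and its vanishing\<close>

text \<open>The matrix U of the change of frame is unitary: expanding a vector of e' in e and
  pairing it with another vector of e' gives the Kronecker delta.\<close>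

lemma parseval:
  assumes F: "unitary_frame W e" and F': "unitary_frame W e'" and Q: "lin W Q" and p: "p \<in> W"
  shows "(\<Sum>i\<in>{1..n}. Q (e i) p * cnj (Q (e i) p)) = (\<Sum>i\<in>{1..n}. Q (e' i) p * cnj (Q (e' i) p))"
proof -
  let ?I = "{1..n}"
  note W = unitary_frame_open[OF F]
  note pT = mem_topspace[OF W p] and t = unitary_frame_tangent[OF F p] and t' = unitary_frame_tangent[OF F' p]
  define U where "U i m = g p (e i p) (conj_vec (e' m p))" for i m
  have Qe: "Q (e i) p = (\<Sum>m\<in>?I. U i m * Q (e' m) p)" if "i \<in> ?I" for i
    unfolding U_def by (rule lin_frame[OF F' Q unitary_frame_field10[OF F that] p])
  have unit: "(\<Sum>i\<in>?I. U i m * cnj (U i l)) = (if l = m then 1 else 0)" if m: "m \<in> ?I" and l: "l \<in> ?I" for m l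
  proof -
    have c: "cnj (U i l) = g p (e' l p) (conj_vec (e i p))" if i: "i \<in> ?I" for i
      using g_conj_left[OF pT t(4)[OF i] t'(4)[OF l]] g_sym[OF pT t'(4)[OF l] t(5)[OF i]] by (simp add: U_def)
    have "(if l = m then 1 else 0) = g p (e' l p) (conj_vec (e' m p))"
      using F' p l m by (simp add: unitary_frame_def)
    also have "\<dots> = g p (\<Sum>i\<in>?I. g p (e' l p) (conj_vec (e i p)) \<odot> e i p) (conj_vec (e' m p))"
      using frame_expansion10[OF F p t'(2)[OF l]] by (rule arg_cong)
    also have "\<dots> = (\<Sum>i\<in>?I. g p (e' l p) (conj_vec (e i p)) * U i m)"
      unfolding U_def by (rule g_lin[OF pT t(4) t'(5)[OF m]])
    also have "\<dots> = (\<Sum>i\<in>?I. U i m * cnj (U i l))" by (rule sum.cong) (simp_all add: c mult.commute)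
    finally show ?thesis by (rule sym)
  qed
  have "(\<Sum>i\<in>?I. Q (e i) p * cnj (Q (e i) p)) =
      (\<Sum>i\<in>?I. \<Sum>m\<in>?I. \<Sum>l\<in>?I. U i m * cnj (U i l) * (Q (e' m) p * cnj (Q (e' l) p)))"
    by (rule sum.cong) (simp_all add: Qe sum_product mult_ac)
  also have "\<dots> = (\<Sum>m\<in>?I. \<Sum>l\<in>?I. \<Sum>i\<in>?I. U i m * cnj (U i l) * (Q (e' m) p * cnj (Q (e' l) p)))"
    by (rule sum3_rotate)
  also have "\<dots> = (\<Sum>m\<in>?I. \<Sum>l\<in>?I. (if l = m then 1 else 0) * (Q (e' m) p * cnj (Q (e' l) p)))"
    by (rule sum.cong[OF refl], rule sum.cong[OF refl]) (simp only: unit sum_distrib_right[symmetric])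
  also have "\<dots> = (\<Sum>m\<in>?I. Q (e' m) p * cnj (Q (e' m) p))"
    by (rule sum.cong) (simp_all add: if_distrib[of "\<lambda>x. x * _"] cong: if_cong)
  finally show ?thesis .
qed

text \<open>The frame is exchanged one slot at a time, with the sum over that slot moved innermost
  so that \<open>parseval\<close> applies to it.\<close>

lemma pairing_frame_independent:
  assumes F: "unitary_frame W e" and F': "unitary_frame W' e'" and p: "p \<in> W" "p \<in> W'"
  shows "pairing e tor tor p = pairing e' tor tor p"
proof -
  let ?I = "{1..n}"
  define V where "V = W \<inter> W'"
  have V: "openin T V" "V \<subseteq> W" "V \<subseteq> W'" "p \<in> V"
    using unitary_frame_open[OF F] unitary_frame_open[OF F'] p by (auto simp: V_def)
  have G: "unitary_frame V e" and G': "unitary_frame V e'"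
    using unitary_frame_subset[OF F V(1,2)] unitary_frame_subset[OF F' V(1,3)] by blast+
  note T = trilin_tor[OF V(1)] and e10 = unitary_frame_field10[OF G] and e10' = unitary_frame_field10[OF G']
  let ?N = "\<lambda>X Y Z. tor X Y Z p * cnj (tor X Y Z p)"
  have "pairing e tor tor p = (\<Sum>i\<in>?I. \<Sum>j\<in>?I. \<Sum>k\<in>?I. ?N (e i) (e j) (e' k))"
    unfolding pairing_def
    by (rule sum.cong[OF refl], rule sum.cong[OF refl], rule parseval[OF G G' trilinD(3)[OF T e10 e10] V(4)])
  also have "\<dots> = (\<Sum>i\<in>?I. \<Sum>k\<in>?I. \<Sum>j\<in>?I. ?N (e i) (e j) (e' k))"
    by (rule sum.cong[OF refl], rule sum.swap)
  also have "\<dots> = (\<Sum>i\<in>?I. \<Sum>k\<in>?I. \<Sum>j\<in>?I. ?N (e i) (e' j) (e' k))"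
    by (rule sum.cong[OF refl], rule sum.cong[OF refl], rule parseval[OF G G' trilinD(2)[OF T e10 e10'] V(4)])
  also have "\<dots> = (\<Sum>k\<in>?I. \<Sum>j\<in>?I. \<Sum>i\<in>?I. ?N (e i) (e' j) (e' k))"
    by (rule sum3_rotate)
  also have "\<dots> = (\<Sum>k\<in>?I. \<Sum>j\<in>?I. \<Sum>i\<in>?I. ?N (e' i) (e' j) (e' k))"
    by (rule sum.cong[OF refl], rule sum.cong[OF refl], rule parseval[OF G G' trilinD(1)[OF T e10' e10'] V(4)])
  also have "\<dots> = (\<Sum>i\<in>?I. \<Sum>k\<in>?I. \<Sum>j\<in>?I. ?N (e' i) (e' j) (e' k))"
    by (rule sum3_rotate[symmetric])
  also have "\<dots> = pairing e' tor tor p"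
    unfolding pairing_def by (rule sum.cong[OF refl], rule sum.swap)
  finally show ?thesis .
qed

text \<open>|T|^2 without reference to a frame. The maximum principle is about one function on the
  whole manifold, whereas frames are local, so a frame is chosen at each point separately; its
  choice does not affect the value.\<close>

definition tor_norm_sq :: "'a \<Rightarrow> complex" where
  "tor_norm_sq p = pairing (SOME e. \<exists>W. p \<in> W \<and> unitary_frame W e) tor tor p"

lemma tor_norm_sq_frame:
  assumes "unitary_frame W e" "p \<in> W"
  shows "tor_norm_sq p = pairing e tor tor p"
proof -
  have "\<exists>e W. p \<in> W \<and> unitary_frame W e" using assms by blast
  then obtain W' where "p \<in> W'" "unitary_frame W' (SOME e. \<exists>W. p \<in> W \<and> unitary_frame W e)"
    using someI_ex[of "\<lambda>e. \<exists>W. p \<in> W \<and> unitary_frame W e"] by blast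
  then show ?thesis unfolding tor_norm_sq_def using pairing_frame_independent assms by blast
qed

text \<open>|T|^2 is constant by the maximum principle, so the operator annihilates it at the point
  p where R'' is definite. The bound by the Ricci terms then makes T vanish at p, and the constant
  is 0.\<close>

lemma tor_norm_sq_zero:
  assumes conn: "connected_space T" and comp: "compact_space T"
    and par: "parallel_curvature20 nabla" and pos: "second_ricci_quasi_positive nabla"
    and q: "q \<in> topspace T"
  shows "tor_norm_sq q = 0"
proof -
  let ?I = "{1..n}"
  have semi: "second_ricci_semidefinite_at nabla p" if "p \<in> topspace T" for p
    using pos that by (simp add: second_ricci_quasi_positive_def)
  obtain p where p: "p \<in> topspace T" "second_ricci_definite_at nabla p"
    using pos by (auto simp: second_ricci_quasi_positive_def)
  have const: "tor_norm_sq r = tor_norm_sq p" if "r \<in> topspace T" for r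
  proof (rule strong_maximum_principle[OF conn comp _ _ that p(1)])
    fix r assume r: "r \<in> topspace T"
    obtain W e where We: "r \<in> W" "unitary_frame W e" using unitary_frame_exists[OF r] by blast
    show "Im (tor_norm_sq r) = 0" unfolding tor_norm_sq_frame[OF We(2,1)] pairing_self by (rule Im_complex_of_real)
    note W = unitary_frame_open[OF We(2)]
    have "smooth_fun W tor_norm_sq"
      using smooth_fun_cong[OF W, of tor_norm_sq "pairing e tor tor"] tor_norm_sq_frame[OF We(2)]
        pairing_smooth[OF We(2) trilin_tor[OF W] trilin_tor[OF W]] by simp
    moreover have "0 \<le> Re (frame_operator e (frame_drift e) tor_norm_sq s)" if "s \<in> W" for s
      using frame_operator_nonneg(2)[OF We(2) par that semi[OF mem_topspace[OF W that]]]
        frame_operator_cong[OF We(2) frame_drift_field[OF We(2)] that tor_norm_sq_frame[OF We(2)]] by simp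
    ultimately show "\<exists>W e B. r \<in> W \<and> unitary_frame W e \<and> field_on W B \<and> smooth_fun W tor_norm_sq \<and>
        (\<forall>q\<in>W. 0 \<le> Re (frame_operator e B tor_norm_sq q))"
      using We frame_drift_field[OF We(2)] by blast
  qed
  obtain W e where We: "p \<in> W" "unitary_frame W e" using unitary_frame_exists[OF p(1)] by blast
  note W = unitary_frame_open[OF We(2)]
  have "frame_operator e (frame_drift e) (pairing e tor tor) p = frame_operator e (frame_drift e) (\<lambda>r. tor_norm_sq p) p"
  proof (rule frame_operator_cong[OF We(2) frame_drift_field[OF We(2)] We(1)])
    show "pairing e tor tor r = tor_norm_sq p" if "r \<in> W" for r
      using tor_norm_sq_frame[OF We(2) that] const[OF mem_topspace[OF W that]] by simp
  qed
  also have "\<dots> = 0"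
  proof -
    have z: "X r (\<lambda>q. c) = 0" if "field_on W X" "r \<in> W" for X r c
      using tangent_const[OF field_onD[OF that]] .
    have "e a p (\<lambda>r. conj_field (e a) r (\<lambda>r. tor_norm_sq p)) = 0" if a: "a \<in> ?I" for a
    proof -
      note f = field10_field[OF unitary_frame_field10[OF We(2) a]]
      have "e a p (\<lambda>r. conj_field (e a) r (\<lambda>r. tor_norm_sq p)) = e a p (\<lambda>r. 0)"
        by (rule tangent_cong[OF field_onD[OF f We(1)] W We(1)]) (rule z[OF field_on_conj[OF f]])
      then show ?thesis using z[OF f We(1)] by simp
    qed
    then show ?thesis using z[OF frame_drift_field[OF We(2)] We(1)] by (simp add: frame_operator_def)
  qed
  \<comment> \<open>The sum is nonnegative term by term as well, so every form in it is zero. By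
    definiteness the vectors with components conj T(e_i, e_j, e_k), indexed by i, vanish for all j
    and k.\<close>
  finally have sum0: "(\<Sum>j\<in>?I. \<Sum>k\<in>?I. second_ricci_form nabla e (\<lambda>i. cnj (tor (e i) (e j) (e k) p)) p) \<le> 0"
    using frame_operator_nonneg(1)[OF We(2) par We(1) semi[OF p(1)]] by simp
  have nn: "0 \<le> second_ricci_form nabla e \<xi> p" for \<xi>
    using semi[OF p(1)] We unfolding second_ricci_semidefinite_at_def by blast
  have t0: "tor (e i) (e j) (e k) p = 0" if ijk: "i \<in> ?I" "j \<in> ?I" "k \<in> ?I" for i j k
  proof (rule ccontr)
    assume nz: "tor (e i) (e j) (e k) p \<noteq> 0"
    have "\<exists>i\<in>?I. cnj (tor (e i) (e j) (e k) p) \<noteq> 0"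
      by (rule bexI[OF _ ijk(1)]) (simp add: nz)
    then have "0 < second_ricci_form nabla e (\<lambda>i. cnj (tor (e i) (e j) (e k) p)) p"
      using p(2)[unfolded second_ricci_definite_at_def, rule_format, of W e "\<lambda>i. cnj (tor (e i) (e j) (e k) p)"] We
      by (simp only: simp_thms)
    then have "0 < (\<Sum>k\<in>?I. second_ricci_form nabla e (\<lambda>i. cnj (tor (e i) (e j) (e k) p)) p)"
      by (rule sum_pos2[OF finite_atLeastAtMost ijk(3)]) (rule nn)
    then have "0 < (\<Sum>j\<in>?I. \<Sum>k\<in>?I. second_ricci_form nabla e (\<lambda>i. cnj (tor (e i) (e j) (e k) p)) p)"
      by (rule sum_pos2[OF finite_atLeastAtMost ijk(2)]) (intro sum_nonneg nn)
    then show False using sum0 by simp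
  qed
  have "tor_norm_sq p = 0"
    unfolding tor_norm_sq_frame[OF We(2,1)] pairing_def using t0 by simp
  then show ?thesis using const[OF q] by simp
qed

lemma torsion_zero10:
  assumes zero: "\<forall>q\<in>topspace T. tor_norm_sq q = 0"
    and W: "openin T W" and X: "field10 W X" and Y: "field10 W Y" and p: "p \<in> W"
  shows "torsion nabla X Y p = 0"
proof -
  let ?I = "{1..n}"
  have pT: "p \<in> topspace T" by (rule mem_topspace[OF W p])
  obtain W0 e where We: "p \<in> W0" "unitary_frame W0 e" using unitary_frame_exists[OF pT] by blast
  define V where "V = W \<inter> W0"
  have V: "openin T V" "V \<subseteq> W" "V \<subseteq> W0" "p \<in> V" using W unitary_frame_open[OF We(2)] p We(1) by (auto simp: V_def)
  have F: "unitary_frame V e" by (rule unitary_frame_subset[OF We(2) V(1,3)])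
  note T = trilin_tor[OF V(1)] and e10 = unitary_frame_field10[OF F]
  have XV: "field10 V X" and YV: "field10 V Y" using field10_subset X Y V(2) by blast+
  have "(\<Sum>i\<in>?I. \<Sum>j\<in>?I. \<Sum>k\<in>?I. (cmod (tor (e i) (e j) (e k) p))\<^sup>2) = 0"
    using bspec[OF zero pT] unfolding tor_norm_sq_frame[OF F V(4)] pairing_self of_real_eq_0_iff .
  then have t0: "tor (e i) (e j) (e k) p = 0" if "i \<in> ?I" "j \<in> ?I" "k \<in> ?I" for i j k
    using that by (simp add: sum_nonneg_eq_0_iff sum_nonneg)
  show ?thesis
  proof (rule T01_zeroI[OF F V(4) torsion_T01[OF W X Y p]])
    fix k assume k: "k \<in> ?I"
    have "tor X (e j) (e k) p = 0" if j: "j \<in> ?I" for j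
      using lin_frame[OF F trilinD(1)[OF T e10[OF j] e10[OF k]] XV V(4)] t0[OF _ j k] by simp
    then have "tor X Y (e k) p = 0"
      using lin_frame[OF F trilinD(2)[OF T XV e10[OF k]] YV V(4)] by simp
    then show "g p (torsion nabla X Y p) (e k p) = 0" by (simp add: tor_def)
  qed
qed

text \<open>Splitting both arguments by type leaves three cases: (1,0) with (1,0) is settled by T =
  0, (0,1) with (0,1) is its conjugate, and mixed pairs vanish for the canonical connection.\<close>

lemma torsion_zero:
  assumes zero: "\<forall>q\<in>topspace T. tor_norm_sq q = 0"
    and W: "openin T W" and X: "field_on W X" and Y: "field_on W Y" and p: "p \<in> W"
  shows "torsion nabla X Y p = 0"
proof -
  define X0 X1 Y0 Y1 where "X0 = part10 X" and "X1 = conj_field (part01 X)"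
    and "Y0 = part10 Y" and "Y1 = conj_field (part01 Y)"
  have X01: "field10 W X0" "field10 W X1" and Y01: "field10 W Y0" "field10 W Y1"
    unfolding X0_def X1_def Y0_def Y1_def using field10_part10[OF W] field10_conj_part01[OF W] X Y by blast+
  have dec: "X = X0 + conj_field X1" "Y = Y0 + conj_field Y1"
    by (simp_all add: X0_def X1_def Y0_def Y1_def fun_eq_iff part10_def part01_def algebra_simps)
  note f = field10_field
  have t10: "torsion nabla A B p = 0" if "field10 W A" "field10 W B" for A B
    by (rule torsion_zero10[OF zero W that p])
  have tm: "torsion nabla A (conj_field B) p = 0" "torsion nabla (conj_field B) A p = 0" if "field10 W A" "field10 W B" for A B
  proof -
    show *: "torsion nabla A (conj_field B) p = 0" by (rule torsion_mixed[OF W that p])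
    have "torsion nabla (conj_field B) A p = - torsion nabla A (conj_field B) p" by (rule torsion_antisym[OF W])
    then show "torsion nabla (conj_field B) A p = 0" using * by simp
  qed
  have tc: "torsion nabla (conj_field A) (conj_field B) p = 0" if "field10 W A" "field10 W B" for A B
    using torsion_conj_conj[OF W f[OF that(1)] f[OF that(2)] p] t10[OF that] by simp
  have split2: "torsion nabla A Y p = torsion nabla A Y0 p + torsion nabla A (conj_field Y1) p" if "field_on W A" for A
    unfolding dec(2)
    using torsion_add1[OF W f[OF Y01(1)] field_on_conj[OF f[OF Y01(2)]] that p]
      torsion_antisym[OF W, of A "Y0 + conj_field Y1" p] torsion_antisym[OF W, of A Y0 p]
      torsion_antisym[OF W, of A "conj_field Y1" p] by simp
  have "torsion nabla X Y p = torsion nabla X0 Y p + torsion nabla (conj_field X1) Y p"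
    unfolding dec(1) by (rule torsion_add1[OF W f[OF X01(1)] field_on_conj[OF f[OF X01(2)]] Y p])
  then show ?thesis
    unfolding split2[OF f[OF X01(1)]] split2[OF field_on_conj[OF f[OF X01(2)]]]
    using t10[OF X01(1) Y01(1)] tm(1)[OF X01(1) Y01(2)] tm(2)[OF Y01(1) X01(2)] tc[OF X01(2) Y01(2)] by simp
qed

text \<open>Without torsion [X,Y] = nabla_X Y - nabla_Y X. Since nabla commutes with J, the terms of
  the Nijenhuis tensor cancel in pairs, and d omega is zero as a sum of torsion terms.\<close>

theorem kaehler_of_quasi_positive:
  assumes "connected_space T" "compact_space T"
    and "parallel_curvature20 nabla" "second_ricci_quasi_positive nabla"
  shows kaehler
proof -
  have "\<forall>q\<in>topspace T. tor_norm_sq q = 0" using tor_norm_sq_zero[OF assms] by blast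
  note tz = torsion_zero[OF this]
  have "nijenhuis X Y p = 0"
    if W: "openin T W" and X: "field_on W X" and Y: "field_on W Y" and p: "p \<in> W" for W X Y p
  proof -
    note pT = mem_topspace[OF W p] and nf = nabla_field[OF W]
    have br: "bracket A B p = nabla A B p - nabla B A p" if "field_on W A" "field_on W B" for A B
      using tz[OF W that p] by (simp add: torsion_eq[OF W])
    have JX: "field_on W (J_field X)" and JY: "field_on W (J_field Y)" using field_on_J[OF W] X Y by blast+
    have t: "nabla A B p \<in> tangent_space p" if "field_on W A" "field_on W B" for A B
      using field_onD[OF nf[OF that] p] .
    note nJ = nabla_J[OF W _ _ p]
    have 1: "bracket (J_field X) (J_field Y) p = J p (nabla (J_field X) Y p) - J p (nabla (J_field Y) X p)"
      by (simp add: br[OF JX JY] nJ[OF JX Y] nJ[OF JY X])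
    have 2: "J p (bracket (J_field X) Y p) = J p (nabla (J_field X) Y p) + nabla Y X p"
      by (simp add: br[OF JX Y] nJ[OF Y X] J_diff[OF pT t[OF JX Y] J_closed[OF pT t[OF Y X]]] J_square[OF pT t[OF Y X]])
    have 3: "J p (bracket X (J_field Y) p) = - nabla X Y p - J p (nabla (J_field Y) X p)"
      by (simp add: br[OF X JY] nJ[OF X Y] J_diff[OF pT J_closed[OF pT t[OF X Y]] t[OF JY X]] J_square[OF pT t[OF X Y]])
    have "nijenhuis X Y p = bracket (J_field X) (J_field Y) p - J p (bracket (J_field X) Y p)
        - J p (bracket X (J_field Y) p) - bracket X Y p"
      by (simp add: nijenhuis_def J_field_def)
    then show ?thesis unfolding 1 2 3 br[OF X Y] by simp
  qed
  moreover have "ext_d fundamental_form X Y Z p = 0"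
    if W: "openin T W" and X: "field_on W X" and Y: "field_on W Y" and Z: "field_on W Z" and p: "p \<in> W" for W X Y Z p
    unfolding ext_d_fundamental_form[OF W X Y Z p] tz[OF W X Y p] tz[OF W X Z p] tz[OF W Y Z p]
    using fundamental_form_zero(1)[OF W mem_topspace[OF W p]] field_onD[OF X p] field_onD[OF Y p] field_onD[OF Z p] by simp
  ultimately show ?thesis
    unfolding kaehler_def integrable_structure_def by auto
qed

end

theorem theorem1p2:
  fixes T :: "'a topology" and A :: "('a, 'e::euclidean_space) chart set"
    and J :: "'a \<Rightarrow> 'a tvec \<Rightarrow> 'a tvec" and g :: "'a \<Rightarrow> 'a tvec \<Rightarrow> 'a tvec \<Rightarrow> complex"
    and n :: nat and nabla :: "'a vfield \<Rightarrow> 'a vfield \<Rightarrow> 'a vfield"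
  assumes "almost_hermitian_manifold T A J g n"
    and "compact_space T" and "connected_space T"
    and "almost_hermitian_manifold.quasi_kaehler T A J g"
    and "almost_hermitian_manifold.canonical_connection T A J g nabla"
    and "almost_hermitian_manifold.second_ricci_quasi_positive T A J g n nabla"
    and "almost_hermitian_manifold.parallel_curvature20 T A J g nabla"
  shows "almost_hermitian_manifold.kaehler T A J g"
proof -
  interpret almost_hermitian_manifold T A J g n by fact
  interpret quasi_kaehler_connection T A J g n nabla
    by unfold_locales (fact assms)+
  show ?thesis by (rule kaehler_of_quasi_positive) (fact assms)+
qed

end
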